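(* Let $\{Y_{n,i}\}_{1\le i\le n,\,n\ge1}$ be a triangular array of random vectors in $\mathbb{R}^d$ with constant mean (for each $n$, $\mathbb{E}[Y_{n,i}]$ does not depend on $i$), such that $\sup_{n,i}\max_{1\le j\le d}\|Y_{n,i,j}-\mathbb{E}[Y_{n,i,j}]\|_{\psi_1}<\mu$ for some finite $\mu$, and $\theta_r(Y_1^n)=O(r^{-\theta})$ (uniformly in $n$) for some $\theta>4$. Suppose the block length $b_n$ satisfies $b_n\to\infty$ and $b_n=o(n)$. Then the conditional law of the block multiplier sum $W_n^Y$ given $Y_1^n$ weakly approaches the law of $S_n^X$ in probability: for every bounded continuous $f:\mathbb{R}^d\to\mathbb{R}$, $$\mathbb{E}[f(W_n^Y)\mid Y_1^n]-\mathbb{E}[f(S_n^X)]\xrightarrow{P}0 .$$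
   Context: $Y_1^n=(Y_{n,1},\dots,Y_{n,n})$, $Y_i=Y_{n,i}$, $\bar Y_n=\frac1n\sum_{i=1}^nY_i$, and $S_n^X=\frac1{\sqrt n}\sum_{i=1}^n(Y_i-\mathbb{E}[Y_i])$. Blocks: $m=m_n=\lfloor n/b_n\rfloor$, $\mathcal{K}_l=\{(l-1)b_n+1,\dots,lb_n\}$ for $1\le l\le m$, $B_l=\sum_{i\in\mathcal{K}_l}(Y_i-\bar Y_n)$, and $W_n^Y=\frac1{\sqrt n}\sum_{l=1}^me_lB_l$, where $e_1,e_2,\dots$ are i.i.d. $N(0,1)$ independent of the $Y$'s. Sub-exponential norm: $\|X\|_{\psi_1}=\sup_{p\ge1}p^{-1}(\mathbb{E}|X|^p)^{1/p}$. $\theta$-coefficient: for random vectors $Y_1,\dots,Y_n$ in $\mathbb{R}^d$, $$\theta_r(Y_1^n)=\max_{1\le l\le n-r}\ \max_{v}\ \frac1{|v|}\sup_{g}\big\|\mathbb{E}[g((Y_j)_{j\in v})\mid\sigma(Y_1,\dots,Y_l)]-\mathbb{E}[g((Y_j)_{j\in v})]\big\|_1,$$ where $v$ ranges over non-empty subsets of $\{l+r,\dots,n\}$ and $g$ over real functions on $(\mathbb{R}^d)^{|v|}$ that are 1-Lipschitz for the sup-norm. *)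

theory Defs
  imports "HOL-Probability.Probability"
begin

definition gen_sigma :: "'a measure \<Rightarrow> 'i set \<Rightarrow> ('i \<Rightarrow> 'a \<Rightarrow> 'b::topological_space) \<Rightarrow> 'a measure" where
  "gen_sigma M I X = vimage_algebra (space M) (\<lambda>\<omega>. \<lambda>i\<in>I. X i \<omega>) (PiM I (\<lambda>_. borel))"

text \<open>The supremum is taken in the extended half-line; it is infinite as soon as one of the
  moments is. Real exponents are used throughout.\<close>
definition psi1_norm :: "'a measure \<Rightarrow> ('a \<Rightarrow> real) \<Rightarrow> ennreal" where
  "psi1_norm M X =
     (SUP p\<in>{1..}.
        if integrable M (\<lambda>\<omega>. \<bar>X \<omega>\<bar> powr p)
        then ennreal (inverse p * (\<integral>\<omega>. \<bar>X \<omega>\<bar> powr p \<partial>M) powr (1 / p))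
        else \<infinity>)"

text \<open>Points of \<open>(R^d)^|v|\<close> are extensional functions on the index set \<open>v\<close>; the sup-norm is the
  maximum of the absolute values of all \<open>d |v|\<close> coordinates (\<open>infnorm\<close> is the sup-norm on \<open>R^d\<close>).\<close>
definition lipschitz1_sup :: "nat set \<Rightarrow> ((nat \<Rightarrow> real ^ 'd) \<Rightarrow> real) set" where
  "lipschitz1_sup v =
     {g. \<forall>x \<in> v \<rightarrow>\<^sub>E UNIV. \<forall>y \<in> v \<rightarrow>\<^sub>E UNIV.
           \<bar>g x - g y\<bar> \<le> Max ((\<lambda>j. infnorm (x j - y j)) ` v)}"

text \<open>The \<open>\<theta>\<close>-coefficient of \<open>Y 1, \<dots>, Y n\<close>. For \<open>r \<ge> n\<close> there is no admissible \<open>l\<close>, and the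
  coefficient is 0.\<close>
definition theta_coeff :: "'a measure \<Rightarrow> (nat \<Rightarrow> 'a \<Rightarrow> real ^ 'd) \<Rightarrow> nat \<Rightarrow> nat \<Rightarrow> ennreal" where
  "theta_coeff M Y n r =
     (SUP l\<in>{1..n - r}. SUP v\<in>{v. v \<noteq> {} \<and> v \<subseteq> {l + r..n}}.
        (SUP g\<in>lipschitz1_sup v.
           \<integral>\<^sup>+\<omega>. ennreal \<bar>real_cond_exp M (gen_sigma M {1..l} Y) (\<lambda>\<omega>'. g (\<lambda>j\<in>v. Y j \<omega>')) \<omega>
                          - (\<integral>\<omega>'. g (\<lambda>j\<in>v. Y j \<omega>') \<partial>M)\<bar> \<partial>M)
        / of_nat (card v))"

definition centered_sum :: "'a measure \<Rightarrow> (nat \<Rightarrow> 'a \<Rightarrow> real ^ 'd) \<Rightarrow> nat \<Rightarrow> 'a \<Rightarrow> real ^ 'd" where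
  "centered_sum M Y n \<omega> = (1 / sqrt (real n)) *\<^sub>R (\<Sum>i=1..n. Y i \<omega> - (\<integral>\<omega>'. Y i \<omega>' \<partial>M))"

definition sample_mean :: "(nat \<Rightarrow> 'a \<Rightarrow> real ^ 'd) \<Rightarrow> nat \<Rightarrow> 'a \<Rightarrow> real ^ 'd" where
  "sample_mean Y n \<omega> = (1 / real n) *\<^sub>R (\<Sum>i=1..n. Y i \<omega>)"

definition block :: "nat \<Rightarrow> nat \<Rightarrow> nat set" where
  "block b l = {(l - 1) * b + 1..l * b}"

definition block_sum :: "(nat \<Rightarrow> 'a \<Rightarrow> real ^ 'd) \<Rightarrow> nat \<Rightarrow> nat \<Rightarrow> nat \<Rightarrow> 'a \<Rightarrow> real ^ 'd" where
  "block_sum Y n b l \<omega> = (\<Sum>i\<in>block b l. Y i \<omega> - sample_mean Y n \<omega>)"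

definition multiplier_sum ::
  "(nat \<Rightarrow> 'a \<Rightarrow> real ^ 'd) \<Rightarrow> (nat \<Rightarrow> 'a \<Rightarrow> real) \<Rightarrow> nat \<Rightarrow> nat \<Rightarrow> 'a \<Rightarrow> real ^ 'd" where
  "multiplier_sum Y e n b \<omega> =
     (1 / sqrt (real n)) *\<^sub>R (\<Sum>l=1..n div b. e l \<omega> *\<^sub>R block_sum Y n b l \<omega>)"

definition converges_in_prob :: "'a measure \<Rightarrow> (nat \<Rightarrow> 'a \<Rightarrow> real) \<Rightarrow> real \<Rightarrow> bool" where
  "converges_in_prob M Z c \<longleftrightarrow>
     (\<forall>\<epsilon>>0. (\<lambda>n. measure M {\<omega> \<in> space M. \<epsilon> < \<bar>Z n \<omega> - c\<bar>}) \<longlonglongrightarrow> 0)"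

end

theory Submission
  imports Defs "HOL-Real_Asymp.Real_Asymp"
begin

text \<open>
Conditionally on the data, \<open>t \<bullet> W\<close> is a centred Gaussian with variance
\<open>V t = (1/n) \<Sum>l (t \<bullet> B\<^sub>l)\<^sup>2\<close>, so its characteristic function is \<open>exp (- V t / 2)\<close>. For fixed \<open>t\<close> the
projections \<open>t \<bullet> (Y i - E (Y i))\<close> form a real weakly dependent array, and two facts about such arrays
make this close in \<open>L\<^sup>1\<close> to the characteristic function of \<open>S\<close>, although the variances need not converge:
a central limit theorem \<open>E (exp (i t \<bullet> S)) - exp (- Var (t \<bullet> S) / 2) \<longlonglongrightarrow> 0\<close> by Bernstein's big and small
blocks, and \<open>V t - Var (t \<bullet> S) \<longlonglongrightarrow> 0\<close> in \<open>L\<^sup>1\<close>. The second fact needs uniform integrability of the squared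
normalised block sums; this comes from the central limit theorem applied inside each block, with
\<open>x\<^sup>2\<close> replaced by the bounded function \<open>2 K\<^sup>2 (1 - cos (x / K))\<close>. Finally the test function is smoothed by a
Gaussian kernel, itself a mixture of characters, which turns the convergence of characteristic
functions into the claim; tightness is only needed for \<open>S\<close>.
\<close>

text \<open>The \<theta>-coefficient controls only covariances between a bounded variable of the
  past and a Lipschitz function of later terms, at the price of the bound times the Lipschitz
  constant. The square of a block sum is neither bounded nor Lipschitz, so no sharp moments of sums
  beyond the second are available; second moments reduce to pairwise covariances, where clipping one
  factor is enough. This is why squared block sums are truncated and the truncation error is
  computed from their characteristic function instead of from a fourth moment. Of the decay rate
  only \<open>r ^ 4\<close> in the denominator is kept. The covariance bound grows with the square
  of the number of terms: one power undoes the normalisation by \<open>card v\<close> in the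
  coefficient, the other is the Lipschitz constant of a sum in the sup-norm. With at most
  \<open>N / p\<close> blocks of length \<open>p\<close>, gaps \<open>q\<close> and a frequency of
  order \<open>1 / sqrt N\<close>, the dependence between blocks therefore costs
  \<open>sqrt N * p / q ^ 4\<close> in total, and the third moments of blocks, estimated without
  cancellation, cost \<open>p^2 / sqrt N\<close>.\<close>

declare One_nat_def [simp del]

section \<open>Elementary inequalities\<close>

lemma abs_mult_le_sum_squares: "\<bar>x * y\<bar> \<le> x\<^sup>2 + y\<^sup>2" for x y :: real
proof -
  have "0 \<le> (\<bar>x\<bar> - \<bar>y\<bar>)\<^sup>2 + x\<^sup>2 + y\<^sup>2" by simp
  then show ?thesis by (simp add: power2_diff abs_mult)
qed

lemma square_le_one_plus_fourth: "x\<^sup>2 \<le> 1 + x ^ 4" for x :: real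
  using abs_mult_le_sum_squares[of "x\<^sup>2" 1] by (simp add: power_mult[symmetric])

text \<open>Cauchy-Schwarz with upper bounds \<open>a\<close> and \<open>b\<close> in place of the
  two second moments, so that moment estimates can be inserted directly.\<close>

lemma integral_abs_mult_le_sqrt:
  fixes f g :: "'a \<Rightarrow> real"
  assumes [measurable]: "f \<in> borel_measurable M" "g \<in> borel_measurable M"
    and f: "integrable M (\<lambda>x. (f x)\<^sup>2)" and g: "integrable M (\<lambda>x. (g x)\<^sup>2)"
    and a: "(\<integral>x. (f x)\<^sup>2 \<partial>M) \<le> a" and b: "(\<integral>x. (g x)\<^sup>2 \<partial>M) \<le> b"
  shows "integrable M (\<lambda>x. f x * g x)" "(\<integral>x. \<bar>f x * g x\<bar> \<partial>M) \<le> sqrt (a * b)"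
proof -
  show i: "integrable M (\<lambda>x. f x * g x)"
  proof (rule Bochner_Integration.integrable_bound[OF Bochner_Integration.integrable_add[OF f g]])
    show "AE x in M. norm (f x * g x) \<le> norm ((f x)\<^sup>2 + (g x)\<^sup>2)"
      using abs_mult_le_sum_squares by simp
  qed simp
  have "(\<integral>\<^sup>+x. ennreal \<bar>f x\<bar> * ennreal \<bar>g x\<bar> \<partial>M)\<^sup>2
      \<le> (\<integral>\<^sup>+x. (ennreal \<bar>f x\<bar>)^2 \<partial>M) * (\<integral>\<^sup>+x. (ennreal \<bar>g x\<bar>)^2 \<partial>M)"
    by (rule Cauchy_Schwarz_nn_integral) simp_all
  also have "(\<integral>\<^sup>+x. ennreal \<bar>f x\<bar> * ennreal \<bar>g x\<bar> \<partial>M) = ennreal (\<integral>x. \<bar>f x * g x\<bar> \<partial>M)"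
    by (subst nn_integral_eq_integral[symmetric]) (use i in \<open>auto simp: abs_mult[symmetric] ennreal_mult[symmetric] intro: integrable_abs\<close>)
  also have "(\<integral>\<^sup>+x. (ennreal \<bar>f x\<bar>)^2 \<partial>M) = ennreal (\<integral>x. (f x)\<^sup>2 \<partial>M)"
    by (subst nn_integral_eq_integral[symmetric]) (use f in \<open>simp_all add: ennreal_power\<close>)
  also have "(\<integral>\<^sup>+x. (ennreal \<bar>g x\<bar>)^2 \<partial>M) = ennreal (\<integral>x. (g x)\<^sup>2 \<partial>M)"
    by (subst nn_integral_eq_integral[symmetric]) (use g in \<open>simp_all add: ennreal_power\<close>)
  finally have "(\<integral>x. \<bar>f x * g x\<bar> \<partial>M)\<^sup>2 \<le> (\<integral>x. (f x)\<^sup>2 \<partial>M) * (\<integral>x. (g x)\<^sup>2 \<partial>M)"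
    by (simp add: ennreal_power ennreal_mult[symmetric])
  also have "\<dots> \<le> a * b"
    using a b by (intro mult_mono order_trans[OF _ a] integral_nonneg_AE) auto
  finally show "(\<integral>x. \<bar>f x * g x\<bar> \<partial>M) \<le> sqrt (a * b)"
    by (rule real_le_rsqrt)
qed

lemma (in prob_space) expectation_abs_le_sqrt:
  fixes f :: "'a \<Rightarrow> real"
  assumes "f \<in> borel_measurable M" "integrable M (\<lambda>x. (f x)\<^sup>2)" "(\<integral>x. (f x)\<^sup>2 \<partial>M) \<le> a"
  shows "integrable M f" "(\<integral>x. \<bar>f x\<bar> \<partial>M) \<le> sqrt a"
  using integral_abs_mult_le_sqrt[of f M "\<lambda>_. 1" a 1] assms by (simp_all add: prob_space)

text \<open>Telescoping of \<open>1 / m - 1 / (m + 1)\<close>. It turns a covariance decay of order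
  \<open>1 / r^2\<close> into a tail of order \<open>1 / u\<close> beyond distance
  \<open>u\<close>.\<close>

lemma sum_inverse_squares_le:
  assumes "1 \<le> u" "finite J" "J \<subseteq> {u..}"
  shows "(\<Sum>r\<in>J. 1 / (real r)\<^sup>2) \<le> 2 / real u"
proof -
  have *: "(\<Sum>r=u..m. 1 / (real r)\<^sup>2) \<le> 2 / real u - 1 / real m" if "u \<le> m" for m
    using that
  proof (induction m rule: dec_induct)
    case base
    have "1 / (real u)\<^sup>2 \<le> 1 / real u" using assms(1) by (simp add: field_simps power2_eq_square)
    then show ?case by simp
  next
    case (step m)
    have "1 / (real (Suc m))\<^sup>2 \<le> 1 / (real m * real (Suc m))"
      using step assms(1) unfolding power2_eq_square
      by (intro divide_left_mono mult_right_mono) auto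
    also have "\<dots> = 1 / real m - 1 / real (Suc m)"
      using step assms(1) by (simp add: field_simps)
    finally have "1 / (real (Suc m))\<^sup>2 \<le> 1 / real m - 1 / real (Suc m)" .
    then show ?case using step by simp
  qed
  define m where "m = Max (insert u J)"
  have "u \<le> m" unfolding m_def using assms by (intro Max_ge) auto
  have "(\<Sum>r\<in>J. 1 / (real r)\<^sup>2) \<le> (\<Sum>r=u..m. 1 / (real r)\<^sup>2)"
    using assms by (intro sum_mono2) (auto simp: m_def)
  also have "\<dots> \<le> 2 / real u" using *[OF \<open>u \<le> m\<close>] by (smt (verit) divide_nonneg_nonneg of_nat_0_le_iff)
  finally show ?thesis .
qed

text \<open>The true order is logarithmic. A square root is good enough, because the sum arises once
  per block of length \<open>p\<close> and is compared with \<open>p\<close>.\<close>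

lemma sum_inverse_le_sqrt: "(\<Sum>u=1..p. 1 / real u) \<le> 2 * sqrt (real p)"
proof (induction p)
  case (Suc p)
  define s t where "s = sqrt (real p)" and "t = sqrt (real (Suc p))"
  have st: "s\<^sup>2 + 1 = t\<^sup>2" "0 \<le> s" "1 \<le> t" by (simp_all add: s_def t_def)
  have "1 / t\<^sup>2 \<le> 2 * (t - s)"
  proof -
    have "1 = (t - s) * (t + s)" using st by (simp add: algebra_simps power2_eq_square)
    also have "\<dots> \<le> (t - s) * (2 * t\<^sup>2)"
    proof (rule mult_left_mono)
      show ts: "0 \<le> t - s" using st by (smt (verit) power2_le_imp_le)
      have "t \<le> t\<^sup>2" using st by (simp add: power2_eq_square)
      then show "t + s \<le> 2 * t\<^sup>2" using ts by linarith
    qed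
    finally show ?thesis using st by (simp add: field_simps)
  qed
  then show ?case using Suc by (simp add: s_def t_def del: of_nat_Suc)
qed simp

text \<open>Two applications of Cauchy-Schwarz, the second to the squares.\<close>

lemma sum_fourth_le:
  fixes x :: "'i \<Rightarrow> real"
  shows "(\<Sum>i\<in>v. x i) ^ 4 \<le> (real (card v)) ^ 3 * (\<Sum>i\<in>v. x i ^ 4)"
proof -
  have "(\<Sum>i\<in>v. x i) ^ 4 = ((\<Sum>i\<in>v. x i)\<^sup>2)\<^sup>2" by simp
  also have "\<dots> \<le> ((\<Sum>i\<in>v. (x i)\<^sup>2) * real (card v))\<^sup>2"
    by (intro power_mono sum_squared_le_sum_of_squares) auto
  also have "\<dots> = (\<Sum>i\<in>v. (x i)\<^sup>2)\<^sup>2 * (real (card v))\<^sup>2" by (simp add: power_mult_distrib)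
  also have "\<dots> \<le> ((\<Sum>i\<in>v. ((x i)\<^sup>2)\<^sup>2) * real (card v)) * (real (card v))\<^sup>2"
    by (intro mult_right_mono sum_squared_le_sum_of_squares) auto
  finally show ?thesis by (simp add: power_mult[symmetric] power3_eq_cube power2_eq_square[of "real (card v)"] mult_ac)
qed

lemma abs_cos_diff_le: "\<bar>cos a - cos b\<bar> \<le> \<bar>a - b\<bar>" for a b :: real
proof -
  have "\<bar>cos a - cos b\<bar> = \<bar>2 * sin ((a + b) / 2) * sin ((b - a) / 2)\<bar>" by (simp add: cos_diff_cos)
  also have "\<dots> \<le> 2 * 1 * \<bar>(b - a) / 2\<bar>"
    unfolding abs_mult using abs_sin_x_le_abs_x[of "(b - a) / 2"] by (intro mult_mono) auto
  finally show ?thesis by simp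
qed

lemma abs_sin_diff_le: "\<bar>sin a - sin b\<bar> \<le> \<bar>a - b\<bar>" for a b :: real
proof -
  have "\<bar>sin a - sin b\<bar> = \<bar>2 * sin ((a - b) / 2) * cos ((a + b) / 2)\<bar>" by (simp add: sin_diff_sin)
  also have "\<dots> \<le> 2 * \<bar>(a - b) / 2\<bar> * 1"
    unfolding abs_mult using abs_sin_x_le_abs_x[of "(a - b) / 2"] by (intro mult_mono) auto
  finally show ?thesis by simp
qed

text \<open>The reciprocal of the quadratic lower bound of \<open>exp y\<close>: the product of
  \<open>1 - y + y^2 / 2\<close> and \<open>1 + y + y^2 / 2\<close> is \<open>1 + y ^ 4 / 4\<close>,
  hence at least 1.\<close>

lemma exp_minus_le_Taylor:
  fixes y :: real
  assumes "0 \<le> y"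
  shows "exp (- y) \<le> 1 - y + y\<^sup>2 / 2"
proof -
  have "inverse (exp y) \<le> inverse (1 + y + y\<^sup>2 / 2)"
    using exp_lower_Taylor_quadratic[OF assms] assms by (intro le_imp_inverse_le) (auto simp: add_pos_nonneg)
  also have "\<dots> \<le> 1 - y + y\<^sup>2 / 2"
  proof -
    have "1 \<le> (1 - y + y\<^sup>2 / 2) * (1 + y + y\<^sup>2 / 2)"
      using assms by (simp add: algebra_simps power2_eq_square)
    then show ?thesis using assms by (simp add: inverse_eq_divide divide_le_eq add_pos_nonneg)
  qed
  finally show ?thesis by (simp add: exp_minus)
qed

lemma exp_minus_diff_le:
  fixes x y :: real
  assumes "0 \<le> x" "0 \<le> y"
  shows "\<bar>exp (- x) - exp (- y)\<bar> \<le> \<bar>x - y\<bar>"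
proof -
  have *: "exp (- a) - exp (- b) \<le> b - a" if "0 \<le> a" "a \<le> b" for a b :: real
  proof -
    have "exp (- a) - exp (- b) = exp (- a) * (1 - exp (a - b))" by (simp add: algebra_simps exp_add[symmetric])
    also have "\<dots> \<le> 1 * (b - a)"
    proof (intro mult_mono)
      show "1 - exp (a - b) \<le> b - a" using exp_ge_add_one_self[of "a - b"] by linarith
    qed (use that in auto)
    finally show ?thesis by simp
  qed
  show ?thesis using *[of x y] *[of y x] assms by (cases "x \<le> y") auto
qed

lemma iexp_diff_le: "cmod (iexp x - iexp y) \<le> \<bar>x - y\<bar>"
proof -
  have "cmod (iexp x - iexp y) = cmod (iexp y * (iexp (x - y) - 1))"
    by (simp add: algebra_simps exp_add[symmetric])
  also have "\<dots> \<le> \<bar>x - y\<bar>"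
    using iexp_approx1[of "x - y" 0] by (simp add: norm_mult One_nat_def)
  finally show ?thesis .
qed

lemma cmod_integral_iexp_le_1:
  assumes "prob_space M" and "f \<in> borel_measurable M"
  shows "cmod (\<integral>\<omega>. iexp (f \<omega>) \<partial>M) \<le> 1"
proof -
  interpret prob_space M by fact
  have "cmod (\<integral>\<omega>. iexp (f \<omega>) \<partial>M) \<le> (\<integral>\<omega>. cmod (iexp (f \<omega>)) \<partial>M)" by (rule integral_norm_bound)
  then show ?thesis by (simp add: prob_space)
qed

subsection \<open>Second moments of sums of weakly dependent variables\<close>

text \<open>The limit theorems see the dependence only as a covariance inequality for a bounded past
  variable \<open>H\<close> against a Lipschitz function of one sum over future indices; conditional
  expectations do not occur. \<open>A\<close> and \<open>C\<close> carry all constants, so every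
  bound is uniform over the instances. The index range is finite because a row of a triangular array
  ends, and the notion is stable under passing to an interval of indices, which is how blocks are
  treated.\<close>

locale weakly_dependent = prob_space M for M :: "'a measure" +
  fixes F :: "nat \<Rightarrow> 'a measure" and X :: "nat \<Rightarrow> 'a \<Rightarrow> real" and N :: nat and A C :: real
  assumes subalg: "\<And>i. subalgebra M (F i)"
    and filtration: "\<And>i j. i \<le> j \<Longrightarrow> sets (F i) \<subseteq> sets (F j)"
    and adapted: "\<And>i. i \<in> {1..N} \<Longrightarrow> X i \<in> borel_measurable (F i)"
    and moment_integrable: "\<And>i. i \<in> {1..N} \<Longrightarrow> integrable M (\<lambda>\<omega>. X i \<omega> ^ 4)"
    and moment_le: "\<And>i. i \<in> {1..N} \<Longrightarrow> expectation (\<lambda>\<omega>. X i \<omega> ^ 4) \<le> A"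
    and centered: "\<And>i. i \<in> {1..N} \<Longrightarrow> expectation (X i) = 0"
    and nonneg: "0 \<le> A" "0 \<le> C"
    and dependence: "\<And>l r v H \<psi> K L. 1 \<le> l \<Longrightarrow> 1 \<le> r \<Longrightarrow> v \<noteq> {} \<Longrightarrow> v \<subseteq> {l + r..N} \<Longrightarrow>
      H \<in> borel_measurable (F l) \<Longrightarrow> (\<And>\<omega>. \<omega> \<in> space M \<Longrightarrow> \<bar>H \<omega>\<bar> \<le> K) \<Longrightarrow>
      0 < L \<Longrightarrow> (\<And>x y. \<bar>\<psi> x - \<psi> y\<bar> \<le> L * \<bar>x - y\<bar>) \<Longrightarrow>
      \<bar>expectation (\<lambda>\<omega>. H \<omega> * \<psi> (\<Sum>i\<in>v. X i \<omega>))
        - expectation H * expectation (\<lambda>\<omega>. \<psi> (\<Sum>i\<in>v. X i \<omega>))\<bar>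
      \<le> C * K * L * (real (card v))\<^sup>2 / real r ^ 4"
begin

definition S :: "nat set \<Rightarrow> 'a \<Rightarrow> real" where
  "S v \<omega> = (\<Sum>i\<in>v. X i \<omega>)"

text \<open>One constant for two purposes: it dominates \<open>C + 2 * A\<close>, which governs
  covariances at positive lag, and \<open>1 + A\<close>, which bounds variances.\<close>

definition D :: real where
  "D = 1 + 3 * A + C"

lemma D_ge_1: "1 \<le> D"
  using nonneg by (simp add: D_def)

lemma space_F [simp]: "space (F i) = space M"
  using subalg by (simp add: subalgebra_def)

lemma X_measurable [measurable]: "i \<in> {1..N} \<Longrightarrow> X i \<in> borel_measurable M"
  using adapted measurable_from_subalg[OF subalg] by blast

lemma X_measurable_F: "i \<in> {1..N} \<Longrightarrow> i \<le> l \<Longrightarrow> X i \<in> borel_measurable (F l)"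
  by (rule measurable_from_subalg[OF _ adapted]) (simp_all add: subalgebra_def filtration)

lemma S_measurable_F: "v \<subseteq> {1..N} \<Longrightarrow> v \<subseteq> {..l} \<Longrightarrow> S v \<in> borel_measurable (F l)"
  unfolding S_def[abs_def] by (intro borel_measurable_sum X_measurable_F) auto

lemma S_measurable [measurable (raw)]: "v \<subseteq> {1..N} \<Longrightarrow> S v \<in> borel_measurable M"
  unfolding S_def[abs_def] by (intro borel_measurable_sum X_measurable) auto

lemma X_integrable_product:
  assumes "i \<in> {1..N}" "j \<in> {1..N}"
  shows "integrable M (\<lambda>\<omega>. X i \<omega> * X j \<omega>)"
proof (rule Bochner_Integration.integrable_bound)
  show "integrable M (\<lambda>\<omega>. 2 + X i \<omega> ^ 4 + X j \<omega> ^ 4)"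
    using moment_integrable[OF assms(1)] moment_integrable[OF assms(2)] by simp
  have "\<bar>x * y\<bar> \<le> 2 + x ^ 4 + y ^ 4" for x y :: real
  proof -
    show ?thesis
      using abs_mult_le_sum_squares[of x y] square_le_one_plus_fourth[of x]
        square_le_one_plus_fourth[of y] by linarith
  qed
  then show "AE \<omega> in M. norm (X i \<omega> * X j \<omega>) \<le> norm (2 + X i \<omega> ^ 4 + X j \<omega> ^ 4)"
    by simp
qed (use assms in measurable)

lemma X_square_integrable: "i \<in> {1..N} \<Longrightarrow> integrable M (\<lambda>\<omega>. (X i \<omega>)\<^sup>2)"
  using X_integrable_product[of i i] by (simp add: power2_eq_square)

lemma X_integrable: "i \<in> {1..N} \<Longrightarrow> integrable M (X i)"
  using expectation_abs_le_sqrt(1)[OF X_measurable X_square_integrable order_refl] by blast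

lemma S_product:
  "S v \<omega> * S w \<omega> = (\<Sum>i\<in>v. \<Sum>j\<in>w. X i \<omega> * X j \<omega>)"
  by (simp add: S_def sum_product)

lemma S_integrable_product:
  "v \<subseteq> {1..N} \<Longrightarrow> w \<subseteq> {1..N} \<Longrightarrow> integrable M (\<lambda>\<omega>. S v \<omega> * S w \<omega>)"
  unfolding S_product by (intro Bochner_Integration.integrable_sum X_integrable_product) auto

lemma S_square_integrable: "v \<subseteq> {1..N} \<Longrightarrow> integrable M (\<lambda>\<omega>. (S v \<omega>)\<^sup>2)"
  using S_integrable_product[of v v] by (simp add: power2_eq_square)

lemma S_integrable: "v \<subseteq> {1..N} \<Longrightarrow> integrable M (S v)"
  unfolding S_def[abs_def] by (intro Bochner_Integration.integrable_sum X_integrable) auto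

lemma S_expectation: "v \<subseteq> {1..N} \<Longrightarrow> expectation (S v) = 0"
  unfolding S_def[abs_def]
  by (subst Bochner_Integration.integral_sum)
     (auto intro!: X_integrable sum.neutral centered)

lemma S_product_expectation:
  "v \<subseteq> {1..N} \<Longrightarrow> w \<subseteq> {1..N} \<Longrightarrow>
    expectation (\<lambda>\<omega>. S v \<omega> * S w \<omega>) = (\<Sum>i\<in>v. \<Sum>j\<in>w. expectation (\<lambda>\<omega>. X i \<omega> * X j \<omega>))"
  unfolding S_product
  by (subst Bochner_Integration.integral_sum, 
      (auto intro!: Bochner_Integration.integrable_sum X_integrable_product)[1])
     (intro sum.cong refl Bochner_Integration.integral_sum, auto intro!: X_integrable_product)

text \<open>\<open>dependence\<close> accepts a bounded factor only, so \<open>X i\<close> is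
  clipped at \<open>T\<close> to give \<open>H\<close>, while \<open>X j\<close> enters through the
  identity, which is Lipschitz although unbounded. The clipped part costs
  \<open>C * T / r ^ 4 = C / T ^ 3\<close>; the part cut off costs \<open>2 * A / T^2\<close> by
  fourth moments.\<close>

lemma covariance_bound_less:
  assumes "i \<in> {1..N}" "j \<in> {1..N}" "i < j"
  shows "\<bar>expectation (\<lambda>\<omega>. X i \<omega> * X j \<omega>)\<bar> \<le> (C + 2 * A) / (real (j - i))\<^sup>2"
proof -
  define r where "r = j - i"
  define T where "T = real r"
  have r: "1 \<le> r" and T: "1 \<le> T" using assms by (auto simp: r_def T_def)
  \<comment> \<open>the lag itself is a good enough truncation level\<close>
  define H where "H \<omega> = max (- T) (min T (X i \<omega>))" for \<omega>
  have H_F: "H \<in> borel_measurable (F i)"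
    unfolding H_def[abs_def] using adapted[OF assms(1)] by measurable
  have H[measurable]: "H \<in> borel_measurable M"
    using measurable_from_subalg[OF subalg H_F] .
  have Hb: "\<bar>H \<omega>\<bar> \<le> T" for \<omega> using T by (auto simp: H_def)
  have "\<bar>expectation (\<lambda>\<omega>. H \<omega> * (\<lambda>x. x) (\<Sum>i\<in>{j}. X i \<omega>))
      - expectation H * expectation (\<lambda>\<omega>. (\<lambda>x. x) (\<Sum>i\<in>{j}. X i \<omega>))\<bar>
      \<le> C * T * 1 * (real (card {j}))\<^sup>2 / real r ^ 4"
    by (rule dependence[where l = i]) (use assms r H_F Hb in \<open>auto simp: r_def\<close>)
  then have 1: "\<bar>expectation (\<lambda>\<omega>. H \<omega> * X j \<omega>)\<bar> \<le> C / T ^ 3"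
    using T centered[OF assms(2)] by (simp add: T_def field_simps power4_eq_xxxx power3_eq_cube power2_eq_square)
  have HX: "integrable M (\<lambda>\<omega>. H \<omega> * X j \<omega>)"
    using X_integrable[OF assms(2)] Hb
    by (intro Bochner_Integration.integrable_bound[OF integrable_mult_right[of T, OF X_integrable[OF assms(2)]]])
       (use assms T in \<open>auto simp: abs_mult intro!: mult_mono\<close>)
  have XX: "integrable M (\<lambda>\<omega>. X i \<omega> * X j \<omega>)"
    using assms by (intro X_integrable_product)
  have pt: "\<bar>X i \<omega> * X j \<omega> - H \<omega> * X j \<omega>\<bar> \<le> (X i \<omega> ^ 4 + X j \<omega> ^ 4) / T\<^sup>2" for \<omega>
  proof -
    define x y where "x = \<bar>X i \<omega>\<bar>" and "y = \<bar>X j \<omega>\<bar>"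
    \<comment> \<open>Clipping changes \<open>X i\<close> only where \<open>x > T\<close>; there the
      change is at most \<open>x\<close>, and \<open>T^2\<close> is at most
      \<open>x^2\<close>.\<close>
    have d: "T\<^sup>2 * \<bar>X i \<omega> - H \<omega>\<bar> \<le> x ^ 3"
    proof (cases "x \<le> T")
      case True then show ?thesis by (auto simp: H_def x_def)
    next
      case False
      have "T\<^sup>2 * \<bar>X i \<omega> - H \<omega>\<bar> \<le> x\<^sup>2 * x"
        using False T by (intro mult_mono power_mono) (auto simp: H_def x_def)
      then show ?thesis by (simp add: power4_eq_xxxx power3_eq_cube power2_eq_square)
    qed
    have xy: "x ^ 3 * y \<le> x ^ 4 + y ^ 4"
    proof (cases "x \<le> y")
      case True
      have "x ^ 3 * y \<le> y ^ 3 * y" using True by (intro mult_right_mono power_mono) (auto simp: x_def y_def)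
      also have "\<dots> = y ^ 4" by (simp add: power4_eq_xxxx power3_eq_cube)
      finally show ?thesis by (simp add: add_increasing)
    next
      case False
      have "x ^ 3 * y \<le> x ^ 3 * x" using False by (intro mult_left_mono) (auto simp: x_def y_def)
      also have "\<dots> = x ^ 4" by (simp add: power4_eq_xxxx power3_eq_cube)
      finally show ?thesis by (simp add: add_increasing2)
    qed
    have "T\<^sup>2 * (\<bar>X i \<omega> - H \<omega>\<bar> * y) \<le> x ^ 3 * y"
      using mult_right_mono[OF d, of y] by (simp add: y_def mult.assoc)
    with xy have "T\<^sup>2 * (\<bar>X i \<omega> - H \<omega>\<bar> * y) \<le> x ^ 4 + y ^ 4" by linarith
    then have "T\<^sup>2 * \<bar>X i \<omega> * X j \<omega> - H \<omega> * X j \<omega>\<bar> \<le> X i \<omega> ^ 4 + X j \<omega> ^ 4"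
      unfolding x_def y_def by (simp add: abs_mult[symmetric] left_diff_distrib)
    then show ?thesis using T by (simp add: field_simps)
  qed
  have "\<bar>expectation (\<lambda>\<omega>. X i \<omega> * X j \<omega>) - expectation (\<lambda>\<omega>. H \<omega> * X j \<omega>)\<bar>
     = \<bar>expectation (\<lambda>\<omega>. X i \<omega> * X j \<omega> - H \<omega> * X j \<omega>)\<bar>"
    using HX XX by simp
  also have "\<dots> \<le> expectation (\<lambda>\<omega>. \<bar>X i \<omega> * X j \<omega> - H \<omega> * X j \<omega>\<bar>)"
    by (rule integral_abs_bound)
  also have "\<dots> \<le> expectation (\<lambda>\<omega>. (X i \<omega> ^ 4 + X j \<omega> ^ 4) / T\<^sup>2)"
    using HX XX pt moment_integrable[OF assms(1)] moment_integrable[OF assms(2)]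
    by (intro integral_mono) auto
  also have "\<dots> \<le> 2 * A / T\<^sup>2"
    using moment_integrable[OF assms(1)] moment_integrable[OF assms(2)]
      moment_le[OF assms(1)] moment_le[OF assms(2)] T by (simp add: divide_right_mono)
  finally have "\<bar>expectation (\<lambda>\<omega>. X i \<omega> * X j \<omega>)\<bar> \<le> C / T ^ 3 + 2 * A / T\<^sup>2"
    using 1 by linarith
  also have "C / T ^ 3 \<le> C / T\<^sup>2"
    using T nonneg by (intro divide_left_mono power_increasing) auto
  finally show ?thesis by (simp add: T_def r_def add_divide_distrib)
qed

lemma second_moment_le: "i \<in> {1..N} \<Longrightarrow> expectation (\<lambda>\<omega>. (X i \<omega>)\<^sup>2) \<le> 1 + A"
proof -
  assume i: "i \<in> {1..N}"
  have "expectation (\<lambda>\<omega>. (X i \<omega>)\<^sup>2) \<le> expectation (\<lambda>\<omega>. 1 + X i \<omega> ^ 4)"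
    using i square_le_one_plus_fourth by (intro integral_mono X_square_integrable) (auto intro!: moment_integrable)
  also have "\<dots> \<le> 1 + A" using moment_integrable[OF i] moment_le[OF i] by (simp add: prob_space)
  finally show ?thesis .
qed

lemma covariance_bound:
  assumes "i \<in> {1..N}" "j \<in> {1..N}"
  shows "i \<noteq> j \<Longrightarrow> \<bar>expectation (\<lambda>\<omega>. X i \<omega> * X j \<omega>)\<bar> \<le> D * (1 / (real (if i < j then j - i else i - j))\<^sup>2)"
    and "\<bar>expectation (\<lambda>\<omega>. X i \<omega> * X i \<omega>)\<bar> \<le> D"
proof -
  have m: "(C + 2 * A) / z\<^sup>2 \<le> D * (1 / z\<^sup>2)" for z :: real
    using nonneg by (simp add: D_def divide_right_mono)
  show "\<bar>expectation (\<lambda>\<omega>. X i \<omega> * X j \<omega>)\<bar> \<le> D * (1 / (real (if i < j then j - i else i - j))\<^sup>2)" if "i \<noteq> j"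
  proof (cases "i < j")
    case True
    then show ?thesis using covariance_bound_less[OF assms True] m[of "real (j - i)"] by (simp del: of_nat_diff)
  next
    case False
    then have "j < i" using that by simp
    then show ?thesis using covariance_bound_less[OF assms(2,1)] m[of "real (i - j)"] by (simp add: mult.commute del: of_nat_diff)
  qed
  have "0 \<le> expectation (\<lambda>\<omega>. (X i \<omega>)\<^sup>2)" by (rule integral_nonneg_AE) simp
  then show "\<bar>expectation (\<lambda>\<omega>. X i \<omega> * X i \<omega>)\<bar> \<le> D"
    using second_moment_le[OF assms(1)] nonneg by (simp add: power2_eq_square D_def)
qed

lemma covariance_sum_right:
  assumes "i \<in> {1..N}" "J \<subseteq> {1..N}" "1 \<le> u" "J \<subseteq> {i + u..}"
  shows "(\<Sum>j\<in>J. \<bar>expectation (\<lambda>\<omega>. X i \<omega> * X j \<omega>)\<bar>) \<le> 2 * D / real u"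
proof -
  have fin: "finite J" using assms(2) finite_subset by blast
  have ij: "i < j" if "j \<in> J" for j using that assms by force
  have "(\<Sum>j\<in>J. \<bar>expectation (\<lambda>\<omega>. X i \<omega> * X j \<omega>)\<bar>) \<le> (\<Sum>j\<in>J. D * (1 / (real (j - i))\<^sup>2))"
  proof (rule sum_mono)
    fix j assume "j \<in> J"
    then show "\<bar>expectation (\<lambda>\<omega>. X i \<omega> * X j \<omega>)\<bar> \<le> D * (1 / (real (j - i))\<^sup>2)"
      using covariance_bound(1)[of i j] ij[of j] assms(1,2) by (auto simp del: of_nat_diff)
  qed
  also have "\<dots> = D * (\<Sum>r\<in>(\<lambda>j. j - i) ` J. 1 / (real r)\<^sup>2)"
    by (subst sum.reindex) (auto simp: inj_on_def sum_distrib_left dest!: ij simp del: of_nat_diff)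
  also have "\<dots> \<le> D * (2 / real u)"
    using D_ge_1 fin assms(3,4) by (intro mult_left_mono sum_inverse_squares_le) auto
  finally show ?thesis by (simp add: mult.commute)
qed

lemma covariance_sum_left:
  assumes "i \<in> {1..N}" "J \<subseteq> {1..N}" "1 \<le> u" "\<And>j. j \<in> J \<Longrightarrow> j + u \<le> i"
  shows "(\<Sum>j\<in>J. \<bar>expectation (\<lambda>\<omega>. X i \<omega> * X j \<omega>)\<bar>) \<le> 2 * D / real u"
proof -
  have fin: "finite J" using assms(2) finite_subset by blast
  have ij: "j < i" if "j \<in> J" for j using that assms by force
  have "(\<Sum>j\<in>J. \<bar>expectation (\<lambda>\<omega>. X i \<omega> * X j \<omega>)\<bar>) \<le> (\<Sum>j\<in>J. D * (1 / (real (i - j))\<^sup>2))"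
  proof (rule sum_mono)
    fix j assume "j \<in> J"
    then show "\<bar>expectation (\<lambda>\<omega>. X i \<omega> * X j \<omega>)\<bar> \<le> D * (1 / (real (i - j))\<^sup>2)"
      using covariance_bound(1)[of i j] ij[of j] assms(1,2) by (auto simp del: of_nat_diff)
  qed
  also have "\<dots> = D * (\<Sum>r\<in>(\<lambda>j. i - j) ` J. 1 / (real r)\<^sup>2)"
    by (subst sum.reindex) (auto simp: inj_on_def sum_distrib_left dest!: ij simp del: of_nat_diff)
  also have "\<dots> \<le> D * (2 / real u)"
    using D_ge_1 fin assms(3,4) by (intro mult_left_mono sum_inverse_squares_le) force+
  finally show ?thesis by (simp add: mult.commute)
qed

text \<open>\<open>5 = 1 + 2 + 2\<close>: the diagonal term and the tails on both sides from
  distance 1 on.\<close>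

lemma covariance_row_sum:
  assumes "i \<in> {1..N}" "J \<subseteq> {1..N}"
  shows "(\<Sum>j\<in>J. \<bar>expectation (\<lambda>\<omega>. X i \<omega> * X j \<omega>)\<bar>) \<le> 5 * D"
proof -
  have fin: "finite J" using assms(2) finite_subset by blast
  let ?c = "\<lambda>j. \<bar>expectation (\<lambda>\<omega>. X i \<omega> * X j \<omega>)\<bar>"
  have J: "J = (J \<inter> {i}) \<union> (J \<inter> {i+1..}) \<union> (J \<inter> {..<i})" by auto
  have "sum ?c J = sum ?c (J \<inter> {i}) + sum ?c (J \<inter> {i+1..}) + sum ?c (J \<inter> {..<i})"
    using fin by (subst arg_cong[OF J, of "sum ?c"], subst sum.union_disjoint, (auto)[3],
        subst sum.union_disjoint) auto
  moreover have "sum ?c (J \<inter> {i}) \<le> D"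
    using covariance_bound(2)[OF assms(1,1)] D_ge_1 by (cases "i \<in> J") auto
  moreover have "sum ?c (J \<inter> {i+1..}) \<le> 2 * D / real 1"
    using assms by (intro covariance_sum_right) auto
  moreover have "sum ?c (J \<inter> {..<i}) \<le> 2 * D / real 1"
    using assms by (intro covariance_sum_left) auto
  ultimately show ?thesis by simp
qed

lemma S_second_moment_le:
  assumes "R \<subseteq> {1..N}"
  shows "expectation (\<lambda>\<omega>. (S R \<omega>)\<^sup>2) \<le> 5 * D * real (card R)"
proof -
  have "expectation (\<lambda>\<omega>. (S R \<omega>)\<^sup>2) = (\<Sum>i\<in>R. \<Sum>j\<in>R. expectation (\<lambda>\<omega>. X i \<omega> * X j \<omega>))"
    using S_product_expectation[OF assms assms] by (simp add: power2_eq_square)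
  also have "\<dots> \<le> (\<Sum>i\<in>R. \<Sum>j\<in>R. \<bar>expectation (\<lambda>\<omega>. X i \<omega> * X j \<omega>)\<bar>)"
    by (intro sum_mono abs_ge_self)
  also have "\<dots> \<le> (\<Sum>i\<in>R. 5 * D)"
    using assms by (intro sum_mono covariance_row_sum) auto
  finally show ?thesis by (simp add: mult.commute)
qed

text \<open>The point \<open>a + u\<close> of the interval is at distance at least \<open>u\<close>
  from everything to its left outside the interval, and at least \<open>p + 1 - u\<close> from
  everything to its right. The two tails \<open>2 * D / u\<close> and
  \<open>2 * D / (p + 1 - u)\<close> sum to harmonic sums, so the bound does not depend on the size
  of \<open>J\<close> and only boundary effects remain.\<close>

lemma S_interval_covariance:
  assumes "{a + 1..a + p} \<subseteq> {1..N}" "J \<subseteq> {1..N}" "J \<inter> {a + 1..a + p} = {}"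
  shows "\<bar>expectation (\<lambda>\<omega>. S {a + 1..a + p} \<omega> * S J \<omega>)\<bar> \<le> 8 * D * sqrt (real p)"
proof -
  have fin: "finite J" using assms(2) finite_subset by blast
  let ?c = "\<lambda>i j. \<bar>expectation (\<lambda>\<omega>. X i \<omega> * X j \<omega>)\<bar>"
  have "\<bar>expectation (\<lambda>\<omega>. S {a + 1..a + p} \<omega> * S J \<omega>)\<bar> \<le> (\<Sum>i\<in>{a + 1..a + p}. \<Sum>j\<in>J. ?c i j)"
    unfolding S_product_expectation[OF assms(1,2)]
    by (intro order_trans[OF sum_abs] sum_mono order_refl)
  also have "\<dots> = (\<Sum>u=1..p. \<Sum>j\<in>J. ?c (a + u) j)"
    using sum.shift_bounds_cl_nat_ivl[of "\<lambda>i. \<Sum>j\<in>J. ?c i j" 1 a p] by (simp add: add.commute)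
  also have "\<dots> \<le> (\<Sum>u=1..p. 2 * D / real u + 2 * D / real (p + 1 - u))"
  proof (rule sum_mono)
    fix u assume u: "u \<in> {1..p}"
    then have i: "a + u \<in> {1..N}" using assms(1) by auto
    have J: "J = (J \<inter> {..a}) \<union> (J \<inter> {a+p+1..})" 
    proof -
      have "x \<in> {a + 1..a + p} \<or> x \<in> {..a} \<or> x \<in> {a+p+1..}" for x by auto
      then show ?thesis using assms(3) by blast
    qed
    have "(\<Sum>j\<in>J. ?c (a + u) j) = (\<Sum>j\<in>J \<inter> {..a}. ?c (a + u) j) + (\<Sum>j\<in>J \<inter> {a+p+1..}. ?c (a + u) j)"
      using fin by (subst arg_cong[OF J, of "sum _"], subst sum.union_disjoint) auto
    also have "\<dots> \<le> 2 * D / real u + 2 * D / real (p + 1 - u)"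
      using i u assms(2) by (intro add_mono covariance_sum_left covariance_sum_right) auto
    finally show "(\<Sum>j\<in>J. ?c (a + u) j) \<le> 2 * D / real u + 2 * D / real (p + 1 - u)" .
  qed
  also have "\<dots> = 2 * D * (\<Sum>u=1..p. 1 / real u) + 2 * D * (\<Sum>u=1..p. 1 / real (p + 1 - u))"
    by (simp add: sum.distrib sum_distrib_left del: of_nat_diff)
  also have "(\<Sum>u=1..p. 1 / real (p + 1 - u)) = (\<Sum>u=1..p. 1 / real u)"
    by (rule sum.reindex_bij_witness[of _ "\<lambda>u. p + 1 - u" "\<lambda>u. p + 1 - u"]) auto
  also have "2 * D * (\<Sum>u=1..p. 1 / real u) + 2 * D * (\<Sum>u=1..p. 1 / real u)
      \<le> 2 * D * (2 * sqrt (real p)) + 2 * D * (2 * sqrt (real p))"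
    using D_ge_1 by (intro add_mono mult_left_mono sum_inverse_le_sqrt) auto
  finally show ?thesis by (simp add: mult.commute)
qed

lemma S_UN:
  assumes "finite I" "\<And>j. j \<in> I \<Longrightarrow> finite (B j)" "disjoint_family_on B I"
  shows "S (\<Union>j\<in>I. B j) \<omega> = (\<Sum>j\<in>I. S (B j) \<omega>)"
  unfolding S_def using assms by (intro sum.UNION_disjoint) (auto simp: disjoint_family_on_def)

text \<open>\<open>S U * S U\<close> is expanded in one factor only: the block \<open>B j\<close>
  meets \<open>U\<close> in itself, which gives its variance, and in the rest of \<open>U\<close>,
  which gives a boundary covariance. No gap between the blocks is required, so the estimate serves
  the separated blocks of the central limit theorem as well as the adjacent blocks of the multiplier
  sum.\<close>

lemma block_variance_sum:
  assumes "\<And>j. j < k \<Longrightarrow> {a j + 1..a j + p} \<subseteq> {1..N}"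
    and "disjoint_family_on (\<lambda>j. {a j + 1..a j + p}) {..<k}"
  shows "\<bar>expectation (\<lambda>\<omega>. (S (\<Union>j<k. {a j + 1..a j + p}) \<omega>)\<^sup>2)
      - (\<Sum>j<k. expectation (\<lambda>\<omega>. (S {a j + 1..a j + p} \<omega>)\<^sup>2))\<bar> \<le> real k * (8 * D * sqrt (real p))"
proof -
  define B where "B j = {a j + 1..a j + p}" for j
  define U where "U = (\<Union>j<k. B j)"
  have B: "B j \<subseteq> {1..N}" "B j \<subseteq> U" if "j < k" for j using assms(1)[OF that] that by (auto simp: B_def U_def)
  have U: "U \<subseteq> {1..N}" using B(1) by (force simp: U_def)
  then have fU: "finite U" using finite_subset by blast
  have SU: "S U \<omega> = (\<Sum>j<k. S (B j) \<omega>)" for \<omega>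
    unfolding U_def using assms(2) by (intro S_UN) (auto simp: B_def)
  have split: "S U \<omega> = S (B j) \<omega> + S (U - B j) \<omega>" if "j < k" for j \<omega>
    unfolding S_def using B(2)[OF that] fU by (metis add.commute sum.subset_diff)
  have "expectation (\<lambda>\<omega>. (S U \<omega>)\<^sup>2) = expectation (\<lambda>\<omega>. \<Sum>j<k. S (B j) \<omega> * S U \<omega>)"
    by (simp add: power2_eq_square sum_distrib_right SU)
  also have "\<dots> = expectation (\<lambda>\<omega>. \<Sum>j<k. (S (B j) \<omega>)\<^sup>2 + S (B j) \<omega> * S (U - B j) \<omega>)"
  proof (intro Bochner_Integration.integral_cong refl sum.cong)
    fix \<omega> j assume "j \<in> {..<k}"
    then show "S (B j) \<omega> * S U \<omega> = (S (B j) \<omega>)\<^sup>2 + S (B j) \<omega> * S (U - B j) \<omega>"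
      using split[of j \<omega>] by (simp add: power2_eq_square algebra_simps)
  qed
  also have "\<dots> = (\<Sum>j<k. expectation (\<lambda>\<omega>. (S (B j) \<omega>)\<^sup>2) + expectation (\<lambda>\<omega>. S (B j) \<omega> * S (U - B j) \<omega>))"
  proof -
    have i: "integrable M (\<lambda>\<omega>. (S (B j) \<omega>)\<^sup>2)" "integrable M (\<lambda>\<omega>. S (B j) \<omega> * S (U - B j) \<omega>)" if "j < k" for j
      using B(1)[OF that] U by (auto intro!: S_square_integrable S_integrable_product)
    show ?thesis using i by (subst Bochner_Integration.integral_sum) auto
  qed
  finally have "expectation (\<lambda>\<omega>. (S U \<omega>)\<^sup>2) - (\<Sum>j<k. expectation (\<lambda>\<omega>. (S (B j) \<omega>)\<^sup>2))
      = (\<Sum>j<k. expectation (\<lambda>\<omega>. S (B j) \<omega> * S (U - B j) \<omega>))"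
    by (simp add: sum.distrib)
  also have "\<bar>\<dots>\<bar> \<le> (\<Sum>j<k. 8 * D * sqrt (real p))"
  proof (intro order_trans[OF sum_abs] sum_mono)
    fix j assume "j \<in> {..<k}"
    then show "\<bar>expectation (\<lambda>\<omega>. S (B j) \<omega> * S (U - B j) \<omega>)\<bar> \<le> 8 * D * sqrt (real p)"
      using S_interval_covariance[of "a j" p "U - B j"] assms(1)[of j] U by (auto simp: B_def)
  qed
  finally show ?thesis by (simp add: U_def B_def)
qed

text \<open>The omitted indices form a set of \<open>N - card R\<close> elements, whose sum has a
  second moment linear in that number. A difference of squares is the omitted sum times the sum of
  both terms, so Cauchy-Schwarz applies twice and gives \<open>10 = 2 * 5\<close>.\<close>

lemma S_second_moment_diff:
  assumes "R \<subseteq> {1..N}"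
  shows "expectation (\<lambda>\<omega>. \<bar>S {1..N} \<omega> - S R \<omega>\<bar>) \<le> sqrt (5 * D * (real N - real (card R)))"
    and "\<bar>expectation (\<lambda>\<omega>. (S {1..N} \<omega>)\<^sup>2) - expectation (\<lambda>\<omega>. (S R \<omega>)\<^sup>2)\<bar>
      \<le> 10 * D * sqrt (real N * (real N - real (card R)))"
proof -
  define Q where "Q = {1..N} - R"
  have Q: "Q \<subseteq> {1..N}" by (auto simp: Q_def)
  have fR: "finite R" using assms finite_subset by blast
  have cN: "card R \<le> N" using card_mono[OF _ assms] by simp
  have c: "real (card Q) = real N - real (card R)"
    using fR assms cN by (simp add: Q_def card_Diff_subset)
  have split: "S {1..N} \<omega> = S R \<omega> + S Q \<omega>" for \<omega>
    unfolding S_def Q_def using assms by (metis add.commute finite_atLeastAtMost sum.subset_diff)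
  have EQ: "expectation (\<lambda>\<omega>. (S Q \<omega>)\<^sup>2) \<le> 5 * D * (real N - real (card R))"
    using S_second_moment_le[OF Q] c by simp
  have "expectation (\<lambda>\<omega>. \<bar>S Q \<omega>\<bar>) \<le> sqrt (5 * D * (real N - real (card R)))"
    by (rule expectation_abs_le_sqrt(2)[OF S_measurable[OF Q] S_square_integrable[OF Q] EQ])
  then show "expectation (\<lambda>\<omega>. \<bar>S {1..N} \<omega> - S R \<omega>\<bar>) \<le> sqrt (5 * D * (real N - real (card R)))"
    by (simp add: split)
  have i: "integrable M (\<lambda>\<omega>. (S {1..N} \<omega>)\<^sup>2)" "integrable M (\<lambda>\<omega>. (S R \<omega>)\<^sup>2)"
    using assms by (auto intro!: S_square_integrable)
  have iQ: "integrable M (\<lambda>\<omega>. S Q \<omega> * S {1..N} \<omega>)" "integrable M (\<lambda>\<omega>. S Q \<omega> * S R \<omega>)"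
    using assms Q by (auto intro!: S_integrable_product)
  have *: "(S {1..N} \<omega>)\<^sup>2 - (S R \<omega>)\<^sup>2 = S Q \<omega> * S {1..N} \<omega> + S Q \<omega> * S R \<omega>" for \<omega>
    by (simp add: split power2_eq_square algebra_simps)
  have cs: "\<bar>expectation (\<lambda>\<omega>. S Q \<omega> * S v \<omega>)\<bar> \<le> sqrt (5 * D * (real N - real (card R)) * (5 * D * real N))"
    if "v \<subseteq> {1..N}" for v
  proof -
    have "card v \<le> N" using card_mono[OF _ that] by simp
    then have "expectation (\<lambda>\<omega>. (S v \<omega>)\<^sup>2) \<le> 5 * D * real N"
      using S_second_moment_le[OF that] D_ge_1 by (smt (verit) mult_left_mono of_nat_mono)
    then have "expectation (\<lambda>\<omega>. \<bar>S Q \<omega> * S v \<omega>\<bar>) \<le> sqrt (5 * D * (real N - real (card R)) * (5 * D * real N))"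
      by (intro integral_abs_mult_le_sqrt(2) EQ S_measurable S_square_integrable Q that)
    then show ?thesis by (rule order_trans[OF integral_abs_bound])
  qed
  have sq: "sqrt (5 * D * (real N - real (card R)) * (5 * D * real N)) = 5 * D * sqrt (real N * (real N - real (card R)))"
  proof -
    have "5 * D * (real N - real (card R)) * (5 * D * real N) = (5 * D)\<^sup>2 * (real N * (real N - real (card R)))"
      by (simp add: power2_eq_square)
    then show ?thesis using D_ge_1 by (simp add: real_sqrt_mult)
  qed
  have "\<bar>expectation (\<lambda>\<omega>. (S {1..N} \<omega>)\<^sup>2) - expectation (\<lambda>\<omega>. (S R \<omega>)\<^sup>2)\<bar>
    = \<bar>expectation (\<lambda>\<omega>. S Q \<omega> * S {1..N} \<omega>) + expectation (\<lambda>\<omega>. S Q \<omega> * S R \<omega>)\<bar>"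
    using i iQ by (subst Bochner_Integration.integral_diff[symmetric], simp, simp, subst *) simp
  also have "\<dots> \<le> 10 * D * sqrt (real N * (real N - real (card R)))"
    using cs[of "{1..N}"] cs[OF assms] unfolding sq by simp
  finally show "\<bar>expectation (\<lambda>\<omega>. (S {1..N} \<omega>)\<^sup>2) - expectation (\<lambda>\<omega>. (S R \<omega>)\<^sup>2)\<bar>
      \<le> 10 * D * sqrt (real N * (real N - real (card R)))" .
qed

subsection \<open>Central limit theorem by big and small blocks\<close>

text \<open>The covariance inequality is real; real and imaginary parts of the two factors produce
  four real covariances, which is the factor 4. Cosine and sine of \<open>u * x\<close> have
  Lipschitz constant \<open>u\<close>.\<close>

lemma dependence_iexp:
  assumes l: "1 \<le> l" "1 \<le> r" "v \<noteq> {}" "v \<subseteq> {l + r..N}"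
    and H: "H \<in> borel_measurable (F l)" "\<And>\<omega>. cmod (H \<omega>) \<le> 1" and u: "0 < u"
  shows "cmod (expectation (\<lambda>\<omega>. H \<omega> * iexp (u * S v \<omega>)) - expectation H * expectation (\<lambda>\<omega>. iexp (u * S v \<omega>)))
    \<le> 4 * (C * u * (real (card v))\<^sup>2 / real r ^ 4)"
proof -
  define \<delta> where "\<delta> = C * u * (real (card v))\<^sup>2 / real r ^ 4"
  have vN: "v \<subseteq> {1..N}" using l by auto
  note [measurable] = S_measurable[OF vN]
  have HM [measurable]: "H \<in> borel_measurable M" using measurable_from_subalg[OF subalg H(1)] .
  have R: "(\<lambda>\<omega>. Re (H \<omega>)) \<in> borel_measurable (F l)" "(\<lambda>\<omega>. Im (H \<omega>)) \<in> borel_measurable (F l)"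
    using H(1) by simp_all
  have b: "\<bar>Re (H \<omega>)\<bar> \<le> 1" "\<bar>Im (H \<omega>)\<bar> \<le> 1" for \<omega>
    using abs_Re_le_cmod[of "H \<omega>"] abs_Im_le_cmod[of "H \<omega>"] H(2)[of \<omega>] by linarith+
  have cos_lip: "\<bar>cos (u * x) - cos (u * y)\<bar> \<le> u * \<bar>x - y\<bar>" for x y
    using abs_cos_diff_le[of "u * x" "u * y"] u by (simp add: right_diff_distrib[symmetric] abs_mult)
  have sin_lip: "\<bar>sin (u * x) - sin (u * y)\<bar> \<le> u * \<bar>x - y\<bar>" for x y
    using abs_sin_diff_le[of "u * x" "u * y"] u by (simp add: right_diff_distrib[symmetric] abs_mult)
  have dep: "\<bar>expectation (\<lambda>\<omega>. h \<omega> * \<psi> (u * S v \<omega>)) - expectation h * expectation (\<lambda>\<omega>. \<psi> (u * S v \<omega>))\<bar> \<le> \<delta>"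
    if "h \<in> borel_measurable (F l)" "\<And>\<omega>. \<bar>h \<omega>\<bar> \<le> 1" "\<And>x y. \<bar>\<psi> (u * x) - \<psi> (u * y)\<bar> \<le> u * \<bar>x - y\<bar>" for h \<psi>
    using dependence[OF l that(1), of 1 u "\<lambda>x. \<psi> (u * x)"] that u
    by (simp add: \<delta>_def S_def)
  define c s where "c \<omega> = cos (u * S v \<omega>)" and "s \<omega> = sin (u * S v \<omega>)" for \<omega>
  have [measurable]: "c \<in> borel_measurable M" "s \<in> borel_measurable M"
    by (simp_all add: c_def[abs_def] s_def[abs_def])
  have cs: "\<bar>c \<omega>\<bar> \<le> 1" "\<bar>s \<omega>\<bar> \<le> 1" for \<omega> by (simp_all add: c_def s_def)
  have int: "integrable M (\<lambda>\<omega>. f \<omega> * g \<omega>)" if [measurable]: "f \<in> borel_measurable M" "g \<in> borel_measurable M"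
    and "\<And>\<omega>. \<bar>f \<omega>\<bar> \<le> 1" "\<And>\<omega>. \<bar>g \<omega>\<bar> \<le> 1" for f g :: "'a \<Rightarrow> real"
    by (rule integrable_const_bound[where B = 1]) (auto simp: abs_mult intro!: mult_le_one that)
  have ib: "integrable M f" if [measurable]: "f \<in> borel_measurable M" and "\<And>\<omega>. \<bar>f \<omega>\<bar> \<le> 1" for f :: "'a \<Rightarrow> real"
    by (rule integrable_const_bound[where B = 1]) (auto simp: that)
  have iR [simp]: "integrable M (\<lambda>\<omega>. Re (H \<omega>))" "integrable M (\<lambda>\<omega>. Im (H \<omega>))" "integrable M c" "integrable M s"
    "integrable M (\<lambda>\<omega>. Re (H \<omega>) * c \<omega>)" "integrable M (\<lambda>\<omega>. Re (H \<omega>) * s \<omega>)"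
    "integrable M (\<lambda>\<omega>. Im (H \<omega>) * c \<omega>)" "integrable M (\<lambda>\<omega>. Im (H \<omega>) * s \<omega>)"
    by (rule ib, simp, fact b, rule ib, simp, fact b, rule ib, simp, fact cs, rule ib, simp, fact cs,
        (rule int; simp add: b cs)+)
  have e: "iexp (u * S v \<omega>) = Complex (c \<omega>) (s \<omega>)" for \<omega>
    by (simp add: c_def s_def complex_eq_iff Re_exp Im_exp)
  have iH [simp]: "integrable M H" by (rule integrable_const_bound[where B = 1]) (auto simp: H)
  have ie [simp]: "integrable M (\<lambda>\<omega>. iexp (u * S v \<omega>))" by (rule integrable_iexp) simp_all
  have iHe [simp]: "integrable M (\<lambda>\<omega>. H \<omega> * iexp (u * S v \<omega>))"
    by (rule integrable_const_bound[where B = 1]) (auto simp: norm_mult H)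
  have EH: "expectation H = Complex (expectation (\<lambda>\<omega>. Re (H \<omega>))) (expectation (\<lambda>\<omega>. Im (H \<omega>)))"
    by (simp add: complex_eq_iff)
  have Ee: "expectation (\<lambda>\<omega>. iexp (u * S v \<omega>)) = Complex (expectation c) (expectation s)"
    using integral_Re[OF ie] integral_Im[OF ie] by (simp add: complex_eq_iff e del: of_real_mult)
  have EHe: "expectation (\<lambda>\<omega>. H \<omega> * iexp (u * S v \<omega>)) =
     Complex (expectation (\<lambda>\<omega>. Re (H \<omega>) * c \<omega>) - expectation (\<lambda>\<omega>. Im (H \<omega>) * s \<omega>))
       (expectation (\<lambda>\<omega>. Re (H \<omega>) * s \<omega>) + expectation (\<lambda>\<omega>. Im (H \<omega>) * c \<omega>))"
    using integral_Re[OF iHe] integral_Im[OF iHe] by (simp add: complex_eq_iff e del: of_real_mult)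
  let ?Z = "expectation (\<lambda>\<omega>. H \<omega> * iexp (u * S v \<omega>)) - expectation H * expectation (\<lambda>\<omega>. iexp (u * S v \<omega>))"
  have d: "\<bar>expectation (\<lambda>\<omega>. Re (H \<omega>) * c \<omega>) - expectation (\<lambda>\<omega>. Re (H \<omega>)) * expectation c\<bar> \<le> \<delta>"
    "\<bar>expectation (\<lambda>\<omega>. Re (H \<omega>) * s \<omega>) - expectation (\<lambda>\<omega>. Re (H \<omega>)) * expectation s\<bar> \<le> \<delta>"
    "\<bar>expectation (\<lambda>\<omega>. Im (H \<omega>) * c \<omega>) - expectation (\<lambda>\<omega>. Im (H \<omega>)) * expectation c\<bar> \<le> \<delta>"
    "\<bar>expectation (\<lambda>\<omega>. Im (H \<omega>) * s \<omega>) - expectation (\<lambda>\<omega>. Im (H \<omega>)) * expectation s\<bar> \<le> \<delta>"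
    unfolding c_def s_def using R b cos_lip sin_lip by (intro dep; blast)+
  have "cmod ?Z \<le> \<bar>Re ?Z\<bar> + \<bar>Im ?Z\<bar>" by (rule cmod_le)
  also have "\<dots> \<le> 4 * \<delta>" using d unfolding EH Ee EHe by simp
  finally show ?thesis by (simp add: \<delta>_def)
qed

lemma S_fourth_le:
  "S v \<omega> ^ 4 \<le> (real (card v)) ^ 3 * (\<Sum>i\<in>v. X i \<omega> ^ 4)"
  unfolding S_def by (rule sum_fourth_le)

text \<open>No cancellation is exploited. Where \<open>\<bar>S v \<omega>\<bar>\<close> is at most
  the cardinality \<open>p\<close>, the cube is at most \<open>p ^ 3\<close>; elsewhere a factor
  \<open>\<bar>S v \<omega>\<bar> / p\<close>, which is at least 1, raises it to the fourth power,
  to which \<open>S_fourth_le\<close> applies.\<close>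

lemma S_third_moment:
  assumes "v \<subseteq> {1..N}"
  shows "integrable M (\<lambda>\<omega>. \<bar>S v \<omega>\<bar> ^ 3)" "expectation (\<lambda>\<omega>. \<bar>S v \<omega>\<bar> ^ 3) \<le> (real (card v)) ^ 3 * (1 + A)"
proof -
  note [measurable] = S_measurable[OF assms]
  have fin: "finite v" using assms finite_subset by blast
  define p where "p = real (card v)"
  let ?b = "\<lambda>\<omega>. p ^ 3 + p\<^sup>2 * (\<Sum>i\<in>v. X i \<omega> ^ 4)"
  have b: "\<bar>S v \<omega>\<bar> ^ 3 \<le> ?b \<omega>" for \<omega>
  proof (cases "\<bar>S v \<omega>\<bar> \<le> p")
    case True
    then have "\<bar>S v \<omega>\<bar> ^ 3 \<le> p ^ 3" by (intro power_mono) auto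
    moreover have "0 \<le> p\<^sup>2 * (\<Sum>i\<in>v. X i \<omega> ^ 4)" by (intro mult_nonneg_nonneg sum_nonneg) auto
    ultimately show ?thesis by linarith
  next
    case False
    have p: "0 < p"
    proof (rule ccontr)
      assume "\<not> 0 < p"
      then have "v = {}" using fin by (auto simp: p_def)
      with False show False by (simp add: S_def p_def)
    qed
    have "p * \<bar>S v \<omega>\<bar> ^ 3 \<le> \<bar>S v \<omega>\<bar> * \<bar>S v \<omega>\<bar> ^ 3" using False by (intro mult_right_mono) auto
    also have "\<dots> = S v \<omega> ^ 4" by (simp add: power4_eq_xxxx power3_eq_cube abs_mult[symmetric] mult_ac)
    also have "\<dots> \<le> p * (p\<^sup>2 * (\<Sum>i\<in>v. X i \<omega> ^ 4))"
      using S_fourth_le[of v \<omega>] by (simp add: p_def power3_eq_cube power2_eq_square mult_ac)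
    finally have "\<bar>S v \<omega>\<bar> ^ 3 \<le> p\<^sup>2 * (\<Sum>i\<in>v. X i \<omega> ^ 4)" using p by simp
    then show ?thesis using p by (smt (verit) zero_le_power)
  qed
  have i: "integrable M ?b"
    using assms by (intro Bochner_Integration.integrable_add integrable_mult_right Bochner_Integration.integrable_sum moment_integrable) auto
  show I: "integrable M (\<lambda>\<omega>. \<bar>S v \<omega>\<bar> ^ 3)"
    by (rule Bochner_Integration.integrable_bound[OF i])
       (use b in \<open>auto intro!: AE_I2 simp: power_abs[symmetric] intro: order_trans[OF _ abs_ge_self]\<close>)
  have "expectation (\<lambda>\<omega>. \<bar>S v \<omega>\<bar> ^ 3) \<le> expectation ?b" by (intro integral_mono I i b)
  also have "\<dots> = p ^ 3 + p\<^sup>2 * (\<Sum>i\<in>v. expectation (\<lambda>\<omega>. X i \<omega> ^ 4))"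
    using assms by (subst Bochner_Integration.integral_add, simp, force intro!: Bochner_Integration.integrable_sum moment_integrable integrable_mult_right,
      subst integral_mult_right_zero, subst Bochner_Integration.integral_sum) 
      (auto intro!: moment_integrable simp: prob_space)
  also have "\<dots> \<le> p ^ 3 + p\<^sup>2 * (\<Sum>i\<in>v. A)"
    using assms by (intro add_left_mono mult_left_mono sum_mono moment_le) auto
  finally show "expectation (\<lambda>\<omega>. \<bar>S v \<omega>\<bar> ^ 3) \<le> p ^ 3 * (1 + A)"
    by (simp add: p_def power3_eq_cube power2_eq_square algebra_simps)
qed

lemma S_second_moment_le':
  assumes "v \<subseteq> {1..N}"
  shows "expectation (\<lambda>\<omega>. (S v \<omega>)\<^sup>2) \<le> (real (card v))\<^sup>2 * (1 + A)"
proof -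
  have "expectation (\<lambda>\<omega>. (S v \<omega>)\<^sup>2) \<le> expectation (\<lambda>\<omega>. (\<Sum>i\<in>v. (X i \<omega>)\<^sup>2) * real (card v))"
  proof (intro integral_mono S_square_integrable assms)
    show "integrable M (\<lambda>\<omega>. (\<Sum>i\<in>v. (X i \<omega>)\<^sup>2) * real (card v))"
      using assms by (auto intro!: integrable_mult_left Bochner_Integration.integrable_sum X_square_integrable)
  qed (auto simp: S_def sum_squared_le_sum_of_squares)
  also have "\<dots> = (\<Sum>i\<in>v. expectation (\<lambda>\<omega>. (X i \<omega>)\<^sup>2)) * real (card v)"
    using assms by (subst integral_mult_left_zero, subst Bochner_Integration.integral_sum) (auto intro!: X_square_integrable)
  also have "\<dots> \<le> (\<Sum>i\<in>v. 1 + A) * real (card v)"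
    using assms by (intro mult_right_mono sum_mono second_moment_le) auto
  finally show ?thesis by (simp add: power2_eq_square mult_ac)
qed

text \<open>Second order Taylor expansion on both sides: the linear term vanishes by centring, the
  third moment bounds the remainder of \<open>iexp\<close>, and \<open>y^2 / 2\<close> bounds that
  of the exponential. The Gaussian has the variance of this very block, so blocks may have different
  variances.\<close>

lemma char_block_approx:
  assumes v: "v \<subseteq> {1..N}" and u: "0 < u"
  defines "p \<equiv> real (card v)"
  shows "cmod (expectation (\<lambda>\<omega>. iexp (u * S v \<omega>)) - exp (- (u\<^sup>2 * expectation (\<lambda>\<omega>. (S v \<omega>)\<^sup>2) / 2)))
    \<le> u ^ 3 * p ^ 3 * (1 + A) / 6 + u ^ 4 * p ^ 4 * (1 + A)\<^sup>2 / 8"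
proof -
  note [measurable] = S_measurable[OF v]
  define \<sigma> where "\<sigma> = expectation (\<lambda>\<omega>. (S v \<omega>)\<^sup>2)"
  define y where "y = u\<^sup>2 * \<sigma> / 2"
  have \<sigma>: "0 \<le> \<sigma>" "\<sigma> \<le> p\<^sup>2 * (1 + A)"
    using S_second_moment_le'[OF v] by (auto simp: \<sigma>_def p_def)
  have y0: "0 \<le> y" using \<sigma> by (simp add: y_def)
  let ?t = "\<lambda>\<omega>. complex_of_real (1 - u\<^sup>2 * (S v \<omega>)\<^sup>2 / 2) + \<i> * complex_of_real (u * S v \<omega>)"
  have pt: "cmod (iexp (u * S v \<omega>) - ?t \<omega>) \<le> u ^ 3 / 6 * \<bar>S v \<omega>\<bar> ^ 3" for \<omega>
  proof -
    have "(\<Sum>k\<le>2. (\<i> * complex_of_real (u * S v \<omega>)) ^ k / fact k) = ?t \<omega>"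
      by (simp add: numeral_2_eq_2 One_nat_def power2_eq_square algebra_simps)
    then show ?thesis
      using iexp_approx1[of "u * S v \<omega>" 2] u
      by (simp add: numeral_3_eq_3[symmetric] fact_numeral power_mult_distrib abs_mult One_nat_def)
  qed
  have i2: "integrable M (\<lambda>\<omega>. (S v \<omega>)\<^sup>2)" and i1: "integrable M (S v)"
    using v by (auto intro!: S_square_integrable S_integrable)
  have ire: "integrable M (\<lambda>\<omega>. 1 - u\<^sup>2 * (S v \<omega>)\<^sup>2 / 2)" "integrable M (\<lambda>\<omega>. u * S v \<omega>)"
    using i1 i2 by auto
  have it: "integrable M ?t"
    using ire by (intro Bochner_Integration.integrable_add integrable_mult_right integrable_of_real) auto
  have ie: "integrable M (\<lambda>\<omega>. iexp (u * S v \<omega>))" by (rule integrable_iexp) simp_all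
  have Et: "expectation ?t = complex_of_real (1 - y)"
    using ire i1 i2 S_expectation[OF v]
    by (subst Bochner_Integration.integral_add)
       (auto simp: integral_of_real prob_space y_def \<sigma>_def simp del: of_real_mult of_real_diff intro!: integrable_mult_right integrable_of_real)
  have "cmod (expectation (\<lambda>\<omega>. iexp (u * S v \<omega>)) - complex_of_real (1 - y))
      = cmod (expectation (\<lambda>\<omega>. iexp (u * S v \<omega>) - ?t \<omega>))"
    unfolding Et[symmetric] using ie it by (simp del: of_real_mult of_real_diff)
  also have "\<dots> \<le> expectation (\<lambda>\<omega>. u ^ 3 / 6 * \<bar>S v \<omega>\<bar> ^ 3)"
    using S_third_moment(1)[OF v] ie it pt
    by (intro order_trans[OF integral_norm_bound] integral_mono) auto
  also have "\<dots> \<le> u ^ 3 / 6 * (p ^ 3 * (1 + A))"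
    using S_third_moment(2)[OF v] u unfolding p_def by simp
  finally have 1: "cmod (expectation (\<lambda>\<omega>. iexp (u * S v \<omega>)) - complex_of_real (1 - y)) \<le> u ^ 3 * p ^ 3 * (1 + A) / 6"
    by (simp add: mult_ac)
  have "\<bar>exp (- y) - (1 - y)\<bar> \<le> y\<^sup>2 / 2"
  proof -
    have "1 - y \<le> exp (- y)" using exp_ge_add_one_self[of "- y"] by simp
    moreover have "exp (- y) \<le> 1 - y + y\<^sup>2 / 2" using y0 by (rule exp_minus_le_Taylor)
    ultimately show ?thesis by linarith
  qed
  also have "y\<^sup>2 / 2 \<le> (u\<^sup>2 * (p\<^sup>2 * (1 + A)) / 2)\<^sup>2 / 2"
    unfolding y_def using \<sigma> u by (intro divide_right_mono power_mono mult_left_mono) auto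
  also have "\<dots> = u ^ 4 * p ^ 4 * (1 + A)\<^sup>2 / 8"
    by (simp add: power_mult_distrib power_divide)
  finally have "cmod (complex_of_real (1 - y) - complex_of_real (exp (- y))) \<le> u ^ 4 * p ^ 4 * (1 + A)\<^sup>2 / 8"
    by (metis abs_minus_commute norm_of_real of_real_diff)
  then have "cmod (expectation (\<lambda>\<omega>. iexp (u * S v \<omega>)) - complex_of_real (exp (- y)))
      \<le> u ^ 3 * p ^ 3 * (1 + A) / 6 + u ^ 4 * p ^ 4 * (1 + A)\<^sup>2 / 8"
    using 1 norm_triangle_le[of "expectation (\<lambda>\<omega>. iexp (u * S v \<omega>)) - complex_of_real (1 - y)" "complex_of_real (1 - y) - complex_of_real (exp (- y))"]
    by (smt (verit, best) diff_add_cancel add_diff_eq)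
  then show ?thesis unfolding y_def \<sigma>_def by (simp add: exp_of_real)
qed

text \<open>Blocks are split off from the right. The last one is separated from the union of all
  earlier ones by a gap of \<open>q\<close>, so \<open>dependence_iexp\<close> factorises it off at
  a fixed cost; the cost adds up linearly because the remaining factor has modulus at most
  1.\<close>

lemma char_product_approx:
  assumes pq: "1 \<le> p" "1 \<le> q" and k: "k * (p + q) \<le> N" and u: "0 < u"
  defines "B \<equiv> \<lambda>j. {j * (p + q) + 1..j * (p + q) + p}"
  shows "cmod (expectation (\<lambda>\<omega>. iexp (u * S (\<Union>j<k. B j) \<omega>)) - (\<Prod>j<k. expectation (\<lambda>\<omega>. iexp (u * S (B j) \<omega>))))
    \<le> real k * (4 * (C * u * (real p)\<^sup>2 / real q ^ 4))"
  using k
proof (induction k)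
  case 0
  show ?case by (simp add: S_def prob_space)
next
  case (Suc k)
  define \<delta> where "\<delta> = 4 * (C * u * (real p)\<^sup>2 / real q ^ 4)"
  have \<delta>: "0 \<le> \<delta>" using nonneg u by (simp add: \<delta>_def)
  define V where "V = (\<Union>j<k. B j)"
  have jk: "j * (p + q) + p + q \<le> k * (p + q)" if "j < k" for j
    using mult_le_mono1[of "Suc j" k "p + q"] that by simp
  have BN: "B k \<subseteq> {1..N}" using Suc.prems by (auto simp: B_def)
  \<comment> \<open>The block before number \<open>k\<close> ends at
    \<open>(k - 1) * (p + q) + p\<close>, which is \<open>k * (p + q) - q\<close>; this is the time
    \<open>l\<close> at which \<open>dependence\<close> is applied.\<close>
  have V: "V \<subseteq> {..k * (p + q) - q}" "V \<subseteq> {1..N}"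
  proof -
    have "x \<le> k * (p + q) - q \<and> 1 \<le> x \<and> x \<le> N" if "x \<in> V" for x
    proof -
      obtain j where "j < k" "j * (p + q) + 1 \<le> x" "x \<le> j * (p + q) + p" using \<open>x \<in> V\<close> by (auto simp: V_def B_def)
      then show ?thesis using jk[of j] Suc.prems by simp
    qed
    then show "V \<subseteq> {..k * (p + q) - q}" "V \<subseteq> {1..N}" by auto
  qed
  have fin: "finite V" using V(2) finite_subset by blast
  have dis: "V \<inter> B k = {}" using V(1) by (fastforce simp: B_def)
  have split: "S (\<Union>j<Suc k. B j) \<omega> = S V \<omega> + S (B k) \<omega>" for \<omega>
  proof -
    have "(\<Union>j<Suc k. B j) = V \<union> B k" by (auto simp: V_def lessThan_Suc)
    then show ?thesis unfolding S_def using fin dis by (simp add: sum.union_disjoint B_def)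
  qed
  define a where "a = expectation (\<lambda>\<omega>. iexp (u * S V \<omega>))"
  define e where "e j = expectation (\<lambda>\<omega>. iexp (u * S (B j) \<omega>))" for j
  have ek: "cmod (e k) \<le> 1" unfolding e_def using S_measurable[OF BN] by (intro cmod_integral_iexp_le_1 prob_space_axioms) simp
  have *: "cmod (expectation (\<lambda>\<omega>. iexp (u * S (\<Union>j<Suc k. B j) \<omega>)) - a * e k) \<le> \<delta>"
  \<comment> \<open>With no earlier block there is no time \<open>l\<close> with
    \<open>1 \<le> l\<close> for \<open>dependence\<close>. The union is empty and the factorisation
    is exact.\<close>
  proof (cases "k = 0")
    case True
    have "expectation (\<lambda>\<omega>. iexp (u * S (\<Union>j<Suc k. B j) \<omega>)) = a * e k"
      unfolding a_def e_def split using True by (simp add: S_def V_def prob_space)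
    then show ?thesis using \<delta> by simp
  next
    case False
    have "p + q \<le> k * (p + q)" using False by simp
    then have l: "1 \<le> k * (p + q) - q" "k * (p + q) - q + q = k * (p + q)" using pq by linarith+
    have "expectation (\<lambda>\<omega>. iexp (u * S (\<Union>j<Suc k. B j) \<omega>)) = expectation (\<lambda>\<omega>. iexp (u * S V \<omega>) * iexp (u * S (B k) \<omega>))"
      by (simp add: split exp_add[symmetric] algebra_simps)
    moreover have "cmod (expectation (\<lambda>\<omega>. iexp (u * S V \<omega>) * iexp (u * S (B k) \<omega>))
       - expectation (\<lambda>\<omega>. iexp (u * S V \<omega>)) * expectation (\<lambda>\<omega>. iexp (u * S (B k) \<omega>)))
      \<le> 4 * (C * u * (real (card (B k)))\<^sup>2 / real q ^ 4)"
    proof (rule dependence_iexp[OF l(1) pq(2) _ _ _ _ u])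
      show "B k \<noteq> {}" "B k \<subseteq> {k * (p + q) - q + q..N}" using pq l BN by (auto simp: B_def)
      show "(\<lambda>\<omega>. iexp (u * S V \<omega>)) \<in> borel_measurable (F (k * (p + q) - q))"
        using S_measurable_F[OF V(2,1)] by simp
    qed simp
    ultimately show ?thesis by (simp add: \<delta>_def a_def e_def B_def)
  qed
  have "cmod (a * e k - (\<Prod>j<k. e j) * e k) = cmod (a - (\<Prod>j<k. e j)) * cmod (e k)"
    by (simp add: norm_mult[symmetric] algebra_simps)
  also have "\<dots> \<le> (real k * \<delta>) * 1"
  proof (intro mult_mono ek)
    show "cmod (a - (\<Prod>j<k. e j)) \<le> real k * \<delta>"
      using Suc by (simp add: a_def e_def V_def \<delta>_def)
    show "0 \<le> real k * \<delta>" using \<delta> by simp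
  qed simp
  finally have "cmod (expectation (\<lambda>\<omega>. iexp (u * S (\<Union>j<Suc k. B j) \<omega>)) - (\<Prod>j<k. e j) * e k) \<le> \<delta> + real k * \<delta>"
    using * norm_triangle_ineq[of "expectation (\<lambda>\<omega>. iexp (u * S (\<Union>j<Suc k. B j) \<omega>)) - a * e k" "a * e k - (\<Prod>j<k. e j) * e k"]
    by simp
  moreover have "\<delta> + real k * \<delta> = real (Suc k) * \<delta>" by (simp add: algebra_simps)
  ultimately show ?case unfolding prod.lessThan_Suc \<delta>_def[symmetric] e_def[symmetric] by simp
qed

text \<open>\<open>\<rho>\<close> bounds the fraction of indices outside the big blocks: the gaps
  take at most \<open>N / p\<close> times \<open>q\<close>, the last incomplete period fewer than
  \<open>p + q\<close>. The first summand of the error pays for deleting these indices, the second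
  for factorising over the blocks, the third and fourth are the Taylor remainders of the blocks, and
  the last compares the sum of the block variances with the variance of the full sum.\<close>

lemma clt_bound:
  assumes p: "1 \<le> p" and q: "1 \<le> q" and N: "1 \<le> N" and s: "0 < s"
  defines "\<rho> \<equiv> real q / real p + real (p + q) / real N"
  shows "cmod (expectation (\<lambda>\<omega>. iexp (s / sqrt (real N) * S {1..N} \<omega>))
      - exp (- (s\<^sup>2 * expectation (\<lambda>\<omega>. (S {1..N} \<omega>)\<^sup>2) / (2 * real N))))
    \<le> s * sqrt (5 * D * \<rho>) + 4 * C * s * sqrt (real N) * real p / real q ^ 4
      + s ^ 3 * (real p)\<^sup>2 * (1 + A) / (6 * sqrt (real N)) + s ^ 4 * real p ^ 3 * (1 + A)\<^sup>2 / (8 * real N)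
      + s\<^sup>2 * (4 * D / sqrt (real p) + 5 * D * sqrt \<rho>)"
proof -
  define k where "k = N div (p + q)"
  define B where "B j = {j * (p + q) + 1..j * (p + q) + p}" for j
  define U where "U = (\<Union>j<k. B j)"
  define n where "n = real N"
  define u where "u = s / sqrt n"
  define \<sigma> where "\<sigma> v = expectation (\<lambda>\<omega>. (S v \<omega>)\<^sup>2)" for v
  define e where "e v = expectation (\<lambda>\<omega>. iexp (u * S v \<omega>))" for v
  have n: "1 \<le> n" "0 < n" and P: "1 \<le> real p" and Q: "1 \<le> real q" using N p q by (simp_all add: n_def)
  have u: "0 < u" and u2: "u\<^sup>2 = s\<^sup>2 / n" using s n by (auto simp: u_def power_divide)
  have \<rho>: "0 \<le> \<rho>" by (simp add: \<rho>_def)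
  have kN: "k * (p + q) \<le> N" by (simp add: k_def)
  have jk: "j * (p + q) + p + q \<le> k * (p + q)" if "j < k" for j
    using mult_le_mono1[of "Suc j" k "p + q"] that by simp
  have BN: "B j \<subseteq> {1..N}" if "j < k" for j using jk[OF that] kN by (auto simp: B_def)
  have UN: "U \<subseteq> {1..N}" using BN by (force simp: U_def)
  have disj: "disjoint_family_on B {..<k}"
  proof -
    have "B i \<inter> B j = {}" if "i < j" for i j
    proof -
      have "i * (p + q) + p + q \<le> j * (p + q)" using mult_le_mono1[of "Suc i" j "p + q"] that by simp
      then show ?thesis using q by (auto simp: B_def)
    qed
    then show ?thesis unfolding disjoint_family_on_def by (metis Int_commute linorder_neqE_nat)
  qed
  have cardU: "card U = k * p"
    unfolding U_def using disj
    by (subst card_UN_disjoint) (auto simp: B_def disjoint_family_on_def)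
  have knp: "real k \<le> n / real p"
  proof -
    have "k * p \<le> N" using kN by (metis add_leE distrib_left)
    then have "real k * real p \<le> n" unfolding n_def by (metis of_nat_le_iff of_nat_mult)
    then show ?thesis using P by (simp add: field_simps)
  qed
  have rest: "n - real (k * p) \<le> \<rho> * n"
  proof -
    have "N < k * (p + q) + (p + q)"
      using div_mult_mod_eq[of N "p + q"] mod_less_divisor[of "p + q" N] p unfolding k_def by linarith
    then have "N \<le> k * p + k * q + (p + q)" by (simp add: algebra_simps)
    then have "real N \<le> real (k * p + k * q + (p + q))" by (rule of_nat_mono)
    then have "n - real (k * p) \<le> real k * real q + real (p + q)" by (simp add: n_def)
    also have "\<dots> \<le> n / real p * real q + real (p + q)"
      using knp by (intro add_right_mono mult_right_mono) auto
    also have "\<dots> = \<rho> * n" using n P by (simp add: \<rho>_def n_def field_simps)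
    finally show ?thesis .
  qed

  have 1: "cmod (e {1..N} - e U) \<le> s * sqrt (5 * D * \<rho>)"
  proof -
    have m: "S {1..N} \<in> borel_measurable M" "S U \<in> borel_measurable M" using UN by (auto intro!: S_measurable)
    have i: "integrable M (\<lambda>\<omega>. iexp (u * S {1..N} \<omega>))" "integrable M (\<lambda>\<omega>. iexp (u * S U \<omega>))"
      using m by (auto intro!: integrable_iexp simp del: of_real_mult)
    have iS: "integrable M (\<lambda>\<omega>. S {1..N} \<omega> - S U \<omega>)" using UN by (auto intro!: S_integrable Bochner_Integration.integrable_diff)
    have "cmod (e {1..N} - e U) = cmod (expectation (\<lambda>\<omega>. iexp (u * S {1..N} \<omega>) - iexp (u * S U \<omega>)))"
      unfolding e_def using i by simp
    also have "\<dots> \<le> expectation (\<lambda>\<omega>. cmod (iexp (u * S {1..N} \<omega>) - iexp (u * S U \<omega>)))"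
      by (rule integral_norm_bound)
    also have "\<dots> \<le> expectation (\<lambda>\<omega>. u * \<bar>S {1..N} \<omega> - S U \<omega>\<bar>)"
    proof (rule integral_mono)
      show "integrable M (\<lambda>\<omega>. cmod (iexp (u * S {1..N} \<omega>) - iexp (u * S U \<omega>)))"
        using i by (intro integrable_norm Bochner_Integration.integrable_diff)
      show "integrable M (\<lambda>\<omega>. u * \<bar>S {1..N} \<omega> - S U \<omega>\<bar>)"
        using iS by (intro integrable_mult_right integrable_abs)
      show "cmod (iexp (u * S {1..N} \<omega>) - iexp (u * S U \<omega>)) \<le> u * \<bar>S {1..N} \<omega> - S U \<omega>\<bar>" for \<omega>
        using iexp_diff_le[of "u * S {1..N} \<omega>" "u * S U \<omega>"] u
        by (simp add: right_diff_distrib[symmetric] abs_mult del: of_real_mult)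
    qed
    also have "\<dots> = u * expectation (\<lambda>\<omega>. \<bar>S {1..N} \<omega> - S U \<omega>\<bar>)" by simp
    also have "\<dots> \<le> u * sqrt (5 * D * (n - real (k * p)))"
      using S_second_moment_diff(1)[OF UN] u by (simp add: cardU n_def)
    also have "\<dots> \<le> u * sqrt (5 * D * (\<rho> * n))"
      using u rest D_ge_1 by (intro mult_left_mono real_sqrt_le_mono) auto
    also have "\<dots> = s * sqrt (5 * D * \<rho>)" using n by (simp add: u_def real_sqrt_mult)
    finally show ?thesis .
  qed

  have 2: "cmod (e U - (\<Prod>j<k. e (B j))) \<le> 4 * C * s * sqrt n * real p / real q ^ 4"
  proof -
    have "cmod (e U - (\<Prod>j<k. e (B j))) \<le> real k * (4 * (C * u * (real p)\<^sup>2 / real q ^ 4))"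
      using char_product_approx[OF p q kN u] unfolding e_def U_def B_def .
    also have "\<dots> \<le> n / real p * (4 * (C * u * (real p)\<^sup>2 / real q ^ 4))"
      using knp nonneg u by (intro mult_right_mono) auto
    also have "\<dots> = (n * u) * (4 * C * real p / real q ^ 4)"
      using P Q by (simp add: field_simps power2_eq_square)
    also have "n * u = s * sqrt n"
    proof -
      have "n * u = s * (n / sqrt n)" by (simp add: u_def)
      then show ?thesis using n by (simp add: real_div_sqrt)
    qed
    finally show ?thesis by (simp add: mult_ac)
  qed

  have 3: "cmod ((\<Prod>j<k. e (B j)) - (\<Prod>j<k. complex_of_real (exp (- (u\<^sup>2 * \<sigma> (B j) / 2)))))
      \<le> s ^ 3 * (real p)\<^sup>2 * (1 + A) / (6 * sqrt n) + s ^ 4 * real p ^ 3 * (1 + A)\<^sup>2 / (8 * n)"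
  proof -
    have "cmod ((\<Prod>j<k. e (B j)) - (\<Prod>j<k. complex_of_real (exp (- (u\<^sup>2 * \<sigma> (B j) / 2)))))
        \<le> (\<Sum>j<k. cmod (e (B j) - complex_of_real (exp (- (u\<^sup>2 * \<sigma> (B j) / 2)))))"
    proof (rule norm_prod_diff)
      fix j assume "j \<in> {..<k}"
      then have "S (B j) \<in> borel_measurable M" using BN by (auto intro!: S_measurable)
      then show "cmod (e (B j)) \<le> 1" unfolding e_def by (intro cmod_integral_iexp_le_1 prob_space_axioms) simp
      have "0 \<le> \<sigma> (B j)" by (simp add: \<sigma>_def)
      then show "cmod (complex_of_real (exp (- (u\<^sup>2 * \<sigma> (B j) / 2)))) \<le> 1" by simp
    qed
    also have "\<dots> \<le> (\<Sum>j<k. u ^ 3 * real p ^ 3 * (1 + A) / 6 + u ^ 4 * real p ^ 4 * (1 + A)\<^sup>2 / 8)"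
    proof (rule sum_mono)
      fix j assume "j \<in> {..<k}"
      then show "cmod (e (B j) - complex_of_real (exp (- (u\<^sup>2 * \<sigma> (B j) / 2))))
         \<le> u ^ 3 * real p ^ 3 * (1 + A) / 6 + u ^ 4 * real p ^ 4 * (1 + A)\<^sup>2 / 8"
        using char_block_approx[OF BN u, of j] by (simp add: e_def \<sigma>_def B_def exp_of_real)
    qed
    also have "\<dots> = real k * (u ^ 3 * real p ^ 3 * (1 + A) / 6 + u ^ 4 * real p ^ 4 * (1 + A)\<^sup>2 / 8)"
      by simp
    also have "\<dots> \<le> n / real p * (u ^ 3 * real p ^ 3 * (1 + A) / 6 + u ^ 4 * real p ^ 4 * (1 + A)\<^sup>2 / 8)"
      using knp nonneg u by (intro mult_right_mono add_nonneg_nonneg) auto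
    also have "\<dots> = (n * u ^ 3) * ((real p)\<^sup>2 * (1 + A) / 6) + (n * u ^ 4) * (real p ^ 3 * (1 + A)\<^sup>2 / 8)"
      using P by (simp add: field_simps power2_eq_square power3_eq_cube power4_eq_xxxx)
    also have "n * u ^ 3 = s ^ 3 / sqrt n"
    proof -
      have "u ^ 3 = u\<^sup>2 * u" by (simp add: power3_eq_cube power2_eq_square)
      then have "n * u ^ 3 = n * (s\<^sup>2 / n) * (s / sqrt n)" by (simp only: u2 u_def[symmetric])
      then show ?thesis using n by (simp add: power3_eq_cube power2_eq_square)
    qed
    also have "n * u ^ 4 = s ^ 4 / n"
    proof -
      have "u ^ 4 = (u\<^sup>2)\<^sup>2" by simp
      then show ?thesis using n unfolding u2 by (simp add: power_divide power2_eq_square[of n])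
    qed
    finally show ?thesis by (simp add: mult_ac)
  qed

  \<comment> \<open>The Gaussian factors multiply to a single Gaussian whose exponent is the sum of
    the block variances, so only this sum has to be close to the variance of the full sum.\<close>
  have 4: "cmod ((\<Prod>j<k. complex_of_real (exp (- (u\<^sup>2 * \<sigma> (B j) / 2)))) - complex_of_real (exp (- (u\<^sup>2 * \<sigma> {1..N} / 2))))
      \<le> s\<^sup>2 * (4 * D / sqrt (real p) + 5 * D * sqrt \<rho>)"
  proof -
    have \<sigma>0: "0 \<le> \<sigma> v" for v by (simp add: \<sigma>_def)
    have "(\<Prod>j<k. complex_of_real (exp (- (u\<^sup>2 * \<sigma> (B j) / 2)))) = complex_of_real (exp (- (u\<^sup>2 * (\<Sum>j<k. \<sigma> (B j)) / 2)))"
      by (simp add: exp_sum[symmetric] of_real_prod[symmetric] sum_negf sum_distrib_left sum_divide_distrib del: of_real_prod)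
    then have "cmod ((\<Prod>j<k. complex_of_real (exp (- (u\<^sup>2 * \<sigma> (B j) / 2)))) - complex_of_real (exp (- (u\<^sup>2 * \<sigma> {1..N} / 2))))
       = \<bar>exp (- (u\<^sup>2 * (\<Sum>j<k. \<sigma> (B j)) / 2)) - exp (- (u\<^sup>2 * \<sigma> {1..N} / 2))\<bar>"
      by (simp only: of_real_diff[symmetric] norm_of_real)
    also have "\<dots> \<le> \<bar>u\<^sup>2 * (\<Sum>j<k. \<sigma> (B j)) / 2 - u\<^sup>2 * \<sigma> {1..N} / 2\<bar>"
      using \<sigma>0 by (intro exp_minus_diff_le) (auto intro!: divide_nonneg_nonneg mult_nonneg_nonneg sum_nonneg)
    also have "\<dots> = u\<^sup>2 / 2 * \<bar>(\<Sum>j<k. \<sigma> (B j)) - \<sigma> {1..N}\<bar>"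
      by (simp add: right_diff_distrib[symmetric] diff_divide_distrib[symmetric] abs_mult)
    also have "\<dots> \<le> u\<^sup>2 / 2 * (n / real p * (8 * D * sqrt (real p)) + 10 * D * (n * sqrt \<rho>))"
    proof (rule mult_left_mono)
      have "\<bar>\<sigma> U - (\<Sum>j<k. \<sigma> (B j))\<bar> \<le> real k * (8 * D * sqrt (real p))"
        unfolding \<sigma>_def U_def B_def
        by (rule block_variance_sum) (use BN disj in \<open>simp_all only: B_def[abs_def]\<close>)
      also have "\<dots> \<le> n / real p * (8 * D * sqrt (real p))"
        using knp D_ge_1 by (intro mult_right_mono) auto
      finally have a: "\<bar>\<sigma> U - (\<Sum>j<k. \<sigma> (B j))\<bar> \<le> n / real p * (8 * D * sqrt (real p))" .
      have "\<bar>\<sigma> {1..N} - \<sigma> U\<bar> \<le> 10 * D * sqrt (n * (n - real (k * p)))"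
        using S_second_moment_diff(2)[OF UN] by (simp add: \<sigma>_def n_def cardU)
      also have "\<dots> \<le> 10 * D * sqrt (n * (\<rho> * n))"
        using rest n D_ge_1 by (intro mult_left_mono real_sqrt_le_mono) auto
      also have "sqrt (n * (\<rho> * n)) = n * sqrt \<rho>"
        using n by (simp add: real_sqrt_mult)
      finally have b: "\<bar>\<sigma> {1..N} - \<sigma> U\<bar> \<le> 10 * D * (n * sqrt \<rho>)" .
      from a b show "\<bar>(\<Sum>j<k. \<sigma> (B j)) - \<sigma> {1..N}\<bar> \<le> n / real p * (8 * D * sqrt (real p)) + 10 * D * (n * sqrt \<rho>)"
        by linarith
    qed (use u in simp)
    also have "\<dots> = s\<^sup>2 * (4 * D * (sqrt (real p) / real p) + 5 * D * sqrt \<rho>)"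
      unfolding u2 using n by (simp add: field_simps)
    also have "sqrt (real p) / real p = 1 / sqrt (real p)"
      using P by (simp add: field_simps)
    finally show ?thesis by simp
  qed
  have "cmod (e {1..N} - complex_of_real (exp (- (u\<^sup>2 * \<sigma> {1..N} / 2))))
      \<le> cmod (e {1..N} - e U) + cmod (e U - (\<Prod>j<k. e (B j)))
       + cmod ((\<Prod>j<k. e (B j)) - (\<Prod>j<k. complex_of_real (exp (- (u\<^sup>2 * \<sigma> (B j) / 2)))))
       + cmod ((\<Prod>j<k. complex_of_real (exp (- (u\<^sup>2 * \<sigma> (B j) / 2)))) - complex_of_real (exp (- (u\<^sup>2 * \<sigma> {1..N} / 2))))"
    by (intro norm_triangle_le_diff norm_diff_triangle_le[where y = "(\<Prod>j<k. complex_of_real (exp (- (u\<^sup>2 * \<sigma> (B j) / 2))))"]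
          norm_diff_triangle_le[where y = "\<Prod>j<k. e (B j)"] norm_diff_triangle_le[where y = "e U"] order_refl)
  also note add_mono[OF add_mono[OF add_mono[OF 1 2] 3] 4]
  finally show ?thesis
    unfolding e_def \<sigma>_def u_def[symmetric] n_def[symmetric] u2
    by (simp add: exp_of_real add.assoc n_def u2 mult.commute[of "2::real" "real N"])
qed

end

text \<open>\<open>err\<close> depends on \<open>s\<close>, \<open>A\<close> and \<open>C\<close>
  alone, not on the measure, the filtration or the array. By this uniformity a single sequence
  serves all blocks of all rows, each block being an array of its own.\<close>

theorem weakly_dependent_clt:
  assumes "0 < s"
  obtains err :: "nat \<Rightarrow> real" where "err \<longlonglongrightarrow> 0"
    "\<And>(M :: 'a measure) F X N. weakly_dependent M F X N A C \<Longrightarrow> 1 \<le> N \<Longrightarrow>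
      cmod ((\<integral>\<omega>. iexp (s / sqrt (real N) * (\<Sum>i=1..N. X i \<omega>)) \<partial>M)
        - exp (- (s\<^sup>2 * (\<integral>\<omega>. (\<Sum>i=1..N. X i \<omega>)\<^sup>2 \<partial>M) / (2 * real N)))) \<le> err N"
proof
  \<comment> \<open>Blocks \<open>p\<close> and gaps \<open>q\<close> must satisfy \<open>q \<lless> p \<lless> N\<^sup>1\<^sup>/\<^sup>4\<close> (third moments of blocks are bounded trivially
    by \<open>p\<^sup>3\<close>) and \<open>sqrt N * p \<lless> q\<^sup>4\<close> (dependence between blocks).\<close>
  define p q where "p N = nat \<lceil>real N powr (24/100)\<rceil>" and "q N = nat \<lceil>real N powr (20/100)\<rceil>" for N :: nat
  define d where "d = 1 + 3 * A + C"
  define \<rho> where "\<rho> N = real (q N) / real (p N) + real (p N + q N) / real N" for N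
  define err where "err N = s * sqrt (5 * d * \<rho> N) + 4 * C * s * sqrt (real N) * real (p N) / real (q N) ^ 4
      + s ^ 3 * (real (p N))\<^sup>2 * (1 + A) / (6 * sqrt (real N)) + s ^ 4 * real (p N) ^ 3 * (1 + A)\<^sup>2 / (8 * real N)
      + s\<^sup>2 * (4 * d / sqrt (real (p N)) + 5 * d * sqrt (\<rho> N))" for N
  have \<rho>: "\<rho> \<longlonglongrightarrow> 0" unfolding \<rho>_def p_def q_def by real_asymp
  have l1: "(\<lambda>N. sqrt (real N) * real (p N) / real (q N) ^ 4) \<longlonglongrightarrow> 0" unfolding p_def q_def by real_asymp
  have l2: "(\<lambda>N. (real (p N))\<^sup>2 / sqrt (real N)) \<longlonglongrightarrow> 0" unfolding p_def by real_asymp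
  have l3: "(\<lambda>N. (real (p N))^3 / real N) \<longlonglongrightarrow> 0" unfolding p_def by real_asymp
  have l4: "(\<lambda>N. 1 / sqrt (real (p N))) \<longlonglongrightarrow> 0" unfolding p_def by real_asymp
  have "(\<lambda>N. s * sqrt (5 * d * \<rho> N) + 4 * C * s * (sqrt (real N) * real (p N) / real (q N) ^ 4)
      + s ^ 3 * (1 + A) / 6 * ((real (p N))\<^sup>2 / sqrt (real N)) + s ^ 4 * (1 + A)\<^sup>2 / 8 * (real (p N) ^ 3 / real N)
      + s\<^sup>2 * (4 * d * (1 / sqrt (real (p N))) + 5 * d * sqrt (\<rho> N)))
      \<longlonglongrightarrow> s * sqrt (5 * d * 0) + 4 * C * s * 0 + s ^ 3 * (1 + A) / 6 * 0 + s ^ 4 * (1 + A)\<^sup>2 / 8 * 0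
        + s\<^sup>2 * (4 * d * 0 + 5 * d * sqrt 0)"
    by (intro tendsto_intros \<rho> l1 l2 l3 l4)
  then show "err \<longlonglongrightarrow> 0" by (simp add: err_def[abs_def] mult_ac)
  fix M :: "'a measure" and F X N
  assume wd: "weakly_dependent M F X N A C" and N: "1 \<le> N"
  interpret weakly_dependent M F X N A C by fact
  have "1 \<le> nat \<lceil>x\<rceil>" if "0 < x" for x :: real
    using that zero_less_ceiling[of x] by linarith
  then have "1 \<le> p N" "1 \<le> q N"
    using N unfolding p_def q_def by simp_all
  from clt_bound[OF this N assms]
  show "cmod ((\<integral>\<omega>. iexp (s / sqrt (real N) * (\<Sum>i=1..N. X i \<omega>)) \<partial>M)
        - exp (- (s\<^sup>2 * (\<integral>\<omega>. (\<Sum>i=1..N. X i \<omega>)\<^sup>2 \<partial>M) / (2 * real N)))) \<le> err N"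
    by (simp add: err_def \<rho>_def d_def D_def S_def)
qed

subsection \<open>Consistency of the block variance\<close>

text \<open>A bounded trigonometric substitute for truncating \<open>x\<^sup>2\<close>: its expectation is read off
  the characteristic function.\<close>

definition trig_trunc :: "real \<Rightarrow> real \<Rightarrow> real" where
  "trig_trunc K x = 2 * K\<^sup>2 * (1 - cos (x / K))"

lemma trig_trunc_measurable [measurable]: "trig_trunc K \<in> borel_measurable borel"
  unfolding trig_trunc_def[abs_def] by measurable

lemma trig_trunc_bounds: "0 \<le> trig_trunc K x" "trig_trunc K x \<le> 4 * K\<^sup>2"
proof -
  show "0 \<le> trig_trunc K x" unfolding trig_trunc_def by (intro mult_nonneg_nonneg) auto
  have "2 * K\<^sup>2 * (1 - cos (x / K)) \<le> 2 * K\<^sup>2 * 2"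
    using cos_ge_minus_one[of "x / K"] by (intro mult_left_mono) (linarith, simp)
  then show "trig_trunc K x \<le> 4 * K\<^sup>2" by (simp add: trig_trunc_def)
qed

lemma trig_trunc_le_square:
  assumes "0 < K"
  shows "trig_trunc K x \<le> x\<^sup>2"
proof -
  have "1 - cos (x / K) = 2 * (sin (x / K / 2))\<^sup>2"
    using cos_double_sin[of "x / K / 2"] by simp
  also have "(sin (x / K / 2))\<^sup>2 \<le> (x / K / 2)\<^sup>2"
    using abs_sin_x_le_abs_x[of "x / K / 2"] by (metis abs_le_square_iff)
  finally have "2 * K\<^sup>2 * (1 - cos (x / K)) \<le> 2 * K\<^sup>2 * (2 * (x / K / 2)\<^sup>2)"
    by (intro mult_left_mono) auto
  then show ?thesis using assms by (simp add: trig_trunc_def power_divide)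
qed

lemma trig_trunc_lipschitz:
  assumes "0 < K"
  shows "\<bar>trig_trunc K x - trig_trunc K y\<bar> \<le> 2 * K * \<bar>x - y\<bar>"
proof -
  have "\<bar>trig_trunc K x - trig_trunc K y\<bar> = 2 * K\<^sup>2 * \<bar>cos (x / K) - cos (y / K)\<bar>"
    by (simp add: trig_trunc_def right_diff_distrib[symmetric] abs_mult) (simp add: abs_minus_commute)
  also have "\<dots> \<le> 2 * K\<^sup>2 * \<bar>x / K - y / K\<bar>"
    by (intro mult_left_mono abs_cos_diff_le) simp
  also have "\<dots> = 2 * K * \<bar>x - y\<bar>"
    using assms by (simp add: diff_divide_distrib[symmetric] power2_eq_square)
  finally show ?thesis .
qed

context weakly_dependent
begin

text \<open>A block is again weakly dependent with the same \<open>A\<close> and \<open>C\<close>: a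
  shift preserves the lag \<open>r\<close> and the cardinality of \<open>v\<close>. Hence the
  central limit theorem holds inside each block with a common error.\<close>

lemma shifted:
  assumes "a + n \<le> N"
  shows "weakly_dependent M (\<lambda>i. F (a + i)) (\<lambda>i. X (a + i)) n A C"
proof
  show "sets (F (a + i)) \<subseteq> sets (F (a + j))" if "i \<le> j" for i j
    using that by (intro filtration) simp
next
  fix l r v H \<psi> and K L :: real
  assume h: "1 \<le> l" "1 \<le> r" "v \<noteq> {}" "v \<subseteq> {l + r..n}" "H \<in> borel_measurable (F (a + l))"
    "\<And>\<omega>. \<omega> \<in> space M \<Longrightarrow> \<bar>H \<omega>\<bar> \<le> K" "0 < L" "\<And>x y. \<bar>\<psi> x - \<psi> y\<bar> \<le> L * \<bar>x - y\<bar>"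
  have s: "(\<Sum>i\<in>v. X (a + i) \<omega>) = (\<Sum>i\<in>(+) a ` v. X i \<omega>)" for \<omega>
    by (subst sum.reindex) auto
  have c: "card ((+) a ` v) = card v" by (simp add: card_image)
  show "\<bar>expectation (\<lambda>\<omega>. H \<omega> * \<psi> (\<Sum>i\<in>v. X (a + i) \<omega>))
        - expectation H * expectation (\<lambda>\<omega>. \<psi> (\<Sum>i\<in>v. X (a + i) \<omega>))\<bar>
      \<le> C * K * L * (real (card v))\<^sup>2 / real r ^ 4"
    unfolding s c[symmetric]
  proof (rule dependence[where l = "a + l"])
    show "(+) a ` v \<subseteq> {a + l + r..N}" using h(4) assms by (auto dest!: subsetD)
  qed (use h in auto)
qed (use assms in \<open>simp_all add: subalg nonneg adapted moment_integrable moment_le centered\<close>)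

text \<open>Since \<open>trig_trunc K x\<close> never exceeds \<open>x^2\<close>, the absolute value
  is the difference itself and its expectation is the variance minus the expected truncation. The
  latter is read off the characteristic function at \<open>1 / K\<close>, which is within
  \<open>\<eta>\<close> of a Gaussian one. A normal variable loses only
  \<open>\<sigma>^2 / (4 * K^2)\<close> in this way, and \<open>\<sigma>\<close> is at most
  \<open>5 * D\<close>.\<close>

lemma trig_trunc_gap:
  assumes v: "v \<subseteq> {1..N}" and b: "card v = b" "1 \<le> b" and K: "0 < K"
    and \<eta>: "cmod (expectation (\<lambda>\<omega>. iexp (1 / K / sqrt (real b) * S v \<omega>))
        - exp (- ((1 / K)\<^sup>2 * expectation (\<lambda>\<omega>. (S v \<omega>)\<^sup>2) / (2 * real b)))) \<le> \<eta>"
  shows "expectation (\<lambda>\<omega>. \<bar>(S v \<omega>)\<^sup>2 / real b - trig_trunc K (S v \<omega> / sqrt (real b))\<bar>)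
    \<le> 25 * D\<^sup>2 / (4 * K\<^sup>2) + 2 * K\<^sup>2 * \<eta>"
    and "integrable M (\<lambda>\<omega>. (S v \<omega>)\<^sup>2 / real b - trig_trunc K (S v \<omega> / sqrt (real b)))"
proof -
  note [measurable] = S_measurable[OF v]
  define Z where "Z \<omega> = S v \<omega> / sqrt (real b)" for \<omega>
  have [measurable]: "Z \<in> borel_measurable M" unfolding Z_def[abs_def] by measurable
  have Z2: "(Z \<omega>)\<^sup>2 = (S v \<omega>)\<^sup>2 / real b" for \<omega> by (simp add: Z_def power_divide)
  define \<sigma> where "\<sigma> = expectation (\<lambda>\<omega>. (Z \<omega>)\<^sup>2)"
  have \<sigma>_eq: "\<sigma> = expectation (\<lambda>\<omega>. (S v \<omega>)\<^sup>2) / real b" unfolding \<sigma>_def Z2 by simp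
  have \<sigma>: "0 \<le> \<sigma>" "\<sigma> \<le> 5 * D"
    using S_second_moment_le[OF v] b by (simp_all add: \<sigma>_eq field_simps)
  define y where "y = \<sigma> / (2 * K\<^sup>2)"
  have y: "0 \<le> y" using \<sigma> by (simp add: y_def)
  have i2: "integrable M (\<lambda>\<omega>. (Z \<omega>)\<^sup>2)" using S_square_integrable[OF v] unfolding Z2 by simp
  have ic: "integrable M (\<lambda>\<omega>. cos (Z \<omega> / K))"
    by (rule integrable_const_bound[where B = 1]) auto
  have it: "integrable M (\<lambda>\<omega>. trig_trunc K (Z \<omega>))"
    unfolding trig_trunc_def using ic by simp
  show "integrable M (\<lambda>\<omega>. (S v \<omega>)\<^sup>2 / real b - trig_trunc K (S v \<omega> / sqrt (real b)))"
    using Bochner_Integration.integrable_diff[OF i2 it] by (simp add: Z2) (simp add: Z_def)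
  have arg: "1 / K / sqrt (real b) * S v \<omega> = Z \<omega> / K" for \<omega> by (simp add: Z_def)
  have "expectation (\<lambda>\<omega>. cos (Z \<omega> / K)) = Re (expectation (\<lambda>\<omega>. iexp (Z \<omega> / K)))"
  proof -
    have "integrable M (\<lambda>\<omega>. iexp (Z \<omega> / K))" by (rule integrable_iexp) simp_all
    from integral_Re[OF this] show ?thesis by (simp add: Re_exp del: of_real_divide)
  qed
  also have "\<dots> \<le> exp (- y) + \<eta>"
  proof -
    have e: "(1 / K)\<^sup>2 * expectation (\<lambda>\<omega>. (S v \<omega>)\<^sup>2) / (2 * real b) = y"
      by (simp add: y_def \<sigma>_eq power_divide field_simps)
    have "Re (expectation (\<lambda>\<omega>. iexp (Z \<omega> / K)) - complex_of_real (exp (- y))) \<le> \<eta>"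
      by (rule order_trans[OF complex_Re_le_cmod]) (use \<eta> in \<open>simp only: e arg\<close>)
    then show ?thesis by simp
  qed
  also have "exp (- y) \<le> 1 - y + y\<^sup>2 / 2" using y by (rule exp_minus_le_Taylor)
  finally have c: "y - y\<^sup>2 / 2 - \<eta> \<le> 1 - expectation (\<lambda>\<omega>. cos (Z \<omega> / K))" by simp
  \<comment> \<open>With \<open>y = \<sigma> / (2 * K^2)\<close>, the factor \<open>2 * K^2\<close>
    turns \<open>y\<close> into \<open>\<sigma>\<close> and \<open>y^2 / 2\<close> into
    \<open>\<sigma>^2 / (4 * K^2)\<close>.\<close>
  have "\<sigma> - 25 * D\<^sup>2 / (4 * K\<^sup>2) - 2 * K\<^sup>2 * \<eta> \<le> \<sigma> - \<sigma>\<^sup>2 / (4 * K\<^sup>2) - 2 * K\<^sup>2 * \<eta>"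
  proof -
    have "\<sigma>\<^sup>2 \<le> (5 * D)\<^sup>2" using \<sigma> by (intro power_mono) auto
    then show ?thesis by (simp add: divide_right_mono power_mult_distrib)
  qed
  also have "\<dots> = 2 * K\<^sup>2 * (y - y\<^sup>2 / 2 - \<eta>)"
    using K by (simp add: y_def field_simps power2_eq_square)
  also have "\<dots> \<le> 2 * K\<^sup>2 * (1 - expectation (\<lambda>\<omega>. cos (Z \<omega> / K)))"
    by (intro mult_left_mono c) simp
  also have "\<dots> = expectation (\<lambda>\<omega>. trig_trunc K (Z \<omega>))"
    unfolding trig_trunc_def using ic by (simp add: prob_space)
  finally have "expectation (\<lambda>\<omega>. (Z \<omega>)\<^sup>2 - trig_trunc K (Z \<omega>)) \<le> 25 * D\<^sup>2 / (4 * K\<^sup>2) + 2 * K\<^sup>2 * \<eta>"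
    using i2 it by (simp add: \<sigma>_def)
  moreover have "\<bar>(S v \<omega>)\<^sup>2 / real b - trig_trunc K (S v \<omega> / sqrt (real b))\<bar> = (Z \<omega>)\<^sup>2 - trig_trunc K (Z \<omega>)" for \<omega>
    using trig_trunc_le_square[OF K, of "Z \<omega>"] unfolding Z2 unfolding Z_def by simp
  ultimately show "expectation (\<lambda>\<omega>. \<bar>(S v \<omega>)\<^sup>2 / real b - trig_trunc K (S v \<omega> / sqrt (real b))\<bar>)
    \<le> 25 * D\<^sup>2 / (4 * K\<^sup>2) + 2 * K\<^sup>2 * \<eta>" by simp
qed

text \<open>After truncation the block variables are bounded by \<open>4 * K^2\<close> and Lipschitz
  in the block sum with constant \<open>2 * K / sqrt b\<close>, so the covariance inequality applies
  to them. Adjacent blocks have no gap and are estimated trivially, at most three per row of the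
  covariance matrix, whence \<open>48 = 3 * 16\<close>; all other pairs contribute little.\<close>

lemma truncated_blocks_variance:
  assumes b: "1 \<le> b" and m: "m * b \<le> N" and K: "0 < K"
  defines "B \<equiv> \<lambda>j. {j * b + 1..j * b + b}"
  defines "\<Phi> \<equiv> \<lambda>j \<omega>. trig_trunc K (S (B j) \<omega> / sqrt (real b))"
  shows "expectation (\<lambda>\<omega>. (\<Sum>j<m. \<Phi> j \<omega> - expectation (\<Phi> j))\<^sup>2)
      \<le> real m * (48 * K ^ 4) + (real m)\<^sup>2 * (8 * C * K ^ 3 / real b)"
    and "\<And>j. j < m \<Longrightarrow> integrable M (\<Phi> j)"
    and "integrable M (\<lambda>\<omega>. (\<Sum>j<m. \<Phi> j \<omega> - expectation (\<Phi> j))\<^sup>2)"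
proof -
  have BN: "B j \<subseteq> {1..N}" if "j < m" for j
    using mult_le_mono1[of "Suc j" m b] that m by (auto simp: B_def)
  have meas: "\<Phi> j \<in> borel_measurable M" if "j < m" for j
    unfolding \<Phi>_def using S_measurable[OF BN[OF that]] by measurable
  have bd: "0 \<le> \<Phi> j \<omega>" "\<Phi> j \<omega> \<le> 4 * K\<^sup>2" for j \<omega>
    unfolding \<Phi>_def by (rule trig_trunc_bounds)+
  show i\<Phi>: "integrable M (\<Phi> j)" if "j < m" for j
    using meas[OF that] bd by (intro integrable_const_bound[where B = "4 * K\<^sup>2"]) auto
  define c where "c j = expectation (\<Phi> j)" for j
  have c: "0 \<le> c j" "c j \<le> 4 * K\<^sup>2" if "j < m" for j
  proof -
    show "0 \<le> c j" unfolding c_def using bd by (intro integral_nonneg_AE) auto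
    have "c j \<le> expectation (\<lambda>_. 4 * K\<^sup>2)" unfolding c_def using i\<Phi>[OF that] bd by (intro integral_mono) auto
    then show "c j \<le> 4 * K\<^sup>2" by (simp add: prob_space)
  qed
  define V where "V j \<omega> = \<Phi> j \<omega> - c j" for j \<omega>
  have Vm [measurable]: "V j \<in> borel_measurable M" if "j < m" for j
    unfolding V_def[abs_def] using meas[OF that] by measurable
  have Vb: "\<bar>V j \<omega>\<bar> \<le> 4 * K\<^sup>2" if "j < m" for j \<omega>
    using bd[of j \<omega>] c[OF that] by (auto simp: V_def)
  have VV: "\<bar>V i \<omega> * V j \<omega>\<bar> \<le> 16 * K ^ 4" if "i < m" "j < m" for i j \<omega>
  proof -
    have "\<bar>V i \<omega> * V j \<omega>\<bar> \<le> (4 * K\<^sup>2) * (4 * K\<^sup>2)"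
      unfolding abs_mult using Vb[OF that(1)] Vb[OF that(2)] by (intro mult_mono) auto
    also have "\<dots> = 16 * K ^ 4" by (simp add: power4_eq_xxxx power2_eq_square)
    finally show ?thesis .
  qed
  have iVV: "integrable M (\<lambda>\<omega>. V i \<omega> * V j \<omega>)" if "i < m" "j < m" for i j
    using VV[OF that] Vm[OF that(1)] Vm[OF that(2)]
    by (intro integrable_const_bound[where B = "16 * K ^ 4"]) auto
  have near: "\<bar>expectation (\<lambda>\<omega>. V i \<omega> * V j \<omega>)\<bar> \<le> 16 * K ^ 4" if "i < m" "j < m" for i j
  proof -
    have "\<bar>expectation (\<lambda>\<omega>. V i \<omega> * V j \<omega>)\<bar> \<le> expectation (\<lambda>\<omega>. \<bar>V i \<omega> * V j \<omega>\<bar>)"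
      by (rule integral_abs_bound)
    also have "\<dots> \<le> expectation (\<lambda>_. 16 * K ^ 4)"
      using VV[OF that] iVV[OF that] by (intro integral_mono) auto
    finally show ?thesis by (simp add: prob_space)
  qed
  \<comment> \<open>\<open>i + 2 \<le> j\<close> leaves at least one whole block between the two, so
    the lag is \<open>b\<close>. The bound \<open>b^2 / b ^ 4\<close>, improved by the Lipschitz
    factor \<open>1 / sqrt b\<close>, is rounded up to \<open>1 / b\<close>.\<close>
  have far0: "\<bar>expectation (\<lambda>\<omega>. V i \<omega> * V j \<omega>)\<bar> \<le> 8 * C * K ^ 3 / real b" if "i < m" "j < m" "i + 2 \<le> j" for i j
  proof -
    have g: "i * b + b + b \<le> j * b" using mult_le_mono1[OF that(3), of b] by simp
    have cov: "expectation (\<lambda>\<omega>. V i \<omega> * V j \<omega>) = expectation (\<lambda>\<omega>. \<Phi> i \<omega> * \<Phi> j \<omega>) - c i * c j"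
    proof -
      have i: "integrable M (\<lambda>\<omega>. \<Phi> i \<omega> * \<Phi> j \<omega>)"
      proof (intro integrable_const_bound[where B = "4 * K\<^sup>2 * (4 * K\<^sup>2)"] AE_I2)
        show "norm (\<Phi> i \<omega> * \<Phi> j \<omega>) \<le> 4 * K\<^sup>2 * (4 * K\<^sup>2)" for \<omega>
          unfolding norm_mult using bd by (intro mult_mono) auto
      qed (use meas[OF that(1)] meas[OF that(2)] in measurable)
      have "(\<lambda>\<omega>. V i \<omega> * V j \<omega>) = (\<lambda>\<omega>. \<Phi> i \<omega> * \<Phi> j \<omega> - c i * \<Phi> j \<omega> - c j * \<Phi> i \<omega> + c i * c j)"
        by (auto simp: V_def algebra_simps)
      then show ?thesis using i i\<Phi>[OF that(1)] i\<Phi>[OF that(2)]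
        by (simp add: prob_space c_def[symmetric])
    qed
    have "\<bar>expectation (\<lambda>\<omega>. \<Phi> i \<omega> * trig_trunc K ((\<Sum>x\<in>B j. X x \<omega>) / sqrt (real b)))
        - expectation (\<Phi> i) * expectation (\<lambda>\<omega>. trig_trunc K ((\<Sum>x\<in>B j. X x \<omega>) / sqrt (real b)))\<bar>
      \<le> C * (4 * K\<^sup>2) * (2 * K / sqrt (real b)) * (real (card (B j)))\<^sup>2 / real b ^ 4"
    proof (rule dependence[where l = "i * b + b"])
      show "B j \<noteq> {}" "B j \<subseteq> {i * b + b + b..N}" using b g BN[OF that(2)] by (auto simp: B_def)
      show "\<Phi> i \<in> borel_measurable (F (i * b + b))"
        unfolding \<Phi>_def using S_measurable_F[OF BN[OF that(1)], of "i * b + b"] by (simp add: B_def)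
      show "\<bar>trig_trunc K (x / sqrt (real b)) - trig_trunc K (y / sqrt (real b))\<bar>
          \<le> 2 * K / sqrt (real b) * \<bar>x - y\<bar>" for x y
        using trig_trunc_lipschitz[OF K, of "x / sqrt (real b)" "y / sqrt (real b)"]
        by (simp add: diff_divide_distrib[symmetric])
    qed (use b K bd in auto)
    also have "\<dots> = 8 * C * K ^ 3 / (sqrt (real b) * (real b)\<^sup>2)"
      using b by (simp add: B_def power4_eq_xxxx power3_eq_cube power2_eq_square)
    also have "\<dots> \<le> 8 * C * K ^ 3 / real b"
    proof (rule divide_left_mono)
      have "1 * (real b * 1) \<le> sqrt (real b) * (real b * real b)"
        using b by (intro mult_mono) auto
      then show "real b \<le> sqrt (real b) * (real b)\<^sup>2" by (simp add: power2_eq_square)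
    qed (use b K nonneg in auto)
    finally show ?thesis unfolding cov by (simp add: c_def \<Phi>_def S_def)
  qed
  have far: "\<bar>expectation (\<lambda>\<omega>. V i \<omega> * V j \<omega>)\<bar> \<le> 8 * C * K ^ 3 / real b" if "i < m" "j < m" "i + 2 \<le> j \<or> j + 2 \<le> i" for i j
    using far0[of i j] far0[of j i] that by (auto simp: mult.commute)
  have "expectation (\<lambda>\<omega>. (\<Sum>j<m. V j \<omega>)\<^sup>2) = (\<Sum>i<m. \<Sum>j<m. expectation (\<lambda>\<omega>. V i \<omega> * V j \<omega>))"
    unfolding power2_eq_square sum_product
    by (subst Bochner_Integration.integral_sum, force intro: iVV,
        intro sum.cong refl Bochner_Integration.integral_sum) (auto intro: iVV)
  \<comment> \<open>For \<open>i = 0\<close> the subtraction stops at 0 and the window has two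
    elements instead of three.\<close>
  also have "\<dots> \<le> (\<Sum>i<m. \<Sum>j<m. (if j \<in> {i - 1..i + 1} then 16 * K ^ 4 else 0) + 8 * C * K ^ 3 / real b)"
  proof (intro sum_mono)
    fix i j assume ij: "i \<in> {..<m}" "j \<in> {..<m}"
    have nn: "0 \<le> 8 * C * K ^ 3 / real b" using nonneg K by simp
    show "expectation (\<lambda>\<omega>. V i \<omega> * V j \<omega>) \<le> (if j \<in> {i - 1..i + 1} then 16 * K ^ 4 else 0) + 8 * C * K ^ 3 / real b"
    proof (cases "j \<in> {i - 1..i + 1}")
      case True
      then show ?thesis using near[of i j] ij nn by auto
    next
      case False
      then have "i + 2 \<le> j \<or> j + 2 \<le> i" by auto
      then show ?thesis using far[of i j] ij False by auto
    qed
  qed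
  also have "\<dots> \<le> (\<Sum>i<m. 3 * (16 * K ^ 4) + real m * (8 * C * K ^ 3 / real b))"
  proof (intro sum_mono)
    fix i
    have "(\<Sum>j<m. if j \<in> {i - 1..i + 1} then 16 * K ^ 4 else 0) = real (card ({..<m} \<inter> {i - 1..i + 1})) * (16 * K ^ 4)"
      by (subst sum.inter_restrict[symmetric]) simp_all
    also have "\<dots> \<le> 3 * (16 * K ^ 4)"
    proof (rule mult_right_mono)
      have "card ({..<m} \<inter> {i - 1..i + 1}) \<le> card {i - 1..i + 1}" by (intro card_mono) auto
      also have "\<dots> \<le> 3" by simp
      finally show "real (card ({..<m} \<inter> {i - 1..i + 1})) \<le> 3" by simp
    qed simp
    finally show "(\<Sum>j<m. (if j \<in> {i - 1..i + 1} then 16 * K ^ 4 else 0) + 8 * C * K ^ 3 / real b)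
      \<le> 3 * (16 * K ^ 4) + real m * (8 * C * K ^ 3 / real b)" by (simp add: sum.distrib)
  qed
  also have "\<dots> = real m * (48 * K ^ 4) + (real m)\<^sup>2 * (8 * C * K ^ 3 / real b)"
    by (simp add: algebra_simps power2_eq_square)
  finally show "expectation (\<lambda>\<omega>. (\<Sum>j<m. \<Phi> j \<omega> - expectation (\<Phi> j))\<^sup>2)
      \<le> real m * (48 * K ^ 4) + (real m)\<^sup>2 * (8 * C * K ^ 3 / real b)"
    by (simp add: V_def c_def)
  have "integrable M (\<lambda>\<omega>. (\<Sum>j<m. V j \<omega>)\<^sup>2)"
    unfolding power2_eq_square sum_product by (auto intro!: Bochner_Integration.integrable_sum iVV)
  then show "integrable M (\<lambda>\<omega>. (\<Sum>j<m. \<Phi> j \<omega> - expectation (\<Phi> j))\<^sup>2)"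
    by (simp add: V_def c_def)
qed

end

section \<open>The mean error of the block variance estimator at a fixed truncation level\<close>

context weakly_dependent
begin

text \<open>The first summand is the truncation gap, doubled because the lost part is centred; the
  square root is the standard deviation of the truncated sum; \<open>8 * D / sqrt b\<close> compares
  the sum of the block variances with the variance of their union. In
  \<open>20 * D * sqrt (b / N)\<close> one half accounts for the at most \<open>b\<close> indices
  beyond the last block and the other for the cross term of a block sum with the sample mean; the
  square of the sample mean gives \<open>5 * D * b / N\<close>.\<close>

lemma block_variance_bound:
  assumes b: "1 \<le> b" "b \<le> N" and K: "0 < K"
  defines "B \<equiv> \<lambda>j. {j * b + 1..j * b + b}"
  assumes \<eta>: "\<And>j. j < N div b \<Longrightarrow> cmod (expectation (\<lambda>\<omega>. iexp (1 / K / sqrt (real b) * S (B j) \<omega>))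
        - exp (- ((1 / K)\<^sup>2 * expectation (\<lambda>\<omega>. (S (B j) \<omega>)\<^sup>2) / (2 * real b)))) \<le> \<eta>"
  shows "expectation (\<lambda>\<omega>. \<bar>(\<Sum>j<N div b. (S (B j) \<omega> - real b / real N * S {1..N} \<omega>)\<^sup>2) / real N
      - expectation (\<lambda>\<omega>. (S {1..N} \<omega>)\<^sup>2) / real N\<bar>)
    \<le> 2 * (25 * D\<^sup>2 / (4 * K\<^sup>2) + 2 * K\<^sup>2 * \<eta>) + sqrt (96 * K ^ 4 * (real b / real N) + 8 * C * K ^ 3 / real b)
      + 8 * D / sqrt (real b) + 20 * D * sqrt (real b / real N) + 5 * D * (real b / real N)"
proof -
  define m where "m = N div b"
  define n where "n = real N"
  define \<beta> where "\<beta> = real b"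
  define G where "G = 25 * D\<^sup>2 / (4 * K\<^sup>2) + 2 * K\<^sup>2 * \<eta>"
  define \<sigma> where "\<sigma> v = expectation (\<lambda>\<omega>. (S v \<omega>)\<^sup>2)" for v
  define T where "T = S {1..N}"
  define U where "U = (\<Union>j<m. B j)"
  define \<Phi> where "\<Phi> j \<omega> = trig_trunc K (S (B j) \<omega> / sqrt \<beta>)" for j \<omega>
  define W where "W j \<omega> = (S (B j) \<omega>)\<^sup>2 / \<beta> - \<Phi> j \<omega>" for j \<omega>
  have n: "1 \<le> n" "0 < n" and \<beta>: "1 \<le> \<beta>" "\<beta> \<le> n" using b by (simp_all add: n_def \<beta>_def)
  have mN: "m * b \<le> N" by (simp add: m_def)
  have m1: "1 \<le> real m"
  proof -
    have "0 < m" using b by (simp add: m_def div_greater_zero_iff)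
    then show ?thesis by simp
  qed
  have mbn: "real m * \<beta> \<le> n" using mN unfolding n_def \<beta>_def by (metis of_nat_le_iff of_nat_mult)
  have nmb: "n \<le> real m * \<beta> + \<beta>"
  proof -
    have "N \<le> m * b + b" using div_mult_mod_eq[of N b] mod_less_divisor[of b N] b unfolding m_def by linarith
    then have "real N \<le> real (m * b + b)" by (rule of_nat_mono)
    then show ?thesis by (simp add: n_def \<beta>_def)
  qed
  have BN: "B j \<subseteq> {1..N}" if "j < m" for j
    using mult_le_mono1[of "Suc j" m b] that mN by (auto simp: B_def)
  have UN: "U \<subseteq> {1..N}" using BN by (force simp: U_def)
  have disj: "disjoint_family_on B {..<m}"
  proof -
    have "B i \<inter> B j = {}" if "i < j" for i j
    proof -
      have "i * b + b \<le> j * b" using mult_le_mono1[of "Suc i" j b] that by simp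
      then show ?thesis by (auto simp: B_def)
    qed
    then show ?thesis unfolding disjoint_family_on_def by (metis Int_commute linorder_neqE_nat)
  qed
  have cardU: "real (card U) = real m * \<beta>"
    unfolding U_def using disj
    by (subst card_UN_disjoint) (auto simp: B_def \<beta>_def disjoint_family_on_def)
  have iQ: "integrable M (\<lambda>\<omega>. (S (B j) \<omega>)\<^sup>2)" if "j < m" for j
    using BN[OF that] by (rule S_square_integrable)
  have gap: "expectation (\<lambda>\<omega>. \<bar>W j \<omega>\<bar>) \<le> G" "integrable M (W j)" if "j < m" for j
    using trig_trunc_gap[OF BN[OF that] _ b(1) K \<eta>] that
    by (simp_all add: W_def[abs_def] \<Phi>_def \<beta>_def G_def m_def B_def)
  have i\<Phi>: "integrable M (\<Phi> j)" if "j < m" for j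
    using truncated_blocks_variance(2)[OF b(1) mN K that] by (simp add: \<Phi>_def[abs_def] B_def \<beta>_def)
  define R where "R \<omega> = (\<Sum>j<m. \<Phi> j \<omega> - expectation (\<Phi> j))" for \<omega>
  have iR: "integrable M R" unfolding R_def[abs_def] using i\<Phi> by auto
  have ER: "expectation (\<lambda>\<omega>. \<bar>R \<omega>\<bar>) \<le> sqrt (real m * (48 * K ^ 4) + (real m)\<^sup>2 * (8 * C * K ^ 3 / \<beta>))"
  proof (rule expectation_abs_le_sqrt(2))
    have \<Phi>_eq: "\<Phi> = (\<lambda>j \<omega>. trig_trunc K (S {j * b + 1..j * b + b} \<omega> / sqrt (real b)))"
      by (simp add: fun_eq_iff \<Phi>_def B_def \<beta>_def)
    show "R \<in> borel_measurable M" using iR by simp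
    show "expectation (\<lambda>\<omega>. (R \<omega>)\<^sup>2) \<le> real m * (48 * K ^ 4) + (real m)\<^sup>2 * (8 * C * K ^ 3 / \<beta>)"
      using truncated_blocks_variance(1)[OF b(1) mN K] by (simp only: R_def \<Phi>_eq \<beta>_def)
    show "integrable M (\<lambda>\<omega>. (R \<omega>)\<^sup>2)"
      using truncated_blocks_variance(3)[OF b(1) mN K] by (simp only: R_def \<Phi>_eq \<beta>_def)
  qed
  have \<beta>n: "\<beta> / n \<le> 1 / real m" using mbn n m1 by (simp add: field_simps)
  \<comment> \<open>Here \<open>b \<le> N\<close> enters: there is at least one block, so the
    leftover is no longer than the part covered and \<open>N \<le> 2 * m * b\<close>. This doubles
    48 to 96.\<close>
  have m2: "1 / real m \<le> 2 * (\<beta> / n)"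
  proof -
    have "\<beta> \<le> real m * \<beta>" using m1 \<beta> by simp
    then have "n \<le> 2 * (real m * \<beta>)" using nmb by linarith
    then show ?thesis using n m1 by (simp add: field_simps)
  qed
  have R_le: "\<beta> / n * expectation (\<lambda>\<omega>. \<bar>R \<omega>\<bar>) \<le> sqrt (96 * K ^ 4 * (\<beta> / n) + 8 * C * K ^ 3 / \<beta>)"
  proof -
    have "\<beta> / n * expectation (\<lambda>\<omega>. \<bar>R \<omega>\<bar>) \<le> 1 / real m * sqrt (real m * (48 * K ^ 4) + (real m)\<^sup>2 * (8 * C * K ^ 3 / \<beta>))"
      using \<beta>n ER by (intro mult_mono) auto
    also have "\<dots> = sqrt ((1 / real m)\<^sup>2 * (real m * (48 * K ^ 4) + (real m)\<^sup>2 * (8 * C * K ^ 3 / \<beta>)))"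
      by (simp only: real_sqrt_mult) simp
    also have "(1 / real m)\<^sup>2 * (real m * (48 * K ^ 4) + (real m)\<^sup>2 * (8 * C * K ^ 3 / \<beta>)) = 48 * K ^ 4 * (1 / real m) + 8 * C * K ^ 3 / \<beta>"
      using m1 \<beta> by (simp add: field_simps power2_eq_square)
    also have "sqrt \<dots> \<le> sqrt (48 * K ^ 4 * (2 * (\<beta> / n)) + 8 * C * K ^ 3 / \<beta>)"
      using m2 by (intro real_sqrt_le_mono add_right_mono mult_left_mono) auto
    finally show ?thesis by (simp add: mult_ac)
  qed
  define V where "V \<omega> = (\<Sum>j<m. (S (B j) \<omega>)\<^sup>2)" for \<omega>
  have iV: "integrable M V" unfolding V_def[abs_def] using iQ by auto
  have EV: "expectation V = (\<Sum>j<m. \<sigma> (B j))"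
    unfolding V_def \<sigma>_def using iQ by (subst Bochner_Integration.integral_sum) auto
  \<comment> \<open>\<open>W j\<close> is what truncation removes from the squared normalised block
    sum; it is small in mean, block by block. \<open>R\<close> collects the centred truncated parts
    and is small by its variance.\<close>
  have V_eq: "V \<omega> - expectation V = \<beta> * (\<Sum>j<m. W j \<omega> - expectation (W j)) + \<beta> * R \<omega>" for \<omega>
  proof -
    have q: "(S (B j) \<omega>)\<^sup>2 = \<beta> * (W j \<omega> + \<Phi> j \<omega>)" for j \<omega> using \<beta> by (simp add: W_def)
    have "\<sigma> (B j) = \<beta> * (expectation (W j) + expectation (\<Phi> j))" if "j < m" for j
      unfolding \<sigma>_def q using gap(2)[OF that] i\<Phi>[OF that] by simp
    then have "expectation V = (\<Sum>j<m. \<beta> * (expectation (W j) + expectation (\<Phi> j)))" unfolding EV by simp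
    then show ?thesis unfolding V_def q R_def
      by (simp add: sum_distrib_left sum_subtractf[symmetric] sum.distrib[symmetric] algebra_simps)
  qed
  have iW: "integrable M (\<lambda>\<omega>. \<bar>W j \<omega> - expectation (W j)\<bar>)" if "j < m" for j
    using gap(2)[OF that] by (intro integrable_abs Bochner_Integration.integrable_diff) auto
  have iSW: "integrable M (\<lambda>\<omega>. \<beta> * (\<Sum>j<m. \<bar>W j \<omega> - expectation (W j)\<bar>))"
    by (intro integrable_mult_right Bochner_Integration.integrable_sum iW) simp
  have "expectation (\<lambda>\<omega>. \<bar>V \<omega> - expectation V\<bar>) \<le> expectation (\<lambda>\<omega>. \<beta> * (\<Sum>j<m. \<bar>W j \<omega> - expectation (W j)\<bar>) + \<beta> * \<bar>R \<omega>\<bar>)"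
  proof (rule integral_mono)
    show "integrable M (\<lambda>\<omega>. \<bar>V \<omega> - expectation V\<bar>)" using iV by (intro integrable_abs Bochner_Integration.integrable_diff) auto
    show "integrable M (\<lambda>\<omega>. \<beta> * (\<Sum>j<m. \<bar>W j \<omega> - expectation (W j)\<bar>) + \<beta> * \<bar>R \<omega>\<bar>)"
      by (intro Bochner_Integration.integrable_add iSW integrable_mult_right integrable_abs iR)
    fix \<omega>
    have "\<bar>\<Sum>j<m. W j \<omega> - expectation (W j)\<bar> \<le> (\<Sum>j<m. \<bar>W j \<omega> - expectation (W j)\<bar>)" by (rule sum_abs)
    then have "\<beta> * \<bar>\<Sum>j<m. W j \<omega> - expectation (W j)\<bar> \<le> \<beta> * (\<Sum>j<m. \<bar>W j \<omega> - expectation (W j)\<bar>)"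
      using \<beta> by (intro mult_left_mono) auto
    then show "\<bar>V \<omega> - expectation V\<bar> \<le> \<beta> * (\<Sum>j<m. \<bar>W j \<omega> - expectation (W j)\<bar>) + \<beta> * \<bar>R \<omega>\<bar>"
      unfolding V_eq using \<beta> abs_triangle_ineq[of "\<beta> * (\<Sum>j<m. W j \<omega> - expectation (W j))" "\<beta> * R \<omega>"]
      by (simp only: abs_mult)
  qed
  also have "\<dots> = \<beta> * (\<Sum>j<m. expectation (\<lambda>\<omega>. \<bar>W j \<omega> - expectation (W j)\<bar>)) + \<beta> * expectation (\<lambda>\<omega>. \<bar>R \<omega>\<bar>)"
    using Bochner_Integration.integral_add[OF iSW integrable_mult_right[OF integrable_abs[OF iR], of \<beta>]]
      Bochner_Integration.integral_sum[of "{..<m}" M, OF iW] by simp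
  also have "\<dots> \<le> \<beta> * (\<Sum>j<m. 2 * G) + \<beta> * expectation (\<lambda>\<omega>. \<bar>R \<omega>\<bar>)"
  proof (intro add_right_mono mult_left_mono sum_mono)
    fix j assume "j \<in> {..<m}"
    then have j: "j < m" by simp
    have "expectation (\<lambda>\<omega>. \<bar>W j \<omega> - expectation (W j)\<bar>) \<le> expectation (\<lambda>\<omega>. \<bar>W j \<omega>\<bar> + \<bar>expectation (W j)\<bar>)"
      using gap(2)[OF j] iW[OF j] by (intro integral_mono) (auto intro: abs_triangle_ineq4)
    also have "\<dots> = expectation (\<lambda>\<omega>. \<bar>W j \<omega>\<bar>) + \<bar>expectation (W j)\<bar>"
      using gap(2)[OF j] by (simp add: prob_space)
    also have "\<bar>expectation (W j)\<bar> \<le> expectation (\<lambda>\<omega>. \<bar>W j \<omega>\<bar>)" by (rule integral_abs_bound)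
    finally show "expectation (\<lambda>\<omega>. \<bar>W j \<omega> - expectation (W j)\<bar>) \<le> 2 * G" using gap(1)[OF j] by linarith
  qed (use \<beta> in auto)
  finally have 1: "expectation (\<lambda>\<omega>. \<bar>V \<omega> - expectation V\<bar>) \<le> real m * \<beta> * (2 * G) + \<beta> * expectation (\<lambda>\<omega>. \<bar>R \<omega>\<bar>)"
    by (simp add: mult_ac)
  \<comment> \<open>Nonnegativity of \<open>\<eta>\<close> is not among the assumptions;
    \<open>G\<close> is nonnegative because it bounds an expected absolute value for the block 0,
    which exists.\<close>
  have G0: "0 \<le> G"
  proof -
    have "0 \<le> expectation (\<lambda>\<omega>. \<bar>W 0 \<omega>\<bar>)" by (rule integral_nonneg_AE) simp
    also have "\<dots> \<le> G" using m1 by (intro gap(1)) simp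
    finally show ?thesis .
  qed
  have VT: "\<bar>expectation V - \<sigma> {1..N}\<bar> \<le> n * (8 * D / sqrt \<beta>) + n * (10 * D * sqrt (\<beta> / n))"
  proof -
    have "\<bar>\<sigma> U - (\<Sum>j<m. \<sigma> (B j))\<bar> \<le> real m * (8 * D * sqrt \<beta>)"
      unfolding \<sigma>_def U_def B_def \<beta>_def
      by (rule block_variance_sum) (use BN disj in \<open>simp_all only: B_def[abs_def]\<close>)
    also have "\<dots> \<le> n / \<beta> * (8 * D * sqrt \<beta>)"
      using mbn \<beta> D_ge_1 by (intro mult_right_mono) (auto simp: field_simps)
    also have "\<dots> = n * (8 * D / sqrt \<beta>)"
      using \<beta> by (simp add: field_simps)
    finally have a: "\<bar>\<sigma> U - (\<Sum>j<m. \<sigma> (B j))\<bar> \<le> n * (8 * D / sqrt \<beta>)" .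
    have "\<bar>\<sigma> {1..N} - \<sigma> U\<bar> \<le> 10 * D * sqrt (n * (n - real m * \<beta>))"
      using S_second_moment_diff(2)[OF UN] by (simp add: \<sigma>_def n_def cardU)
    also have "\<dots> \<le> 10 * D * sqrt (n * \<beta>)"
      using nmb n D_ge_1 by (intro mult_left_mono real_sqrt_le_mono) auto
    also have "sqrt (n * \<beta>) = n * sqrt (\<beta> / n)"
      using n by (simp add: real_sqrt_mult real_sqrt_divide) (simp add: field_simps)
    finally show ?thesis using a unfolding EV by (simp add: mult_ac)
  qed
  have T2: "expectation (\<lambda>\<omega>. (T \<omega>)\<^sup>2) \<le> 5 * D * n"
    using S_second_moment_le[of "{1..N}"] by (simp add: T_def n_def)
  have mT: "T \<in> borel_measurable M" and iT: "integrable M (\<lambda>\<omega>. (T \<omega>)\<^sup>2)"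
    unfolding T_def by (auto intro!: S_measurable S_square_integrable)
  have cross: "expectation (\<lambda>\<omega>. \<bar>S (B j) \<omega> * T \<omega>\<bar>) \<le> 5 * D * (n * sqrt (\<beta> / n))" "integrable M (\<lambda>\<omega>. S (B j) \<omega> * T \<omega>)" if "j < m" for j
  proof -
    have E: "expectation (\<lambda>\<omega>. (S (B j) \<omega>)\<^sup>2) \<le> 5 * D * \<beta>"
      using S_second_moment_le[OF BN[OF that]] by (simp add: B_def \<beta>_def)
    have "expectation (\<lambda>\<omega>. \<bar>S (B j) \<omega> * T \<omega>\<bar>) \<le> sqrt ((5 * D * \<beta>) * (5 * D * n))"
      by (rule integral_abs_mult_le_sqrt(2)[OF S_measurable[OF BN[OF that]] mT iQ[OF that] iT E T2])
    also have "(5 * D * \<beta>) * (5 * D * n) = (5 * D)\<^sup>2 * (n * \<beta>)" by (simp add: power2_eq_square)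
    also have "sqrt \<dots> = 5 * D * sqrt (n * \<beta>)" using D_ge_1 by (simp add: real_sqrt_mult)
    also have "sqrt (n * \<beta>) = n * sqrt (\<beta> / n)"
      using n by (simp add: real_sqrt_mult real_sqrt_divide) (simp add: field_simps)
    finally show "expectation (\<lambda>\<omega>. \<bar>S (B j) \<omega> * T \<omega>\<bar>) \<le> 5 * D * (n * sqrt (\<beta> / n))" .
    show "integrable M (\<lambda>\<omega>. S (B j) \<omega> * T \<omega>)"
      by (rule integral_abs_mult_le_sqrt(1)[OF S_measurable[OF BN[OF that]] mT iQ[OF that] iT E T2])
  qed
  define Z where "Z \<omega> = (\<Sum>j<m. (S (B j) \<omega> - \<beta> / n * T \<omega>)\<^sup>2)" for \<omega>
  have ZV: "\<bar>Z \<omega> - V \<omega>\<bar> \<le> (\<Sum>j<m. 2 * (\<beta> / n) * \<bar>S (B j) \<omega> * T \<omega>\<bar> + (\<beta> / n)\<^sup>2 * (T \<omega>)\<^sup>2)" for \<omega>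
  proof -
    have "Z \<omega> - V \<omega> = (\<Sum>j<m. - (2 * (\<beta> / n) * (S (B j) \<omega> * T \<omega>)) + (\<beta> / n)\<^sup>2 * (T \<omega>)\<^sup>2)"
      unfolding Z_def V_def sum_subtractf[symmetric]
      by (intro sum.cong refl) (simp add: power2_diff power_mult_distrib power_divide mult_ac)
    also have "\<bar>\<dots>\<bar> \<le> (\<Sum>j<m. \<bar>- (2 * (\<beta> / n) * (S (B j) \<omega> * T \<omega>)) + (\<beta> / n)\<^sup>2 * (T \<omega>)\<^sup>2\<bar>)" by (rule sum_abs)
    also have "\<dots> \<le> (\<Sum>j<m. 2 * (\<beta> / n) * \<bar>S (B j) \<omega> * T \<omega>\<bar> + (\<beta> / n)\<^sup>2 * (T \<omega>)\<^sup>2)"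
    proof (rule sum_mono)
      fix j
      have *: "\<bar>- x + y\<bar> \<le> \<bar>x\<bar> + \<bar>y\<bar>" for x y :: real by linarith
      have "\<bar>2 * (\<beta> / n) * x\<bar> = 2 * (\<beta> / n) * \<bar>x\<bar>" for x
        using n \<beta> by (simp only: abs_mult abs_of_nonneg[of "\<beta> / n"] abs_numeral) simp
      moreover have "\<bar>(\<beta> / n)\<^sup>2 * (T \<omega>)\<^sup>2\<bar> = (\<beta> / n)\<^sup>2 * (T \<omega>)\<^sup>2"
        by (rule abs_of_nonneg) (rule mult_nonneg_nonneg; rule zero_le_power2)
      ultimately show "\<bar>- (2 * (\<beta> / n) * (S (B j) \<omega> * T \<omega>)) + (\<beta> / n)\<^sup>2 * (T \<omega>)\<^sup>2\<bar>
         \<le> 2 * (\<beta> / n) * \<bar>S (B j) \<omega> * T \<omega>\<bar> + (\<beta> / n)\<^sup>2 * (T \<omega>)\<^sup>2"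
        using *[of "2 * (\<beta> / n) * (S (B j) \<omega> * T \<omega>)" "(\<beta> / n)\<^sup>2 * (T \<omega>)\<^sup>2"]
        by (simp only:)
    qed
    finally show ?thesis .
  qed
  have i3: "integrable M (\<lambda>\<omega>. \<Sum>j<m. 2 * (\<beta> / n) * \<bar>S (B j) \<omega> * T \<omega>\<bar> + (\<beta> / n)\<^sup>2 * (T \<omega>)\<^sup>2)"
    using cross(2) iT by (intro Bochner_Integration.integrable_sum Bochner_Integration.integrable_add integrable_mult_right integrable_abs) auto
  have E3: "expectation (\<lambda>\<omega>. \<Sum>j<m. 2 * (\<beta> / n) * \<bar>S (B j) \<omega> * T \<omega>\<bar> + (\<beta> / n)\<^sup>2 * (T \<omega>)\<^sup>2)
      \<le> n * (10 * D * sqrt (\<beta> / n) + 5 * D * (\<beta> / n))"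
  proof -
    have "expectation (\<lambda>\<omega>. \<Sum>j<m. 2 * (\<beta> / n) * \<bar>S (B j) \<omega> * T \<omega>\<bar> + (\<beta> / n)\<^sup>2 * (T \<omega>)\<^sup>2)
      = (\<Sum>j<m. 2 * (\<beta> / n) * expectation (\<lambda>\<omega>. \<bar>S (B j) \<omega> * T \<omega>\<bar>) + (\<beta> / n)\<^sup>2 * expectation (\<lambda>\<omega>. (T \<omega>)\<^sup>2))"
    proof (subst Bochner_Integration.integral_sum)
      show "integrable M (\<lambda>\<omega>. 2 * (\<beta> / n) * \<bar>S (B j) \<omega> * T \<omega>\<bar> + (\<beta> / n)\<^sup>2 * (T \<omega>)\<^sup>2)" if "j \<in> {..<m}" for j
        using cross(2) iT that by (intro Bochner_Integration.integrable_add integrable_mult_right integrable_abs) auto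
      show "(\<Sum>j<m. expectation (\<lambda>\<omega>. 2 * (\<beta> / n) * \<bar>S (B j) \<omega> * T \<omega>\<bar> + (\<beta> / n)\<^sup>2 * (T \<omega>)\<^sup>2))
        = (\<Sum>j<m. 2 * (\<beta> / n) * expectation (\<lambda>\<omega>. \<bar>S (B j) \<omega> * T \<omega>\<bar>) + (\<beta> / n)\<^sup>2 * expectation (\<lambda>\<omega>. (T \<omega>)\<^sup>2))"
      proof (rule sum.cong[OF refl])
        fix j assume "j \<in> {..<m}"
        then show "expectation (\<lambda>\<omega>. 2 * (\<beta> / n) * \<bar>S (B j) \<omega> * T \<omega>\<bar> + (\<beta> / n)\<^sup>2 * (T \<omega>)\<^sup>2)
          = 2 * (\<beta> / n) * expectation (\<lambda>\<omega>. \<bar>S (B j) \<omega> * T \<omega>\<bar>) + (\<beta> / n)\<^sup>2 * expectation (\<lambda>\<omega>. (T \<omega>)\<^sup>2)"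
          using cross(2)[of j] iT by (subst Bochner_Integration.integral_add) (auto intro!: integrable_mult_right integrable_abs)
      qed
    qed
    also have "\<dots> \<le> (\<Sum>j<m. 2 * (\<beta> / n) * (5 * D * (n * sqrt (\<beta> / n))) + (\<beta> / n)\<^sup>2 * (5 * D * n))"
      using cross(1) T2 n \<beta> by (intro sum_mono add_mono mult_left_mono) auto
    also have "\<dots> = real m * \<beta> * (10 * D * sqrt (\<beta> / n) + 5 * D * (\<beta> / n))"
      using n by (simp add: algebra_simps power2_eq_square)
    also have "\<dots> \<le> n * (10 * D * sqrt (\<beta> / n) + 5 * D * (\<beta> / n))"
      using mbn n \<beta> D_ge_1 by (intro mult_right_mono) auto
    finally show ?thesis .
  qed
  have iZ: "integrable M Z"
  proof -
    have "(\<lambda>\<omega>. (S (B j) \<omega> - \<beta> / n * T \<omega>)\<^sup>2) = (\<lambda>\<omega>. (S (B j) \<omega>)\<^sup>2 - 2 * (\<beta> / n) * (S (B j) \<omega> * T \<omega>) + (\<beta> / n)\<^sup>2 * (T \<omega>)\<^sup>2)" for j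
      by (auto simp: power2_diff power_mult_distrib power_divide mult_ac)
    then show ?thesis unfolding Z_def[abs_def] using iQ cross(2) iT
      by (intro Bochner_Integration.integrable_sum) auto
  qed
  have "expectation (\<lambda>\<omega>. \<bar>Z \<omega> / n - \<sigma> {1..N} / n\<bar>)
      \<le> expectation (\<lambda>\<omega>. ((\<Sum>j<m. 2 * (\<beta> / n) * \<bar>S (B j) \<omega> * T \<omega>\<bar> + (\<beta> / n)\<^sup>2 * (T \<omega>)\<^sup>2)
         + \<bar>V \<omega> - expectation V\<bar> + \<bar>expectation V - \<sigma> {1..N}\<bar>) / n)"
  proof (rule integral_mono)
    show "integrable M (\<lambda>\<omega>. \<bar>Z \<omega> / n - \<sigma> {1..N} / n\<bar>)" using iZ by (intro integrable_abs) auto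
    show "integrable M (\<lambda>\<omega>. ((\<Sum>j<m. 2 * (\<beta> / n) * \<bar>S (B j) \<omega> * T \<omega>\<bar> + (\<beta> / n)\<^sup>2 * (T \<omega>)\<^sup>2)
         + \<bar>V \<omega> - expectation V\<bar> + \<bar>expectation V - \<sigma> {1..N}\<bar>) / n)"
      using i3 iV by (intro integrable_divide Bochner_Integration.integrable_add integrable_abs) auto
    fix \<omega>
    have "\<bar>Z \<omega> / n - \<sigma> {1..N} / n\<bar> = \<bar>Z \<omega> - \<sigma> {1..N}\<bar> / n"
      using n by (simp add: diff_divide_distrib[symmetric])
    also have "\<dots> \<le> ((\<Sum>j<m. 2 * (\<beta> / n) * \<bar>S (B j) \<omega> * T \<omega>\<bar> + (\<beta> / n)\<^sup>2 * (T \<omega>)\<^sup>2)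
         + \<bar>V \<omega> - expectation V\<bar> + \<bar>expectation V - \<sigma> {1..N}\<bar>) / n"
      using ZV[of \<omega>] n by (intro divide_right_mono) (linarith, simp)
    finally show "\<bar>Z \<omega> / n - \<sigma> {1..N} / n\<bar> \<le> ((\<Sum>j<m. 2 * (\<beta> / n) * \<bar>S (B j) \<omega> * T \<omega>\<bar> + (\<beta> / n)\<^sup>2 * (T \<omega>)\<^sup>2)
         + \<bar>V \<omega> - expectation V\<bar> + \<bar>expectation V - \<sigma> {1..N}\<bar>) / n" .
  qed
  also have "\<dots> = (expectation (\<lambda>\<omega>. \<Sum>j<m. 2 * (\<beta> / n) * \<bar>S (B j) \<omega> * T \<omega>\<bar> + (\<beta> / n)\<^sup>2 * (T \<omega>)\<^sup>2)
      + expectation (\<lambda>\<omega>. \<bar>V \<omega> - expectation V\<bar>) + \<bar>expectation V - \<sigma> {1..N}\<bar>) / n"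
    using i3 iV by (simp add: prob_space)
  also have "\<dots> \<le> (n * (10 * D * sqrt (\<beta> / n) + 5 * D * (\<beta> / n)) + (n * (2 * G) + \<beta> * expectation (\<lambda>\<omega>. \<bar>R \<omega>\<bar>))
      + (n * (8 * D / sqrt \<beta>) + n * (10 * D * sqrt (\<beta> / n)))) / n"
  proof (intro divide_right_mono add_mono E3 VT)
    have "real m * \<beta> * (2 * G) \<le> n * (2 * G)" using mbn G0 by (intro mult_right_mono) auto
    then show "expectation (\<lambda>\<omega>. \<bar>V \<omega> - expectation V\<bar>) \<le> n * (2 * G) + \<beta> * expectation (\<lambda>\<omega>. \<bar>R \<omega>\<bar>)"
      using 1 by linarith
  qed (use n in simp)
  also have "\<dots> = 2 * G + \<beta> / n * expectation (\<lambda>\<omega>. \<bar>R \<omega>\<bar>) + 8 * D / sqrt \<beta> + 20 * D * sqrt (\<beta> / n) + 5 * D * (\<beta> / n)"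
    using n by (simp add: add_divide_distrib)
  also have "\<dots> \<le> 2 * G + sqrt (96 * K ^ 4 * (\<beta> / n) + 8 * C * K ^ 3 / \<beta>) + 8 * D / sqrt \<beta> + 20 * D * sqrt (\<beta> / n) + 5 * D * (\<beta> / n)"
    using R_le by simp
  finally show ?thesis
    by (simp only: Z_def \<sigma>_def T_def G_def m_def n_def \<beta>_def)
qed

end

text \<open>The level \<open>K\<close> is fixed before \<open>n\<close> grows. Then the error of the
  central limit theorem, taken at block length \<open>b n\<close>, vanishes because
  \<open>b n\<close> tends to infinity, and the variance of the truncated sum vanishes because
  moreover \<open>b n / n\<close> tends to 0. What remains is of order
  \<open>1 / K^2\<close>.\<close>

theorem weakly_dependent_block_variance:
  fixes M :: "'a measure" and b :: "nat \<Rightarrow> nat"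
  assumes wd: "\<And>n. 1 \<le> n \<Longrightarrow> weakly_dependent M (F n) (X n) n A C"
    and b: "filterlim b at_top sequentially" and bn: "(\<lambda>n. real (b n) / real n) \<longlonglongrightarrow> 0"
  shows "(\<lambda>n. \<integral>\<omega>. \<bar>(\<Sum>j<n div b n. ((\<Sum>i=j * b n + 1..j * b n + b n. X n i \<omega>)
        - real (b n) / real n * (\<Sum>i=1..n. X n i \<omega>))\<^sup>2) / real n
      - (\<integral>\<omega>. (\<Sum>i=1..n. X n i \<omega>)\<^sup>2 \<partial>M) / real n\<bar> \<partial>M) \<longlonglongrightarrow> 0" (is "?E \<longlonglongrightarrow> 0")
proof (rule LIMSEQ_I)
  fix r :: real assume r: "0 < r"
  define d where "d = 1 + 3 * A + C"
  have d: "1 \<le> d"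
    using weakly_dependent.nonneg[OF wd[of 1]] by (simp add: d_def)
  \<comment> \<open>Chosen so that the part of the bound that does not vanish with \<open>n\<close>,
    \<open>2 * (25 * d^2 / (4 * K^2))\<close>, equals \<open>50 / 144 * r\<close>.\<close>
  define K where "K = 6 * d / sqrt r"
  have K: "0 < K" using d r by (simp add: K_def)
  obtain err :: "nat \<Rightarrow> real" where err: "err \<longlonglongrightarrow> 0"
    and clt: "\<And>(M :: 'a measure) F X N. weakly_dependent M F X N A C \<Longrightarrow> 1 \<le> N \<Longrightarrow>
      cmod ((\<integral>\<omega>. iexp (1 / K / sqrt (real N) * (\<Sum>i=1..N. X i \<omega>)) \<partial>M)
        - exp (- ((1 / K)\<^sup>2 * (\<integral>\<omega>. (\<Sum>i=1..N. X i \<omega>)\<^sup>2 \<partial>M) / (2 * real N)))) \<le> err N"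
    using weakly_dependent_clt[of "1 / K" A C] K by auto
  define g where "g n = 2 * (25 * d\<^sup>2 / (4 * K\<^sup>2) + 2 * K\<^sup>2 * err (b n))
      + sqrt (96 * K ^ 4 * (real (b n) / real n) + 8 * C * K ^ 3 * (1 / real (b n)))
      + 8 * d * (1 / sqrt (real (b n))) + 20 * d * sqrt (real (b n) / real n) + 5 * d * (real (b n) / real n)" for n
  have lb: "(\<lambda>n. 1 / real (b n)) \<longlonglongrightarrow> 0" "(\<lambda>n. 1 / sqrt (real (b n))) \<longlonglongrightarrow> 0"
  proof -
    have "(\<lambda>n::nat. 1 / real n) \<longlonglongrightarrow> 0" "(\<lambda>n::nat. 1 / sqrt (real n)) \<longlonglongrightarrow> 0" by real_asymp+
    from this[THEN filterlim_compose, OF b]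
    show "(\<lambda>n. 1 / real (b n)) \<longlonglongrightarrow> 0" "(\<lambda>n. 1 / sqrt (real (b n))) \<longlonglongrightarrow> 0" .
  qed
  have "g \<longlonglongrightarrow> 2 * (25 * d\<^sup>2 / (4 * K\<^sup>2) + 2 * K\<^sup>2 * 0) + sqrt (96 * K ^ 4 * 0 + 8 * C * K ^ 3 * 0)
      + 8 * d * 0 + 20 * d * sqrt 0 + 5 * d * 0"
    unfolding g_def[abs_def] by (intro tendsto_intros lb bn filterlim_compose[OF err b])
  moreover have "2 * (25 * d\<^sup>2 / (4 * K\<^sup>2)) < r"
    using d r by (simp add: K_def power_divide power_mult_distrib)
  ultimately have "eventually (\<lambda>n. g n < r) sequentially"
    by (intro order_tendstoD(2)[of g]) auto
  moreover have "eventually (\<lambda>n. 1 \<le> b n) sequentially" using b by (simp add: filterlim_at_top)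
  moreover have "eventually (\<lambda>n. real (b n) / real n < 1) sequentially"
    using order_tendstoD(2)[OF bn, of 1] by simp
  moreover have "eventually (\<lambda>n::nat. 1 \<le> n) sequentially" by (rule eventually_ge_at_top)
  ultimately have "eventually (\<lambda>n. norm (?E n - 0) < r) sequentially"
  proof eventually_elim
    case (elim n)
    interpret weakly_dependent M "F n" "X n" n A C using wd elim by simp
    have bN: "1 \<le> b n" "b n \<le> n" using elim by (simp_all add: field_simps)
    have "?E n \<le> g n"
    proof -
      \<comment> \<open>Each block is a shifted array of length \<open>b n\<close>, so the uniform
        error sequence evaluated at \<open>b n\<close> covers all \<open>j\<close>
        simultaneously.\<close>
      have "cmod (expectation (\<lambda>\<omega>. iexp (1 / K / sqrt (real (b n)) * S {j * b n + 1..j * b n + b n} \<omega>))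
        - exp (- ((1 / K)\<^sup>2 * expectation (\<lambda>\<omega>. (S {j * b n + 1..j * b n + b n} \<omega>)\<^sup>2) / (2 * real (b n))))) \<le> err (b n)"
        if "j < n div b n" for j
      proof -
        have "Suc j * b n \<le> n" 
          using that by (intro order_trans[OF mult_le_mono1[of "Suc j" "n div b n" "b n"] div_times_less_eq_dividend]) simp
        then have jn: "j * b n + b n \<le> n" by simp
        have "S {j * b n + 1..j * b n + b n} \<omega> = (\<Sum>i=1..b n. X n (j * b n + i) \<omega>)" for \<omega>
          unfolding S_def using sum.shift_bounds_cl_nat_ivl[of "\<lambda>i. X n i \<omega>" 1 "j * b n" "b n"] by (simp add: add.commute)
        with clt[OF shifted[OF jn] bN(1)] show ?thesis by simp
      qed
      from block_variance_bound[OF bN K this]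
      show ?thesis by (simp add: g_def S_def D_def d_def)
    qed
    moreover have "0 \<le> ?E n" by (rule integral_nonneg_AE) simp
    ultimately show ?case using elim by simp
  qed
  then show "\<exists>no. \<forall>n\<ge>no. norm (?E n - 0) < r" by (simp add: eventually_sequentially)
qed

subsection \<open>From characteristic functions to bounded continuous functions\<close>

text \<open>Left unnormalised, so that it is exactly the characteristic function of
  \<open>gauss_measure\<close>; its Lebesgue mass is divided out only when it is used to approximate
  the identity.\<close>

definition gauss_kernel :: "'b::euclidean_space \<Rightarrow> real" where
  "gauss_kernel z = exp (- ((norm z)\<^sup>2 / 2))"

text \<open>The standard normal law of the space, as an image of a product over
  \<open>Basis\<close>; in this form its characteristic function factorises into one-dimensional
  ones.\<close>

definition gauss_measure :: "'b::euclidean_space measure" where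
  "gauss_measure = distr (\<Pi>\<^sub>M i\<in>Basis. std_normal_distribution) borel (\<lambda>u. \<Sum>i\<in>Basis. u i *\<^sub>R i)"

lemma gauss_kernel_measurable [measurable]: "gauss_kernel \<in> borel_measurable borel"
  unfolding gauss_kernel_def[abs_def] by measurable

lemma gauss_kernel_bounds: "0 < gauss_kernel z" "gauss_kernel z \<le> 1" "\<bar>gauss_kernel z\<bar> \<le> 1"
  by (simp_all add: gauss_kernel_def)

lemma gauss_kernel_nonneg [simp]: "0 \<le> gauss_kernel z"
  by (simp add: gauss_kernel_def)

lemma gauss_kernel_prod: "gauss_kernel z = (\<Prod>i\<in>Basis. exp (- ((z \<bullet> i)\<^sup>2 / 2)))"
proof -
  have "(norm z)\<^sup>2 = (\<Sum>i\<in>Basis. (z \<bullet> i)\<^sup>2)"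
    unfolding power2_norm_eq_inner by (subst euclidean_inner) (simp add: power2_eq_square)
  then show ?thesis
    unfolding gauss_kernel_def by (simp add: exp_sum[symmetric] sum_negf sum_divide_distrib)
qed

lemma gauss_kernel_integrable: "integrable lborel (gauss_kernel :: 'b::euclidean_space \<Rightarrow> real)"
  and gauss_kernel_integral_pos: "0 < (\<integral>z. gauss_kernel (z :: 'b) \<partial>lborel)"
proof -
  interpret product_sigma_finite "\<lambda>_ :: 'b. lborel :: real measure" ..
  have e: "exp (- (x\<^sup>2 / 2)) = sqrt (2 * pi) * std_normal_density x" for x :: real
    by (simp add: std_normal_density_def)
  have i: "integrable lborel (\<lambda>x :: real. exp (- (x\<^sup>2 / 2)))"
    unfolding e by (intro integrable_mult_right) simp
  have c: "(\<integral>x. exp (- (x\<^sup>2 / 2)) \<partial>(lborel :: real measure)) = sqrt (2 * pi)"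
    unfolding e by simp
  have k: "gauss_kernel (\<Sum>i\<in>Basis. u i *\<^sub>R i :: 'b) = (\<Prod>i\<in>Basis. exp (- ((u i)\<^sup>2 / 2)))" for u
    unfolding gauss_kernel_prod by (intro prod.cong) auto
  show "integrable lborel (gauss_kernel :: 'b \<Rightarrow> real)"
    unfolding lborel_eq[where 'a = 'b]
    by (subst integrable_distr_eq) (auto simp: k intro!: product_integrable_prod[OF finite_Basis] i)
  have "(\<integral>z. gauss_kernel (z :: 'b) \<partial>lborel) = (\<Prod>i\<in>(Basis :: 'b set). sqrt (2 * pi))"
    unfolding lborel_eq[where 'a = 'b]
    by (subst integral_distr) (auto simp: k product_integral_prod[OF finite_Basis i] c)
  then show "0 < (\<integral>z. gauss_kernel (z :: 'b) \<partial>lborel)" by (simp add: prod_pos)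
qed

lemma prob_space_gauss_measure: "prob_space (gauss_measure :: 'b::euclidean_space measure)"
proof -
  interpret product_prob_space "\<lambda>_ :: 'b. std_normal_distribution" Basis
    by (intro product_prob_spaceI prob_space_normal_density) simp
  show ?thesis unfolding gauss_measure_def by (rule P.prob_space_distr) measurable
qed

lemma sets_gauss_measure [simp, measurable_cong]: "sets gauss_measure = sets borel"
  by (simp add: gauss_measure_def)

lemma gauss_measure_char:
  "(\<integral>w. iexp (z \<bullet> w) \<partial>gauss_measure) = complex_of_real (gauss_kernel (z :: 'b::euclidean_space))"
proof -
  interpret product_prob_space "\<lambda>_ :: 'b. std_normal_distribution" Basis
    by (intro product_prob_spaceI prob_space_normal_density) simp
  have i: "integrable std_normal_distribution (\<lambda>x. iexp (a * x))" for a
    by (rule prob_space.integrable_iexp) (auto intro: prob_space_normal_density)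
  have "(\<integral>w. iexp (z \<bullet> w) \<partial>gauss_measure)
    = (\<integral>u. (\<Prod>i\<in>Basis. iexp ((z \<bullet> i) * u i)) \<partial>(\<Pi>\<^sub>M i\<in>Basis. std_normal_distribution))"
    unfolding gauss_measure_def
    by (subst integral_distr) (auto simp: inner_sum_right exp_sum[symmetric] sum_distrib_left mult_ac intro!: Bochner_Integration.integral_cong)
  also have "\<dots> = (\<Prod>i\<in>Basis. char std_normal_distribution (z \<bullet> i))"
    unfolding char_def by (rule product_integral_prod[OF finite_Basis i])
  also have "\<dots> = complex_of_real (gauss_kernel z)"
    unfolding char_std_normal_distribution gauss_kernel_prod by (simp add: of_real_prod)
  finally show ?thesis .
qed

text \<open>The kernel is a mixture of characters, so by Fubini its expectation depends on the law
  of \<open>X\<close> only through the characteristic function of \<open>X\<close>.\<close>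

lemma gauss_kernel_expectation:
  fixes X :: "'a \<Rightarrow> 'b::euclidean_space"
  assumes M: "prob_space M" and [measurable]: "X \<in> borel_measurable M"
  shows "complex_of_real (\<integral>\<omega>. gauss_kernel (s *\<^sub>R (y - X \<omega>)) \<partial>M)
    = (\<integral>w. iexp (s * (y \<bullet> w)) * (\<integral>\<omega>. iexp ((- s *\<^sub>R w) \<bullet> X \<omega>) \<partial>M) \<partial>gauss_measure)"
proof -
  interpret M: prob_space M by fact
  interpret G: prob_space "gauss_measure :: 'b measure" by (rule prob_space_gauss_measure)
  interpret P: pair_prob_space M "gauss_measure :: 'b measure" ..
  have int: "integrable (M \<Otimes>\<^sub>M gauss_measure) (\<lambda>(\<omega>, w). iexp ((s *\<^sub>R (y - X \<omega>)) \<bullet> w))"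
    by (rule P.integrable_const_bound[where B = 1]) (auto simp: split_beta)
  have "complex_of_real (\<integral>\<omega>. gauss_kernel (s *\<^sub>R (y - X \<omega>)) \<partial>M)
     = (\<integral>\<omega>. (\<integral>w. iexp ((s *\<^sub>R (y - X \<omega>)) \<bullet> w) \<partial>gauss_measure) \<partial>M)"
    unfolding gauss_measure_char by simp
  also have "\<dots> = (\<integral>w. (\<integral>\<omega>. iexp ((s *\<^sub>R (y - X \<omega>)) \<bullet> w) \<partial>M) \<partial>gauss_measure)"
    by (rule P.Fubini_integral[symmetric]) (use int in simp)
  also have "\<dots> = (\<integral>w. iexp (s * (y \<bullet> w)) * (\<integral>\<omega>. iexp ((- s *\<^sub>R w) \<bullet> X \<omega>) \<partial>M) \<partial>gauss_measure)"
  proof (rule Bochner_Integration.integral_cong[OF refl])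
    fix w
    have "iexp ((s *\<^sub>R (y - X \<omega>)) \<bullet> w) = iexp (s * (y \<bullet> w)) * iexp ((- s *\<^sub>R w) \<bullet> X \<omega>)" for \<omega>
      by (simp add: exp_add[symmetric] inner_diff_left inner_commute algebra_simps)
    then show "(\<integral>\<omega>. iexp ((s *\<^sub>R (y - X \<omega>)) \<bullet> w) \<partial>M) = iexp (s * (y \<bullet> w)) * (\<integral>\<omega>. iexp ((- s *\<^sub>R w) \<bullet> X \<omega>) \<partial>M)"
      by (simp only: integral_mult_right_zero)
  qed
  finally show ?thesis .
qed

text \<open>The location \<open>y\<close> enters only through a factor of modulus 1, so the bound is
  uniform in \<open>y\<close>.\<close>

lemma gauss_kernel_expectation_diff:
  fixes X :: "'a \<Rightarrow> 'b::euclidean_space" and Z :: "'c \<Rightarrow> 'b"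
  assumes M: "prob_space M" and [measurable]: "X \<in> borel_measurable M"
    and Q: "prob_space Q" and [measurable]: "Z \<in> borel_measurable Q"
  shows "\<bar>(\<integral>\<omega>. gauss_kernel (s *\<^sub>R (y - X \<omega>)) \<partial>M) - (\<integral>\<omega>. gauss_kernel (s *\<^sub>R (y - Z \<omega>)) \<partial>Q)\<bar>
    \<le> (\<integral>w. cmod ((\<integral>\<omega>. iexp ((- s *\<^sub>R w) \<bullet> X \<omega>) \<partial>M) - (\<integral>\<omega>. iexp ((- s *\<^sub>R w) \<bullet> Z \<omega>) \<partial>Q)) \<partial>gauss_measure)"
proof -
  interpret M: prob_space M by fact
  interpret Q: prob_space Q by fact
  interpret G: prob_space "gauss_measure :: 'b measure" by (rule prob_space_gauss_measure)
  let ?a = "\<lambda>w. \<integral>\<omega>. iexp ((- s *\<^sub>R w) \<bullet> X \<omega>) \<partial>M" and ?b = "\<lambda>w. \<integral>\<omega>. iexp ((- s *\<^sub>R w) \<bullet> Z \<omega>) \<partial>Q"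
  have [measurable]: "?a \<in> borel_measurable borel" "?b \<in> borel_measurable borel" by measurable
  have b: "cmod (?a w) \<le> 1" "cmod (?b w) \<le> 1" for w by (intro cmod_integral_iexp_le_1 M Q; measurable)+
  have i: "integrable gauss_measure (\<lambda>w. iexp (s * (y \<bullet> w)) * ?a w)" "integrable gauss_measure (\<lambda>w. iexp (s * (y \<bullet> w)) * ?b w)"
    by (rule G.integrable_const_bound[where B = 1], use b in \<open>simp add: norm_mult\<close>, measurable)+
  have "\<bar>(\<integral>\<omega>. gauss_kernel (s *\<^sub>R (y - X \<omega>)) \<partial>M) - (\<integral>\<omega>. gauss_kernel (s *\<^sub>R (y - Z \<omega>)) \<partial>Q)\<bar>
     = cmod (complex_of_real (\<integral>\<omega>. gauss_kernel (s *\<^sub>R (y - X \<omega>)) \<partial>M) - complex_of_real (\<integral>\<omega>. gauss_kernel (s *\<^sub>R (y - Z \<omega>)) \<partial>Q))"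
    by (simp only: of_real_diff[symmetric] norm_of_real)
  also have "\<dots> = cmod (\<integral>w. iexp (s * (y \<bullet> w)) * ?a w - iexp (s * (y \<bullet> w)) * ?b w \<partial>gauss_measure)"
    unfolding gauss_kernel_expectation[OF M \<open>X \<in> _\<close>] gauss_kernel_expectation[OF Q \<open>Z \<in> _\<close>]
    using i by (simp only: Bochner_Integration.integral_diff)
  also have "\<dots> \<le> (\<integral>w. cmod (iexp (s * (y \<bullet> w)) * ?a w - iexp (s * (y \<bullet> w)) * ?b w) \<partial>gauss_measure)"
    by (rule integral_norm_bound)
  also have "\<dots> = (\<integral>w. cmod (?a w - ?b w) \<partial>gauss_measure)"
    by (simp only: right_diff_distrib[symmetric] norm_mult norm_exp_i_times mult_1)
  finally show ?thesis .
qed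

text \<open>Lebesgue integrability of \<open>f\<close> permits the exchange of integrals and
  supplies the constant: a bound uniform in \<open>y\<close> is integrated against
  \<open>\<bar>f y\<bar>\<close>.\<close>

lemma gauss_smoothing_diff:
  fixes X :: "'a \<Rightarrow> 'b::euclidean_space" and Z :: "'c \<Rightarrow> 'b" and f :: "'b \<Rightarrow> real" and s :: real
  assumes M: "prob_space M" and X [measurable]: "X \<in> borel_measurable M"
    and Q: "prob_space Q" and Z [measurable]: "Z \<in> borel_measurable Q"
    and f: "integrable lborel f"
  defines "F \<equiv> \<lambda>x. \<integral>y. f y * gauss_kernel (s *\<^sub>R (y - x)) \<partial>lborel"
  shows "\<bar>(\<integral>\<omega>. F (X \<omega>) \<partial>M) - (\<integral>\<omega>. F (Z \<omega>) \<partial>Q)\<bar>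
    \<le> (\<integral>y. \<bar>f y\<bar> \<partial>lborel) *
      (\<integral>w. cmod ((\<integral>\<omega>. iexp ((- s *\<^sub>R w) \<bullet> X \<omega>) \<partial>M) - (\<integral>\<omega>. iexp ((- s *\<^sub>R w) \<bullet> Z \<omega>) \<partial>Q)) \<partial>gauss_measure)"
proof -
  have [measurable]: "f \<in> borel_measurable borel" using f by simp
  have swap: "(\<integral>\<omega>. F (V \<omega>) \<partial>P) = (\<integral>y. f y * (\<integral>\<omega>. gauss_kernel (s *\<^sub>R (y - V \<omega>)) \<partial>P) \<partial>lborel)"
    and int: "integrable lborel (\<lambda>y. f y * (\<integral>\<omega>. gauss_kernel (s *\<^sub>R (y - V \<omega>)) \<partial>P))"
    if P: "prob_space P" and V [measurable]: "V \<in> borel_measurable P" for P :: "'z measure" and V :: "'z \<Rightarrow> 'b"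
  proof -
    interpret P: prob_space P by fact
    interpret L': pair_sigma_finite "lborel :: 'b measure" P ..
    have kb: "norm (f y * gauss_kernel (s *\<^sub>R (y - V \<omega>))) \<le> norm (f y)" for y \<omega>
      using gauss_kernel_bounds[of "s *\<^sub>R (y - V \<omega>)"] by (simp add: abs_mult mult_left_le)
    have k1: "0 \<le> (\<integral>\<omega>. gauss_kernel (s *\<^sub>R (y - V \<omega>)) \<partial>P)" "(\<integral>\<omega>. gauss_kernel (s *\<^sub>R (y - V \<omega>)) \<partial>P) \<le> 1" for y
    proof -
      show "0 \<le> (\<integral>\<omega>. gauss_kernel (s *\<^sub>R (y - V \<omega>)) \<partial>P)"
        using gauss_kernel_bounds by (intro integral_nonneg_AE AE_I2) (auto intro: less_imp_le)
      show "(\<integral>\<omega>. gauss_kernel (s *\<^sub>R (y - V \<omega>)) \<partial>P) \<le> 1"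
        using gauss_kernel_bounds by (intro P.integral_le_const AE_I2 P.integrable_const_bound[where B = 1]) auto
    qed
    have i1: "integrable (lborel \<Otimes>\<^sub>M P) (\<lambda>(y, \<omega>). f y * gauss_kernel (s *\<^sub>R (y - V \<omega>)))"
    proof (rule L'.Fubini_integrable)
      show "AE y in lborel. integrable P (\<lambda>\<omega>. case (y, \<omega>) of (y, \<omega>) \<Rightarrow> f y * gauss_kernel (s *\<^sub>R (y - V \<omega>)))"
        unfolding prod.case
      proof (rule AE_I2)
        show "integrable P (\<lambda>\<omega>. f y * gauss_kernel (s *\<^sub>R (y - V \<omega>)))" for y
          by (rule P.integrable_const_bound[where B = "norm (f y)"]) (rule AE_I2, rule kb, measurable)
      qed
      have "integrable lborel (\<lambda>y. \<integral>\<omega>. \<bar>f y * gauss_kernel (s *\<^sub>R (y - V \<omega>))\<bar> \<partial>P)"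
      proof (rule Bochner_Integration.integrable_bound[OF f])
        show "AE y in lborel. norm (\<integral>\<omega>. \<bar>f y * gauss_kernel (s *\<^sub>R (y - V \<omega>))\<bar> \<partial>P) \<le> norm (f y)"
        proof (rule AE_I2)
          fix y
          have "norm (\<integral>\<omega>. \<bar>f y * gauss_kernel (s *\<^sub>R (y - V \<omega>))\<bar> \<partial>P) = (\<integral>\<omega>. \<bar>f y * gauss_kernel (s *\<^sub>R (y - V \<omega>))\<bar> \<partial>P)"
            by (simp add: integral_nonneg_AE)
          also have "\<dots> \<le> norm (f y)"
            using kb by (intro P.integral_le_const AE_I2 P.integrable_const_bound[where B = "norm (f y)"]) auto
          finally show "norm (\<integral>\<omega>. \<bar>f y * gauss_kernel (s *\<^sub>R (y - V \<omega>))\<bar> \<partial>P) \<le> norm (f y)" .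
        qed
      qed measurable
      then show "integrable lborel (\<lambda>y. \<integral>\<omega>. norm (case (y, \<omega>) of (y, \<omega>) \<Rightarrow> f y * gauss_kernel (s *\<^sub>R (y - V \<omega>))) \<partial>P)"
        by simp
    qed measurable
    show "(\<integral>\<omega>. F (V \<omega>) \<partial>P) = (\<integral>y. f y * (\<integral>\<omega>. gauss_kernel (s *\<^sub>R (y - V \<omega>)) \<partial>P) \<partial>lborel)"
      unfolding F_def by (subst L'.Fubini_integral[OF i1]) simp
    show "integrable lborel (\<lambda>y. f y * (\<integral>\<omega>. gauss_kernel (s *\<^sub>R (y - V \<omega>)) \<partial>P))"
      by (rule Bochner_Integration.integrable_bound[OF f]) (use k1 in \<open>auto simp: abs_mult intro!: mult_left_le\<close>)
  qed
  let ?\<Delta> = "\<integral>w. cmod ((\<integral>\<omega>. iexp ((- s *\<^sub>R w) \<bullet> X \<omega>) \<partial>M) - (\<integral>\<omega>. iexp ((- s *\<^sub>R w) \<bullet> Z \<omega>) \<partial>Q)) \<partial>gauss_measure"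
  let ?x = "\<lambda>y. \<integral>\<omega>. gauss_kernel (s *\<^sub>R (y - X \<omega>)) \<partial>M" and ?z = "\<lambda>y. \<integral>\<omega>. gauss_kernel (s *\<^sub>R (y - Z \<omega>)) \<partial>Q"
  have i: "integrable lborel (\<lambda>y. f y * ?x y)" "integrable lborel (\<lambda>y. f y * ?z y)"
    by (rule int[OF M X], rule int[OF Q Z])
  have "\<bar>(\<integral>\<omega>. F (X \<omega>) \<partial>M) - (\<integral>\<omega>. F (Z \<omega>) \<partial>Q)\<bar> = \<bar>\<integral>y. f y * ?x y - f y * ?z y \<partial>lborel\<bar>"
    unfolding swap[OF M X] swap[OF Q Z] using i by simp
  also have "\<dots> \<le> (\<integral>y. \<bar>f y * ?x y - f y * ?z y\<bar> \<partial>lborel)" by (rule integral_abs_bound)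
  also have "\<dots> \<le> (\<integral>y. \<bar>f y\<bar> * ?\<Delta> \<partial>lborel)"
  proof (rule integral_mono)
    show "integrable lborel (\<lambda>y. \<bar>f y * ?x y - f y * ?z y\<bar>)" using i by (intro integrable_abs Bochner_Integration.integrable_diff)
    show "integrable lborel (\<lambda>y. \<bar>f y\<bar> * ?\<Delta>)" using f by (intro integrable_mult_left integrable_abs)
    show "\<bar>f y * ?x y - f y * ?z y\<bar> \<le> \<bar>f y\<bar> * ?\<Delta>" for y
      unfolding right_diff_distrib[symmetric] abs_mult
      by (intro mult_left_mono gauss_kernel_expectation_diff[OF M X Q Z]) simp
  qed
  finally show ?thesis by simp
qed

text \<open>Substituting \<open>y = x + \<sigma> *\<^sub>R z\<close> exhibits the smoothed function
  as a Gaussian average of \<open>f\<close> near \<open>x\<close>. Small displacements are handled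
  by uniform continuity, which makes the estimate independent of \<open>x\<close>, large ones by
  boundedness and the Gaussian tail.\<close>

lemma gauss_smoothing_approx:
  fixes f :: "'b::euclidean_space \<Rightarrow> real"
  assumes uc: "uniformly_continuous_on UNIV f" and B: "\<And>x. \<bar>f x\<bar> \<le> B" and \<epsilon>: "0 < \<epsilon>"
  obtains s c where "0 < s" "0 \<le> c"
    "\<And>x. \<bar>f x - c * (\<integral>y. f y * gauss_kernel (s *\<^sub>R (y - x)) \<partial>lborel)\<bar> \<le> \<epsilon>"
proof -
  define c0 where "c0 = (\<integral>z. gauss_kernel (z :: 'b) \<partial>lborel)"
  have c0: "0 < c0" unfolding c0_def by (rule gauss_kernel_integral_pos)
  have B0: "0 \<le> B" using B[of 0] by simp
  have [measurable]: "f \<in> borel_measurable borel"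
    using uniformly_continuous_imp_continuous[OF uc] by (rule borel_measurable_continuous_onI)
  obtain \<delta> where \<delta>: "0 < \<delta>" "\<And>x y. dist y x < \<delta> \<Longrightarrow> dist (f y) (f x) < \<epsilon> / 2"
    using uc \<epsilon> unfolding uniformly_continuous_on_def by (metis UNIV_I half_gt_zero)
  \<comment> \<open>The kernel mass of the points that a scaling by \<open>1 / n\<close> moves by at
    least \<open>\<delta>\<close>.\<close>
  define g where "g n = (\<integral>z. indicator {z :: 'b. \<delta> * real n \<le> norm z} z * gauss_kernel z \<partial>lborel)" for n
  have "g \<longlonglongrightarrow> (\<integral>z. 0 \<partial>(lborel :: 'b measure))"
    unfolding g_def
  proof (rule integral_dominated_convergence[where w = gauss_kernel])
    show "AE z in lborel. (\<lambda>n. indicator {z :: 'b. \<delta> * real n \<le> norm z} z * gauss_kernel z) \<longlonglongrightarrow> 0"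
    proof (rule AE_I2)
      fix z :: 'b
      obtain n0 :: nat where "norm z / \<delta> < real n0" using reals_Archimedean2 by blast
      then have n0: "norm z < \<delta> * real n0" using \<delta>(1) by (simp add: field_simps)
      have "norm z < \<delta> * real n" if "n0 \<le> n" for n
      proof -
        have "\<delta> * real n0 \<le> \<delta> * real n" using that \<delta>(1) by (intro mult_left_mono) auto
        with n0 show ?thesis by linarith
      qed
      then have "eventually (\<lambda>n. indicator {z :: 'b. \<delta> * real n \<le> norm z} z * gauss_kernel z = 0) sequentially"
        unfolding eventually_sequentially by (intro exI[of _ n0]) (auto simp: indicator_def not_le)
      then show "(\<lambda>n. indicator {z :: 'b. \<delta> * real n \<le> norm z} z * gauss_kernel z) \<longlonglongrightarrow> 0"
        by (rule tendsto_eventually)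
    qed
    show "AE z in lborel. norm (indicator {z :: 'b. \<delta> * real n \<le> norm z} z * gauss_kernel z) \<le> gauss_kernel z" for n
      using gauss_kernel_bounds(1) by (intro AE_I2) (auto simp: indicator_def less_imp_le)
  qed (auto intro: gauss_kernel_integrable)
  then have "g \<longlonglongrightarrow> 0" by simp
  \<comment> \<open>The tail is weighted by \<open>2 * B\<close>, so this threshold limits its share
    to half of \<open>\<epsilon> * c0\<close>; \<open>B + 1\<close> avoids a zero
    denominator.\<close>
  moreover have "0 < \<epsilon> * c0 / (4 * (B + 1))" using \<epsilon> c0 B0 by simp
  ultimately have "eventually (\<lambda>n. g n < \<epsilon> * c0 / (4 * (B + 1))) sequentially"
    by (rule order_tendstoD(2))
  then obtain n where n: "0 < n" "g n < \<epsilon> * c0 / (4 * (B + 1))"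
    unfolding eventually_sequentially by (metis le_add1 less_add_Suc2 less_imp_le less_Suc_eq_le zero_less_Suc)
  define \<sigma> where "\<sigma> = 1 / real n"
  have \<sigma>: "0 < \<sigma>" using n by (simp add: \<sigma>_def)
  \<comment> \<open>The reciprocal of the Lebesgue mass of the rescaled kernel:
    \<open>\<sigma> ^ DIM('b)\<close> is the Jacobian of the substitution.\<close>
  define c where "c = 1 / (c0 * \<sigma> ^ DIM('b))"
  have "\<bar>f x - c * (\<integral>y. f y * gauss_kernel (real n *\<^sub>R (y - x)) \<partial>lborel)\<bar> \<le> \<epsilon>" for x
  proof -
    have ik: "integrable lborel (\<lambda>z. h z * gauss_kernel z)"
      if [measurable]: "h \<in> borel_measurable borel" and "\<And>z. \<bar>h z\<bar> \<le> B'" for h :: "'b \<Rightarrow> real" and B'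
    proof (rule Bochner_Integration.integrable_bound[OF integrable_mult_right[OF gauss_kernel_integrable, of B']])
      show "AE z in lborel. norm (h z * gauss_kernel z) \<le> norm (B' * gauss_kernel z)"
        using gauss_kernel_bounds(1) that(2)
        by (auto simp: abs_mult less_imp_le intro!: mult_right_mono AE_I2 order_trans[OF _ abs_ge_self])
    qed measurable
    have "(\<integral>y. f y * gauss_kernel (real n *\<^sub>R (y - x)) \<partial>lborel)
        = (\<integral>y. f y * gauss_kernel (real n *\<^sub>R (y - x)) \<partial>density (distr lborel borel (\<lambda>z. x + \<sigma> *\<^sub>R z)) (\<lambda>_. \<bar>\<sigma>\<bar> ^ DIM('b)))"
      using lborel_affine[of \<sigma> x] \<sigma> by simp
    also have "\<dots> = \<sigma> ^ DIM('b) * (\<integral>z. f (x + \<sigma> *\<^sub>R z) * gauss_kernel z \<partial>lborel)"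
      using \<sigma> n by (subst integral_density) (auto simp: integral_distr \<sigma>_def)
    finally have e: "c * (\<integral>y. f y * gauss_kernel (real n *\<^sub>R (y - x)) \<partial>lborel) = (\<integral>z. f (x + \<sigma> *\<^sub>R z) * gauss_kernel z \<partial>lborel) / c0"
      using \<sigma> c0 by (simp add: c_def)
    have i1: "integrable lborel (\<lambda>z. f (x + \<sigma> *\<^sub>R z) * gauss_kernel z)" "integrable lborel (\<lambda>z. f x * gauss_kernel z)"
      using B gauss_kernel_integrable by (auto intro!: ik)
    have "\<bar>f x * c0 - (\<integral>z. f (x + \<sigma> *\<^sub>R z) * gauss_kernel z \<partial>lborel)\<bar>
       = \<bar>\<integral>z. f x * gauss_kernel z - f (x + \<sigma> *\<^sub>R z) * gauss_kernel z \<partial>lborel\<bar>"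
      unfolding Bochner_Integration.integral_diff[OF i1(2,1)] c0_def by simp
    also have "\<dots> \<le> (\<integral>z. \<bar>f x * gauss_kernel z - f (x + \<sigma> *\<^sub>R z) * gauss_kernel z\<bar> \<partial>lborel)"
      by (rule integral_abs_bound)
    also have "\<dots> \<le> (\<integral>z. \<epsilon> / 2 * gauss_kernel z + 2 * B * (indicator {z :: 'b. \<delta> * real n \<le> norm z} z * gauss_kernel z) \<partial>lborel)"
    proof (rule integral_mono)
      show "integrable lborel (\<lambda>z. \<bar>f x * gauss_kernel z - f (x + \<sigma> *\<^sub>R z) * gauss_kernel z\<bar>)"
        using i1 by (intro integrable_abs Bochner_Integration.integrable_diff)
      show "integrable lborel (\<lambda>z. \<epsilon> / 2 * gauss_kernel z + 2 * B * (indicator {z :: 'b. \<delta> * real n \<le> norm z} z * gauss_kernel z))"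
        by (intro Bochner_Integration.integrable_add integrable_mult_right gauss_kernel_integrable ik[where B' = 1]) (auto simp: indicator_def)
      fix z :: 'b
      have "\<bar>f x - f (x + \<sigma> *\<^sub>R z)\<bar> \<le> \<epsilon> / 2 + 2 * B * indicator {z :: 'b. \<delta> * real n \<le> norm z} z"
      proof (cases "\<delta> * real n \<le> norm z")
        case True
        then show ?thesis using B[of x] B[of "x + \<sigma> *\<^sub>R z"] \<epsilon> by simp
      next
        case False
        then have "dist x (x + \<sigma> *\<^sub>R z) < \<delta>" using n by (simp add: dist_norm \<sigma>_def field_simps)
        from \<delta>(2)[OF this] show ?thesis using False by (simp add: dist_real_def)
      qed
      then have "\<bar>f x - f (x + \<sigma> *\<^sub>R z)\<bar> * gauss_kernel z \<le> (\<epsilon> / 2 + 2 * B * indicator {z :: 'b. \<delta> * real n \<le> norm z} z) * gauss_kernel z"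
        using gauss_kernel_bounds(1)[of z] by (intro mult_right_mono) auto
      then show "\<bar>f x * gauss_kernel z - f (x + \<sigma> *\<^sub>R z) * gauss_kernel z\<bar>
        \<le> \<epsilon> / 2 * gauss_kernel z + 2 * B * (indicator {z :: 'b. \<delta> * real n \<le> norm z} z * gauss_kernel z)"
        using gauss_kernel_bounds(1)[of z] by (simp add: left_diff_distrib[symmetric] abs_mult distrib_right mult.assoc)
    qed
    also have "\<dots> = \<epsilon> / 2 * c0 + 2 * B * g n"
      unfolding g_def c0_def
      by (subst Bochner_Integration.integral_add) (auto intro!: integrable_mult_right gauss_kernel_integrable ik[where B' = 1] simp: indicator_def)
    also have "\<dots> \<le> \<epsilon> / 2 * c0 + 2 * B * (\<epsilon> * c0 / (4 * (B + 1)))"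
      using n(2) B0 by (intro add_left_mono mult_left_mono) auto
    also have "2 * B * (\<epsilon> * c0 / (4 * (B + 1))) \<le> \<epsilon> / 2 * c0"
      using B0 \<epsilon> c0 by (simp add: field_simps)
    finally have "\<bar>f x * c0 - (\<integral>z. f (x + \<sigma> *\<^sub>R z) * gauss_kernel z \<partial>lborel)\<bar> \<le> \<epsilon> * c0" by simp
    moreover have "f x - (\<integral>z. f (x + \<sigma> *\<^sub>R z) * gauss_kernel z \<partial>lborel) / c0 = (f x * c0 - (\<integral>z. f (x + \<sigma> *\<^sub>R z) * gauss_kernel z \<partial>lborel)) / c0"
      using c0 by (simp add: field_simps)
    ultimately show ?thesis unfolding e using c0 by (simp add: abs_divide divide_le_eq)
  qed
  moreover have "0 \<le> c" using c0 \<sigma> by (simp add: c_def)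
  ultimately show ?thesis using n(1) by (intro that[of "real n" c]) auto
qed

text \<open>For a fixed \<open>\<omega>\<close> the variable \<open>W n \<omega>\<close> on
  \<open>Q\<close> has the data frozen, so its law stands for the conditional law. Replacing
  \<open>f\<close> by its smoothing costs at most \<open>r / 4\<close> on either side, whatever the
  laws are; the smoothed difference is bounded by an average over frequencies of distances between
  characteristic functions.\<close>

lemma conditional_char_convergence_integrable:
  fixes W :: "nat \<Rightarrow> 'a \<Rightarrow> 'c \<Rightarrow> 'b::euclidean_space" and S :: "nat \<Rightarrow> 'a \<Rightarrow> 'b" and f :: "'b \<Rightarrow> real"
  assumes M: "prob_space M" and Q: "prob_space Q"
    and W: "\<And>n. case_prod (W n) \<in> borel_measurable (M \<Otimes>\<^sub>M Q)" and S: "\<And>n. S n \<in> borel_measurable M"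
    and char: "\<And>t. (\<lambda>n. \<integral>\<omega>. cmod ((\<integral>\<omega>'. iexp (t \<bullet> W n \<omega> \<omega>') \<partial>Q) - (\<integral>\<omega>. iexp (t \<bullet> S n \<omega>) \<partial>M)) \<partial>M) \<longlonglongrightarrow> 0"
    and f: "uniformly_continuous_on UNIV f" "\<And>x. \<bar>f x\<bar> \<le> B" "integrable lborel f"
  shows "(\<lambda>n. \<integral>\<omega>. \<bar>(\<integral>\<omega>'. f (W n \<omega> \<omega>') \<partial>Q) - (\<integral>\<omega>. f (S n \<omega>) \<partial>M)\<bar> \<partial>M) \<longlonglongrightarrow> 0" (is "?E \<longlonglongrightarrow> 0")
proof (rule LIMSEQ_I)
  fix r :: real assume r: "0 < r"
  interpret M: prob_space M by fact
  interpret Q: prob_space Q by fact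
  interpret G: prob_space "gauss_measure :: 'b measure" by (rule prob_space_gauss_measure)
  interpret P: pair_prob_space M "gauss_measure :: 'b measure" ..
  note [measurable] = S W
  have W' [measurable]: "W n \<omega> \<in> borel_measurable Q" if "\<omega> \<in> space M" for n \<omega>
    using measurable_compose[OF measurable_Pair1'[OF that] W] by simp
  have [measurable]: "f \<in> borel_measurable borel" using f(3) by simp
  obtain s c where s: "0 < s" "0 \<le> c"
    and approx: "\<And>x. \<bar>f x - c * (\<integral>y. f y * gauss_kernel (s *\<^sub>R (y - x)) \<partial>lborel)\<bar> \<le> r / 4"
    using gauss_smoothing_approx[OF f(1,2), of "r / 4"] r by auto
  define F where "F x = (\<integral>y. f y * gauss_kernel (s *\<^sub>R (y - x)) \<partial>lborel)" for x
  have [measurable]: "F \<in> borel_measurable borel" unfolding F_def[abs_def] by measurable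
  have cF: "\<bar>c * F x\<bar> \<le> B + r / 4" for x
    using approx[of x] f(2)[of x] unfolding F_def by linarith
  define J where "J = (\<integral>y. \<bar>f y\<bar> \<partial>lborel)"
  have J: "0 \<le> J" unfolding J_def by (rule integral_nonneg_AE) simp
  define h where "h n w \<omega> = cmod ((\<integral>\<omega>'. iexp ((- s *\<^sub>R w) \<bullet> W n \<omega> \<omega>') \<partial>Q) - (\<integral>\<omega>. iexp ((- s *\<^sub>R w) \<bullet> S n \<omega>) \<partial>M))" for n w \<omega>
  have hm [measurable]: "(\<lambda>(\<omega>, w). h n w \<omega>) \<in> borel_measurable (M \<Otimes>\<^sub>M gauss_measure)" for n
    unfolding h_def by measurable
  have hb: "0 \<le> h n w \<omega>" "h n w \<omega> \<le> 2" if "\<omega> \<in> space M" for n w \<omega>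
  proof -
    have "cmod (\<integral>\<omega>'. iexp ((- s *\<^sub>R w) \<bullet> W n \<omega> \<omega>') \<partial>Q) \<le> 1" "cmod (\<integral>\<omega>. iexp ((- s *\<^sub>R w) \<bullet> S n \<omega>) \<partial>M) \<le> 1"
      using that by (intro cmod_integral_iexp_le_1 M Q; measurable)+
    then show "0 \<le> h n w \<omega>" "h n w \<omega> \<le> 2"
      unfolding h_def using norm_triangle_ineq4[of "\<integral>\<omega>'. iexp ((- s *\<^sub>R w) \<bullet> W n \<omega> \<omega>') \<partial>Q" "\<integral>\<omega>. iexp ((- s *\<^sub>R w) \<bullet> S n \<omega>) \<partial>M"]
      by auto
  qed
  define \<Delta> where "\<Delta> n \<omega> = (\<integral>w. h n w \<omega> \<partial>gauss_measure)" for n \<omega>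
  have \<Delta>m [measurable]: "\<Delta> n \<in> borel_measurable M" for n unfolding \<Delta>_def[abs_def] by measurable
  have hint: "integrable (M \<Otimes>\<^sub>M gauss_measure) (\<lambda>(\<omega>, w). h n w \<omega>)" for n
  proof (rule P.integrable_const_bound[where B = 2])
    show "AE x in M \<Otimes>\<^sub>M gauss_measure. norm (case x of (\<omega>, w) \<Rightarrow> h n w \<omega>) \<le> 2"
      using hb by (intro AE_I2) (auto simp: space_pair_measure)
  qed measurable
  have \<Delta>i: "integrable M (\<Delta> n)" for n
    unfolding \<Delta>_def[abs_def] using P.integrable_fst[OF hint] .
  \<comment> \<open>Fubini moves the expectation over \<open>M\<close> inside, where for each
    \<open>w\<close> the assumption holds at the frequency \<open>- s *\<^sub>R w\<close>. Pointwise
    convergence in \<open>w\<close> suffices, since everything is bounded by 2 and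
    \<open>gauss_measure\<close> is finite.\<close>
  have \<Delta>lim: "(\<lambda>n. \<integral>\<omega>. \<Delta> n \<omega> \<partial>M) \<longlonglongrightarrow> 0"
  proof -
    have "(\<lambda>n. \<integral>w. (\<integral>\<omega>. h n w \<omega> \<partial>M) \<partial>gauss_measure) \<longlonglongrightarrow> (\<integral>w. 0 \<partial>(gauss_measure :: 'b measure))"
    proof (rule integral_dominated_convergence[where w = "\<lambda>_. 2"])
      show "(\<lambda>w. \<integral>\<omega>. h n w \<omega> \<partial>M) \<in> borel_measurable gauss_measure" for n
        using hm[of n] by measurable
      show "AE w in gauss_measure. (\<lambda>n. \<integral>\<omega>. h n w \<omega> \<partial>M) \<longlonglongrightarrow> 0"
        unfolding h_def by (intro AE_I2 char)
      show "AE w in gauss_measure. norm (\<integral>\<omega>. h n w \<omega> \<partial>M) \<le> 2" for n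
      proof (rule AE_I2)
        fix w :: 'b
        have "(\<lambda>\<omega>. h n w \<omega>) \<in> borel_measurable M" unfolding h_def by measurable
        then have "integrable M (h n w)" using hb by (intro M.integrable_const_bound[where B = 2]) auto
        then have "(\<integral>\<omega>. h n w \<omega> \<partial>M) \<le> 2" using hb by (intro M.integral_le_const AE_I2) auto
        moreover have "0 \<le> (\<integral>\<omega>. h n w \<omega> \<partial>M)" using hb by (intro integral_nonneg_AE AE_I2) auto
        ultimately show "norm (\<integral>\<omega>. h n w \<omega> \<partial>M) \<le> 2" by simp
      qed
    qed simp_all
    moreover have "(\<integral>\<omega>. \<Delta> n \<omega> \<partial>M) = (\<integral>w. (\<integral>\<omega>. h n w \<omega> \<partial>M) \<partial>gauss_measure)" for n
      unfolding \<Delta>_def using P.Fubini_integral[OF hint] by simp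
    ultimately show ?thesis by simp
  qed
  have pt: "\<bar>(\<integral>\<omega>'. f (W n \<omega> \<omega>') \<partial>Q) - (\<integral>\<omega>. f (S n \<omega>) \<partial>M)\<bar> \<le> r / 2 + c * J * \<Delta> n \<omega>" if \<omega>: "\<omega> \<in> space M" for n \<omega>
  proof -
    have gen: "\<bar>(\<integral>\<omega>. f (V \<omega>) \<partial>R) - c * (\<integral>\<omega>. F (V \<omega>) \<partial>R)\<bar> \<le> r / 4"
      if R: "prob_space R" and [measurable]: "V \<in> borel_measurable R" for R :: "'z measure" and V
    proof -
      interpret R: prob_space R by fact
      have i: "integrable R (\<lambda>\<omega>. f (V \<omega>))" "integrable R (\<lambda>\<omega>. c * F (V \<omega>))"
        by (rule R.integrable_const_bound[where B = B], simp add: f(2), measurable)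
          (rule R.integrable_const_bound[where B = "B + r / 4"], use cF in simp, measurable)
      have "\<bar>(\<integral>\<omega>. f (V \<omega>) \<partial>R) - c * (\<integral>\<omega>. F (V \<omega>) \<partial>R)\<bar> = \<bar>\<integral>\<omega>. f (V \<omega>) - c * F (V \<omega>) \<partial>R\<bar>"
        using i by (simp del: integral_mult_right_zero add: integral_mult_right_zero[symmetric])
      also have "\<dots> \<le> (\<integral>\<omega>. \<bar>f (V \<omega>) - c * F (V \<omega>)\<bar> \<partial>R)" by (rule integral_abs_bound)
      also have "\<dots> \<le> r / 4"
        using i approx by (intro R.integral_le_const AE_I2 integrable_abs Bochner_Integration.integrable_diff) (auto simp: F_def)
      finally show ?thesis .
    qed
    have "\<bar>(\<integral>\<omega>'. F (W n \<omega> \<omega>') \<partial>Q) - (\<integral>\<omega>. F (S n \<omega>) \<partial>M)\<bar> \<le> J * \<Delta> n \<omega>"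
      unfolding F_def J_def \<Delta>_def h_def by (rule gauss_smoothing_diff[OF Q W'[OF \<omega>] M S f(3)])
    then have "c * \<bar>(\<integral>\<omega>'. F (W n \<omega> \<omega>') \<partial>Q) - (\<integral>\<omega>. F (S n \<omega>) \<partial>M)\<bar> \<le> c * (J * \<Delta> n \<omega>)"
      using s(2) by (rule mult_left_mono)
    then have "\<bar>c * (\<integral>\<omega>'. F (W n \<omega> \<omega>') \<partial>Q) - c * (\<integral>\<omega>. F (S n \<omega>) \<partial>M)\<bar> \<le> c * J * \<Delta> n \<omega>"
      using s(2) by (simp add: right_diff_distrib[symmetric] abs_mult mult.assoc)
    with gen[OF Q W'[OF \<omega>], of n] gen[OF M S, of n] show ?thesis by linarith
  qed
  have "?E n \<le> r / 2 + c * J * (\<integral>\<omega>. \<Delta> n \<omega> \<partial>M)" for n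
  proof -
    have b: "\<bar>\<integral>\<omega>'. f (W n \<omega> \<omega>') \<partial>Q\<bar> \<le> B" if "\<omega> \<in> space M" for \<omega>
    proof -
      have "\<bar>\<integral>\<omega>'. f (W n \<omega> \<omega>') \<partial>Q\<bar> \<le> (\<integral>\<omega>'. \<bar>f (W n \<omega> \<omega>')\<bar> \<partial>Q)" by (rule integral_abs_bound)
      also have "\<dots> \<le> B"
        using that f(2) by (intro Q.integral_le_const AE_I2 Q.integrable_const_bound[where B = B]) auto
      finally show ?thesis .
    qed
    have i: "integrable M (\<lambda>\<omega>. \<integral>\<omega>'. f (W n \<omega> \<omega>') \<partial>Q)"
      by (rule M.integrable_const_bound[where B = B]) (rule AE_I2, simp add: b, measurable)
    have "?E n \<le> (\<integral>\<omega>. r / 2 + c * J * \<Delta> n \<omega> \<partial>M)"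
      using i pt \<Delta>i by (intro integral_mono) auto
    also have "\<dots> = r / 2 + c * J * (\<integral>\<omega>. \<Delta> n \<omega> \<partial>M)" using \<Delta>i by (simp add: M.prob_space)
    finally show ?thesis .
  qed
  moreover have "eventually (\<lambda>n. r / 2 + c * J * (\<integral>\<omega>. \<Delta> n \<omega> \<partial>M) < r) sequentially"
  proof (rule order_tendstoD(2))
    show "(\<lambda>n. r / 2 + c * J * (\<integral>\<omega>. \<Delta> n \<omega> \<partial>M)) \<longlonglongrightarrow> r / 2 + c * J * 0"
      by (intro tendsto_intros \<Delta>lim)
  qed (use r in simp)
  moreover have "0 \<le> ?E n" for n by (rule integral_nonneg_AE) simp
  ultimately have "eventually (\<lambda>n. norm (?E n - 0) < r) sequentially"
    by (elim eventually_mono) (auto intro: le_less_trans)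
  then show "\<exists>no. \<forall>n\<ge>no. norm (?E n - 0) < r" by (simp add: eventually_sequentially)
qed

section \<open>From integrable to bounded continuous test functions\<close>

lemma cutoff_uniformly_continuous_integrable:
  fixes f :: "'b::euclidean_space \<Rightarrow> real"
  assumes f: "continuous_on UNIV f" and z: "\<And>x. R < norm x \<Longrightarrow> f x = 0"
  shows "uniformly_continuous_on UNIV f" "integrable lborel f"
proof -
  have uc: "uniformly_continuous_on (cball 0 (R + 1)) f"
    by (intro compact_uniformly_continuous continuous_on_subset[OF f]) auto
  show "uniformly_continuous_on UNIV f"
    unfolding uniformly_continuous_on_def
  proof (intro allI impI)
    fix e :: real assume e: "0 < e"
    obtain d where d: "0 < d" "\<And>x x'. x \<in> cball 0 (R + 1) \<Longrightarrow> x' \<in> cball 0 (R + 1) \<Longrightarrow> dist x' x < d \<Longrightarrow> dist (f x') (f x) < e"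
      using uc e unfolding uniformly_continuous_on_def by metis
    \<comment> \<open>The cap 1 on the distance places both points in the ball of radius
      \<open>R + 1\<close> as soon as one lies in that of radius \<open>R\<close>; otherwise both
      values are 0.\<close>
    have "dist (f x') (f x) < e" if "dist x' x < min d 1" for x x'
    proof (cases "norm x \<le> R \<or> norm x' \<le> R")
      case True
      moreover have "norm x \<le> norm x' + dist x' x" "norm x' \<le> norm x + dist x' x"
        using norm_triangle_sub[of x x'] norm_triangle_sub[of x' x] by (simp_all add: dist_norm norm_minus_commute)
      ultimately have "x \<in> cball 0 (R + 1)" "x' \<in> cball 0 (R + 1)" using that by auto
      then show ?thesis using d(2) that by simp
    next
      case False
      then show ?thesis using z[of x] z[of x'] e by simp
    qed
    then show "\<exists>d>0. \<forall>x\<in>UNIV. \<forall>x'\<in>UNIV. dist x' x < d \<longrightarrow> dist (f x') (f x) < e"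
      using d(1) by (intro exI[of _ "min d 1"]) auto
  qed
  have "integrable lborel (\<lambda>x. indicator (cball 0 R) x *\<^sub>R f x)"
    by (intro borel_integrable_compact continuous_on_subset[OF f]) auto
  moreover have "(\<lambda>x. indicator (cball 0 R) x *\<^sub>R f x) = f"
    using z by (auto simp: fun_eq_iff indicator_def not_le)
  ultimately show "integrable lborel f" by simp
qed

text \<open>The integrable case is applied to \<open>f * \<kappa>\<close> and once more to the
  cutoff \<open>\<kappa>\<close> itself. The latter shows that \<open>W\<close> loses asymptotically
  the same mass outside the ball as \<open>S\<close> does, so the tail bound of \<open>S\<close>
  transfers to the conditional laws.\<close>

theorem conditional_char_convergence:
  fixes W :: "nat \<Rightarrow> 'a \<Rightarrow> 'c \<Rightarrow> 'b::euclidean_space" and S :: "nat \<Rightarrow> 'a \<Rightarrow> 'b" and f :: "'b \<Rightarrow> real"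
  assumes M: "prob_space M" and Q: "prob_space Q"
    and W: "\<And>n. case_prod (W n) \<in> borel_measurable (M \<Otimes>\<^sub>M Q)" and S: "\<And>n. S n \<in> borel_measurable M"
    and char: "\<And>t. (\<lambda>n. \<integral>\<omega>. cmod ((\<integral>\<omega>'. iexp (t \<bullet> W n \<omega> \<omega>') \<partial>Q) - (\<integral>\<omega>. iexp (t \<bullet> S n \<omega>) \<partial>M)) \<partial>M) \<longlonglongrightarrow> 0"
    and tight: "\<And>n. integrable M (\<lambda>\<omega>. (norm (S n \<omega>))\<^sup>2)" "\<And>n. (\<integral>\<omega>. (norm (S n \<omega>))\<^sup>2 \<partial>M) \<le> D"
    and f: "continuous_on UNIV f" "\<And>x. \<bar>f x\<bar> \<le> B"
  shows "(\<lambda>n. \<integral>\<omega>. \<bar>(\<integral>\<omega>'. f (W n \<omega> \<omega>') \<partial>Q) - (\<integral>\<omega>. f (S n \<omega>) \<partial>M)\<bar> \<partial>M) \<longlonglongrightarrow> 0" (is "?E \<longlonglongrightarrow> 0")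
proof (rule LIMSEQ_I)
  fix r :: real assume r: "0 < r"
  interpret M: prob_space M by fact
  interpret Q: prob_space Q by fact
  note [measurable] = S W
  have W' [measurable]: "W n \<omega> \<in> borel_measurable Q" if "\<omega> \<in> space M" for n \<omega>
    using measurable_compose[OF measurable_Pair1'[OF that] W] by simp
  have fm [measurable]: "f \<in> borel_measurable borel" using f(1) by (rule borel_measurable_continuous_onI)
  have B: "0 \<le> B" using f(2)[of 0] by simp
  have D: "0 \<le> D" using tight(2)[of 0] by (rule order_trans[rotated]) (simp add: integral_nonneg_AE)
  \<comment> \<open>By Chebyshev's inequality this radius gives
    \<open>B * \<tau> n \<le> r / 4\<close>. The loss is paid twice, for \<open>S\<close> and, after
    the transfer, for \<open>W\<close>, which accounts for the \<open>r / 2\<close> in the estimates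
    below.\<close>
  define R where "R = sqrt (4 * B * (D + 1) / r) + 1"
  have R: "1 \<le> R" "4 * B * (D + 1) / r \<le> R\<^sup>2"
  proof -
    have n: "0 \<le> 4 * B * (D + 1) / r" using B D r by simp
    then show "1 \<le> R" by (simp add: R_def)
    have "4 * B * (D + 1) / r = (sqrt (4 * B * (D + 1) / r))\<^sup>2" using n by simp
    also have "\<dots> \<le> R\<^sup>2" unfolding R_def using n by (intro power_mono) auto
    finally show "4 * B * (D + 1) / r \<le> R\<^sup>2" .
  qed
  define \<kappa> :: "'b \<Rightarrow> real" where "\<kappa> x = max 0 (min 1 (R + 1 - norm x))" for x
  have \<kappa>c: "continuous_on UNIV \<kappa>" unfolding \<kappa>_def[abs_def] by (intro continuous_intros)
  have \<kappa>m [measurable]: "\<kappa> \<in> borel_measurable borel" using \<kappa>c by (rule borel_measurable_continuous_onI)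
  have \<kappa>: "0 \<le> \<kappa> x" "\<kappa> x \<le> 1" "R + 1 < norm x \<Longrightarrow> \<kappa> x = 0" "norm x \<le> R \<Longrightarrow> \<kappa> x = 1" for x
    by (auto simp: \<kappa>_def)
  have tail: "1 - \<kappa> x \<le> (norm x)\<^sup>2 / R\<^sup>2" for x
  proof (cases "norm x \<le> R")
    case False
    then have "R\<^sup>2 \<le> (norm x)\<^sup>2" using R(1) by (intro power_mono) auto
    then have "1 \<le> (norm x)\<^sup>2 / R\<^sup>2" using R(1) by simp
    then show ?thesis using \<kappa>(1)[of x] by linarith
  qed (simp add: \<kappa>(4))
  define g where "g x = f x * \<kappa> x" for x
  have gc: "continuous_on UNIV g" unfolding g_def[abs_def] by (intro continuous_intros f(1) \<kappa>c)
  have gb: "\<bar>g x\<bar> \<le> B" for x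
    using f(2)[of x] \<kappa>[of x] mult_mono[of "\<bar>f x\<bar>" B "\<kappa> x" 1] B by (simp add: g_def abs_mult)
  have gm [measurable]: "g \<in> borel_measurable borel" using gc by (rule borel_measurable_continuous_onI)
  have g0: "R + 1 < norm x \<Longrightarrow> g x = 0" for x using \<kappa>(3)[of x] by (simp add: g_def)
  let ?G = "\<lambda>g n \<omega>. \<bar>(\<integral>\<omega>'. g (W n \<omega> \<omega>') \<partial>Q) - (\<integral>\<omega>. g (S n \<omega>) \<partial>M)\<bar>"
  have lg: "(\<lambda>n. \<integral>\<omega>. ?G g n \<omega> \<partial>M) \<longlonglongrightarrow> 0"
    by (rule conditional_char_convergence_integrable[OF M Q W S char _ gb])
       (use cutoff_uniformly_continuous_integrable[OF gc g0] in auto)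
  have \<kappa>b: "\<bar>\<kappa> x\<bar> \<le> 1" for x using \<kappa>[of x] by simp
  have l\<kappa>: "(\<lambda>n. \<integral>\<omega>. ?G \<kappa> n \<omega> \<partial>M) \<longlonglongrightarrow> 0"
    by (rule conditional_char_convergence_integrable[OF M Q W S char _ \<kappa>b])
       (use cutoff_uniformly_continuous_integrable[OF \<kappa>c \<kappa>(3)] in auto)
  have iQ: "integrable Q (\<lambda>\<omega>'. h (W n \<omega> \<omega>'))" and iM: "integrable M (\<lambda>\<omega>. h (S n \<omega>))"
    and bQ: "\<bar>\<integral>\<omega>'. h (W n \<omega> \<omega>') \<partial>Q\<bar> \<le> B'"
    if "\<omega> \<in> space M" and [measurable]: "h \<in> borel_measurable borel" and b: "\<And>x. \<bar>h x\<bar> \<le> B'" for h :: "'b \<Rightarrow> real" and B' n \<omega>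
  proof -
    show i: "integrable Q (\<lambda>\<omega>'. h (W n \<omega> \<omega>'))"
      by (rule Q.integrable_const_bound[where B = B'], simp add: b) (use that(1) in measurable)
    show "integrable M (\<lambda>\<omega>. h (S n \<omega>))"
      by (rule M.integrable_const_bound[where B = B'], simp add: b) measurable
    have "\<bar>\<integral>\<omega>'. h (W n \<omega> \<omega>') \<partial>Q\<bar> \<le> (\<integral>\<omega>'. \<bar>h (W n \<omega> \<omega>')\<bar> \<partial>Q)" by (rule integral_abs_bound)
    also have "\<dots> \<le> B'" using b i by (intro Q.integral_le_const AE_I2 integrable_abs) auto
    finally show "\<bar>\<integral>\<omega>'. h (W n \<omega> \<omega>') \<partial>Q\<bar> \<le> B'" .
  qed
  have iG: "integrable M (?G h n)" if [measurable]: "h \<in> borel_measurable borel" and b: "\<And>x. \<bar>h x\<bar> \<le> B'" for h :: "'b \<Rightarrow> real" and B' n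
  proof -
    have "integrable M (\<lambda>\<omega>. \<integral>\<omega>'. h (W n \<omega> \<omega>') \<partial>Q)"
      by (rule M.integrable_const_bound[where B = B']) (rule AE_I2, use bQ[OF _ that] in simp, measurable)
    then show ?thesis by (intro integrable_abs Bochner_Integration.integrable_diff) auto
  qed
  define \<tau> where "\<tau> n = (\<integral>\<omega>. 1 - \<kappa> (S n \<omega>) \<partial>M)" for n
  have \<tau>: "B * \<tau> n \<le> r / 4" for n
  proof -
    have "\<tau> n \<le> (\<integral>\<omega>. (norm (S n \<omega>))\<^sup>2 / R\<^sup>2 \<partial>M)"
      unfolding \<tau>_def using tail tight(1)
      by (intro integral_mono) (auto intro!: M.integrable_const_bound[where B = 1] simp: \<kappa>)
    also have "\<dots> \<le> (D + 1) / R\<^sup>2" using tight(2)[of n] by (auto intro!: divide_right_mono)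
    finally have "B * \<tau> n \<le> B * ((D + 1) / R\<^sup>2)" using B by (rule mult_left_mono)
    also have "\<dots> \<le> r / 4"
    proof -
      have "4 * (B * (D + 1)) \<le> R\<^sup>2 * r" using R(2) r by (simp add: field_simps)
      then show ?thesis using R(1) by (simp add: field_simps)
    qed
    finally show ?thesis .
  qed
  have pt: "?G f n \<omega> \<le> ?G g n \<omega> + B * ?G \<kappa> n \<omega> + r / 2" if \<omega>: "\<omega> \<in> space M" for n \<omega>
  proof -
    have fg: "\<bar>f x - g x\<bar> \<le> B * (1 - \<kappa> x)" for x
    proof -
      have "f x - g x = f x * (1 - \<kappa> x)" by (simp add: g_def algebra_simps)
      then show ?thesis using f(2)[of x] \<kappa>(2)[of x] by (simp add: abs_mult mult_right_mono)
    qed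
    have i: "integrable Q (\<lambda>\<omega>'. f (W n \<omega> \<omega>'))" "integrable Q (\<lambda>\<omega>'. g (W n \<omega> \<omega>'))" "integrable Q (\<lambda>\<omega>'. \<kappa> (W n \<omega> \<omega>'))"
      "integrable M (\<lambda>\<omega>. f (S n \<omega>))" "integrable M (\<lambda>\<omega>. g (S n \<omega>))" "integrable M (\<lambda>\<omega>. \<kappa> (S n \<omega>))"
      by (rule iQ[OF \<omega> fm f(2)] iQ[OF \<omega> gm gb] iQ[OF \<omega> \<kappa>m \<kappa>b]
          iM[OF \<omega> fm f(2)] iM[OF \<omega> gm gb] iM[OF \<omega> \<kappa>m \<kappa>b])+
    have "\<bar>(\<integral>\<omega>'. f (W n \<omega> \<omega>') \<partial>Q) - (\<integral>\<omega>'. g (W n \<omega> \<omega>') \<partial>Q)\<bar> = \<bar>\<integral>\<omega>'. f (W n \<omega> \<omega>') - g (W n \<omega> \<omega>') \<partial>Q\<bar>"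
      using i by simp
    also have "\<dots> \<le> (\<integral>\<omega>'. \<bar>f (W n \<omega> \<omega>') - g (W n \<omega> \<omega>')\<bar> \<partial>Q)" by (rule integral_abs_bound)
    also have "\<dots> \<le> (\<integral>\<omega>'. B * (1 - \<kappa> (W n \<omega> \<omega>')) \<partial>Q)"
      using i fg by (intro integral_mono) auto
    also have "\<dots> = B * (1 - (\<integral>\<omega>'. \<kappa> (W n \<omega> \<omega>') \<partial>Q))" using i by (simp add: Q.prob_space)
    finally have 1: "\<bar>(\<integral>\<omega>'. f (W n \<omega> \<omega>') \<partial>Q) - (\<integral>\<omega>'. g (W n \<omega> \<omega>') \<partial>Q)\<bar> \<le> B * (1 - (\<integral>\<omega>'. \<kappa> (W n \<omega> \<omega>') \<partial>Q))" .
    have "\<bar>(\<integral>\<omega>. f (S n \<omega>) \<partial>M) - (\<integral>\<omega>. g (S n \<omega>) \<partial>M)\<bar> = \<bar>\<integral>\<omega>. f (S n \<omega>) - g (S n \<omega>) \<partial>M\<bar>"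
      using i by simp
    also have "\<dots> \<le> (\<integral>\<omega>. \<bar>f (S n \<omega>) - g (S n \<omega>)\<bar> \<partial>M)" by (rule integral_abs_bound)
    also have "\<dots> \<le> (\<integral>\<omega>. B * (1 - \<kappa> (S n \<omega>)) \<partial>M)"
      using i fg by (intro integral_mono) auto
    also have "\<dots> = B * \<tau> n" unfolding \<tau>_def by simp
    finally have 2: "\<bar>(\<integral>\<omega>. f (S n \<omega>) \<partial>M) - (\<integral>\<omega>. g (S n \<omega>) \<partial>M)\<bar> \<le> B * \<tau> n" .
    have "1 - (\<integral>\<omega>'. \<kappa> (W n \<omega> \<omega>') \<partial>Q) \<le> ?G \<kappa> n \<omega> + \<tau> n"
      unfolding \<tau>_def using i by (simp add: M.prob_space)
    then have "B * (1 - (\<integral>\<omega>'. \<kappa> (W n \<omega> \<omega>') \<partial>Q)) \<le> B * (?G \<kappa> n \<omega> + \<tau> n)" using B by (rule mult_left_mono)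
    also have "\<dots> = B * ?G \<kappa> n \<omega> + B * \<tau> n" by (rule distrib_left)
    finally show ?thesis using 1 2 \<tau>[of n] by linarith
  qed
  have "?E n \<le> (\<integral>\<omega>. ?G g n \<omega> \<partial>M) + B * (\<integral>\<omega>. ?G \<kappa> n \<omega> \<partial>M) + r / 2" for n
  proof -
    have i: "integrable M (?G f n)" "integrable M (?G g n)" "integrable M (?G \<kappa> n)"
      by (rule iG[OF fm f(2)], rule iG[OF gm gb], rule iG[OF \<kappa>m \<kappa>b])
    have "?E n \<le> (\<integral>\<omega>. ?G g n \<omega> + B * ?G \<kappa> n \<omega> + r / 2 \<partial>M)"
      using i pt by (intro integral_mono) auto
    also have "\<dots> = (\<integral>\<omega>. ?G g n \<omega> \<partial>M) + B * (\<integral>\<omega>. ?G \<kappa> n \<omega> \<partial>M) + r / 2"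
      using i by (simp add: M.prob_space)
    finally show ?thesis .
  qed
  moreover have "eventually (\<lambda>n. (\<integral>\<omega>. ?G g n \<omega> \<partial>M) + B * (\<integral>\<omega>. ?G \<kappa> n \<omega> \<partial>M) + r / 2 < r) sequentially"
  proof (rule order_tendstoD(2))
    show "(\<lambda>n. (\<integral>\<omega>. ?G g n \<omega> \<partial>M) + B * (\<integral>\<omega>. ?G \<kappa> n \<omega> \<partial>M) + r / 2) \<longlonglongrightarrow> 0 + B * 0 + r / 2"
      by (intro tendsto_intros lg l\<kappa>)
  qed (use r in simp)
  moreover have "0 \<le> ?E n" for n by (rule integral_nonneg_AE) simp
  ultimately have "eventually (\<lambda>n. norm (?E n - 0) < r) sequentially"
    by (elim eventually_mono) (auto intro: le_less_trans)
  then show "\<exists>no. \<forall>n\<ge>no. norm (?E n - 0) < r" by (simp add: eventually_sequentially)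
qed

subsection \<open>Conditional expectations given the data\<close>

lemma space_gen_sigma [simp]: "space (gen_sigma M I X) = space M"
  by (simp add: gen_sigma_def)

lemma gen_sigma_measurable_tuple: "(\<lambda>\<omega>. \<lambda>i\<in>I. X i \<omega>) \<in> gen_sigma M I X \<rightarrow>\<^sub>M PiM I (\<lambda>_. borel)"
  unfolding gen_sigma_def by (rule measurable_vimage_algebra1) (auto simp: space_PiM)

lemma gen_sigma_measurable: "i \<in> I \<Longrightarrow> X i \<in> gen_sigma M I X \<rightarrow>\<^sub>M borel"
  using measurable_compose[OF gen_sigma_measurable_tuple measurable_component_singleton[of i I "\<lambda>_. borel"]] by simp

text \<open>The minimality of \<open>gen_sigma\<close>. That it is a subalgebra, that it is monotone
  in the index set and that a single row sits inside the whole array are all instances.\<close>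

lemma sets_gen_sigma_subset:
  assumes "space N = space M" "\<And>i. i \<in> I \<Longrightarrow> X i \<in> N \<rightarrow>\<^sub>M borel"
  shows "sets (gen_sigma M I X) \<subseteq> sets N"
proof -
  have t: "(\<lambda>\<omega>. \<lambda>i\<in>I. X i \<omega>) \<in> N \<rightarrow>\<^sub>M PiM I (\<lambda>_. borel)"
    using assms(2) by (intro measurable_restrict) auto
  show ?thesis
  proof
    fix S assume "S \<in> sets (gen_sigma M I X)"
    then obtain A where "A \<in> sets (PiM I (\<lambda>_. borel))" "S = (\<lambda>\<omega>. \<lambda>i\<in>I. X i \<omega>) -` A \<inter> space M"
      unfolding gen_sigma_def by (subst (asm) sets_vimage_algebra2) (auto simp: space_PiM)
    then show "S \<in> sets N" using measurable_sets[OF t] assms(1) by simp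
  qed
qed

lemma subalgebra_gen_sigma:
  assumes "\<And>i. i \<in> I \<Longrightarrow> X i \<in> borel_measurable M"
  shows "subalgebra M (gen_sigma M I X)"
  unfolding subalgebra_def using sets_gen_sigma_subset[OF refl assms] by simp

lemma gen_sigma_mono:
  assumes "I \<subseteq> J"
  shows "sets (gen_sigma M I X) \<subseteq> sets (gen_sigma M J X)"
  using assms by (intro sets_gen_sigma_subset) (auto intro!: gen_sigma_measurable)

context prob_space
begin

lemma real_cond_exp_independent:
  fixes \<Phi> :: "'v \<times> 'e \<Rightarrow> real"
  assumes V [measurable]: "V \<in> M \<rightarrow>\<^sub>M MV" and E [measurable]: "E \<in> M \<rightarrow>\<^sub>M ME"
    and ind: "indep_set (sets (vimage_algebra (space M) V MV)) (sets (vimage_algebra (space M) E ME))"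
    and \<Phi>: "\<Phi> \<in> borel_measurable (MV \<Otimes>\<^sub>M ME)"
    and B: "\<And>p. \<bar>\<Phi> p\<bar> \<le> B"
  shows "AE \<omega> in M. real_cond_exp M (vimage_algebra (space M) V MV) (\<lambda>\<omega>. \<Phi> (V \<omega>, E \<omega>)) \<omega>
    = (\<integral>\<omega>'. \<Phi> (V \<omega>, E \<omega>') \<partial>M)"
proof -
  note [measurable] = \<Phi>
  let ?G = "vimage_algebra (space M) V MV"
  have Vs: "V \<in> space M \<rightarrow> space MV" using measurable_space[OF V] by auto
  have sub: "subalgebra M ?G"
    unfolding subalgebra_def using measurable_sets[OF V] by (auto simp: sets_vimage_algebra2[OF Vs])
  interpret finite_measure_subalgebra M ?G by unfold_locales (rule sub)
  interpret DV: prob_space "distr M MV V" by (rule prob_space_distr) simp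
  interpret DE: prob_space "distr M ME E" by (rule prob_space_distr) simp
  interpret P: pair_prob_space "distr M MV V" "distr M ME E" ..
  have prod: "distr M MV V \<Otimes>\<^sub>M distr M ME E = distr M (MV \<Otimes>\<^sub>M ME) (\<lambda>\<omega>. (V \<omega>, E \<omega>))"
  proof (rule pair_measure_eqI)
    fix A B assume AB: "A \<in> sets (distr M MV V)" "B \<in> sets (distr M ME E)"
    then have [measurable]: "A \<in> sets MV" "B \<in> sets ME" by simp_all
    have "emeasure (distr M (MV \<Otimes>\<^sub>M ME) (\<lambda>\<omega>. (V \<omega>, E \<omega>))) (A \<times> B)
        = emeasure M ((\<lambda>\<omega>. (V \<omega>, E \<omega>)) -` (A \<times> B) \<inter> space M)"
      by (rule emeasure_distr) measurable
    also have "(\<lambda>\<omega>. (V \<omega>, E \<omega>)) -` (A \<times> B) \<inter> space M = (V -` A \<inter> space M) \<inter> (E -` B \<inter> space M)" by auto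
    also have "emeasure M \<dots> = ennreal (prob (V -` A \<inter> space M) * prob (E -` B \<inter> space M))"
      unfolding emeasure_eq_measure
      by (subst indep_setD[OF ind]) (use AB in \<open>auto intro!: in_vimage_algebra\<close>)
    also have "\<dots> = emeasure (distr M MV V) A * emeasure (distr M ME E) B"
      using AB by (simp add: emeasure_distr emeasure_eq_measure ennreal_mult)
    finally show "emeasure (distr M MV V) A * emeasure (distr M ME E) B
        = emeasure (distr M (MV \<Otimes>\<^sub>M ME) (\<lambda>\<omega>. (V \<omega>, E \<omega>))) (A \<times> B)" by simp
  qed (unfold_locales, simp)
  \<comment> \<open>The average runs over a second copy of \<open>M\<close> rather than over the law
    of \<open>E\<close>, so that multipliers and data stay variables on the same space.\<close>
  define \<gamma> where "\<gamma> v = (\<integral>\<omega>'. \<Phi> (v, E \<omega>') \<partial>M)" for v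
  have \<gamma>m [measurable]: "\<gamma> \<in> borel_measurable MV" unfolding \<gamma>_def[abs_def] by measurable
  have \<gamma>_distr: "\<gamma> v = (\<integral>u. \<Phi> (v, u) \<partial>distr M ME E)" if "v \<in> space MV" for v
    unfolding \<gamma>_def using that by (subst integral_distr) auto
  have \<gamma>b: "\<bar>\<gamma> v\<bar> \<le> B" if "v \<in> space MV" for v
  proof -
    have "\<bar>\<gamma> v\<bar> \<le> (\<integral>\<omega>'. \<bar>\<Phi> (v, E \<omega>')\<bar> \<partial>M)" unfolding \<gamma>_def by (rule integral_abs_bound)
    also have "\<dots> \<le> B" using B that by (intro integral_le_const AE_I2 integrable_const_bound[where B = B]) auto
    finally show ?thesis .
  qed
  have i\<Phi>: "integrable M (\<lambda>\<omega>. \<Phi> (V \<omega>, E \<omega>))"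
    by (rule integrable_const_bound[where B = B]) (simp add: B, measurable)
  have i\<gamma>: "integrable M (\<lambda>\<omega>. \<gamma> (V \<omega>))"
    by (rule integrable_const_bound[where B = B]) (use \<gamma>b measurable_space[OF V] in \<open>auto intro!: AE_I2\<close>)
  have "AE \<omega> in M. real_cond_exp M ?G (\<lambda>\<omega>. \<Phi> (V \<omega>, E \<omega>)) \<omega> = \<gamma> (V \<omega>)"
  proof (rule real_cond_exp_charact[OF _ i\<Phi> i\<gamma>])
    show "(\<lambda>\<omega>. \<gamma> (V \<omega>)) \<in> borel_measurable ?G"
      using measurable_compose[OF measurable_vimage_algebra1[OF Vs] \<gamma>m] .
    fix S assume "S \<in> sets ?G"
    then obtain A where A [measurable]: "A \<in> sets MV" and S: "S = V -` A \<inter> space M"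
      by (auto simp: sets_vimage_algebra2[OF Vs])
    have ind_eq: "indicator S \<omega> = (indicator A (V \<omega>) :: real)" if "\<omega> \<in> space M" for \<omega>
      using that by (auto simp: S indicator_def)
    have iP: "integrable (distr M MV V \<Otimes>\<^sub>M distr M ME E) (\<lambda>(v, u). indicator A v * \<Phi> (v, u))"
    proof (rule P.integrable_const_bound[where B = B])
      have "\<bar>indicator A v * \<Phi> (v, u)\<bar> \<le> B" for v u
        using B[of "(v, u)"] by (auto simp: indicator_def intro: order_trans[OF abs_ge_zero])
      then show "AE x in distr M MV V \<Otimes>\<^sub>M distr M ME E. norm (case x of (v, u) \<Rightarrow> indicator A v * \<Phi> (v, u)) \<le> B"
        by (intro AE_I2) auto
    qed measurable
    have "(\<integral>\<omega>\<in>S. \<Phi> (V \<omega>, E \<omega>) \<partial>M) = (\<integral>\<omega>. indicator A (V \<omega>) * \<Phi> (V \<omega>, E \<omega>) \<partial>M)"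
      unfolding set_lebesgue_integral_def by (intro Bochner_Integration.integral_cong refl) (simp add: ind_eq)
    also have "\<dots> = (\<integral>x. (case x of (v, u) \<Rightarrow> indicator A v * \<Phi> (v, u)) \<partial>distr M (MV \<Otimes>\<^sub>M ME) (\<lambda>\<omega>. (V \<omega>, E \<omega>)))"
      by (subst integral_distr) auto
    also have "\<dots> = (\<integral>x. (case x of (v, u) \<Rightarrow> indicator A v * \<Phi> (v, u)) \<partial>(distr M MV V \<Otimes>\<^sub>M distr M ME E))"
      by (simp add: prod)
    also have "\<dots> = (\<integral>v. (\<integral>u. indicator A v * \<Phi> (v, u) \<partial>distr M ME E) \<partial>distr M MV V)"
      by (rule P.integral_fst[symmetric, OF iP])
    also have "\<dots> = (\<integral>v. indicator A v * \<gamma> v \<partial>distr M MV V)"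
      by (intro Bochner_Integration.integral_cong refl) (simp add: \<gamma>_distr)
    also have "\<dots> = (\<integral>\<omega>. indicator A (V \<omega>) * \<gamma> (V \<omega>) \<partial>M)"
      by (subst integral_distr) auto
    also have "\<dots> = (\<integral>\<omega>\<in>S. \<gamma> (V \<omega>) \<partial>M)"
      unfolding set_lebesgue_integral_def by (intro Bochner_Integration.integral_cong refl) (simp add: ind_eq)
    finally show "(\<integral>\<omega>\<in>S. \<Phi> (V \<omega>, E \<omega>) \<partial>M) = (\<integral>\<omega>\<in>S. \<gamma> (V \<omega>) \<partial>M)" .
  qed
  then show ?thesis by (simp add: \<gamma>_def)
qed

text \<open>Independence factorises the characteristic function. With frozen data as coefficients
  \<open>a\<close> this is the conditional characteristic function of the multiplier sum.\<close>

lemma char_gaussian_combination: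
  fixes e :: "nat \<Rightarrow> 'a \<Rightarrow> real"
  assumes ind: "indep_vars (\<lambda>_. borel) e I" and J: "J \<subseteq> I"
    and gauss: "\<And>l. l \<in> I \<Longrightarrow> distributed M lborel (e l) std_normal_density"
  shows "(\<integral>\<omega>. iexp (\<Sum>l\<in>J. a l * e l \<omega>) \<partial>M) = complex_of_real (exp (- (\<Sum>l\<in>J. (a l)\<^sup>2) / 2))"
proof -
  have m [measurable]: "e l \<in> borel_measurable M" if "l \<in> J" for l
    using distributed_measurable[OF gauss[of l]] that J by auto
  have iv: "indep_vars (\<lambda>_. borel) (\<lambda>l \<omega>. a l * e l \<omega>) J"
    by (rule indep_vars_compose2[OF indep_vars_subset[OF ind J]]) simp
  have c: "char (distr M borel (\<lambda>\<omega>. a l * e l \<omega>)) 1 = complex_of_real (exp (- (a l)\<^sup>2 / 2))" if "l \<in> J" for l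
  proof -
    have d: "distr M lborel (e l) = std_normal_distribution"
      using distributed_distr_eq_density[OF gauss[of l]] that J by auto
    have "char (distr M borel (\<lambda>\<omega>. a l * e l \<omega>)) 1 = (\<integral>\<omega>. iexp (a l * e l \<omega>) \<partial>M)"
      unfolding char_def using m[OF that] by (subst integral_distr) auto
    also have "\<dots> = (\<integral>x. iexp (a l * x) \<partial>distr M lborel (e l))"
      using m[OF that] by (subst integral_distr) auto
    also have "\<dots> = char std_normal_distribution (a l)" unfolding d char_def ..
    finally show ?thesis by (simp add: char_std_normal_distribution)
  qed
  have "(\<integral>\<omega>. iexp (\<Sum>l\<in>J. a l * e l \<omega>) \<partial>M) = char (distr M borel (\<lambda>\<omega>. \<Sum>l\<in>J. a l * e l \<omega>)) 1"
    unfolding char_def using m by (subst integral_distr) (auto intro!: borel_measurable_sum)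
  also have "\<dots> = (\<Prod>l\<in>J. complex_of_real (exp (- (a l)\<^sup>2 / 2)))"
    unfolding char_distr_sum[OF iv] by (intro prod.cong refl c)
  also have "\<dots> = complex_of_real (exp (- (\<Sum>l\<in>J. (a l)\<^sup>2) / 2))"
    \<comment> \<open>For infinite \<open>J\<close> sums are 0 and products are 1 by convention, so
      both sides are 1.\<close>
    by (cases "finite J") (simp_all add: of_real_prod[symmetric] exp_sum[symmetric] sum_negf sum_divide_distrib del: of_real_prod)
  finally show ?thesis .
qed

text \<open>Only the exponents 1 and 4 of the supremum are read off. A value below
  \<open>\<mu>\<close> excludes \<open>\<infinity>\<close>, which encodes a non-integrable moment,
  and the factor \<open>inverse p\<close> at \<open>p = 4\<close> is the origin of
  \<open>4 * \<mu>\<close>.\<close>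

lemma psi1_fourth_moment:
  assumes "psi1_norm M Z < ennreal \<mu>"
  shows "integrable M (\<lambda>\<omega>. \<bar>Z \<omega>\<bar>)" "integrable M (\<lambda>\<omega>. Z \<omega> ^ 4)" "expectation (\<lambda>\<omega>. Z \<omega> ^ 4) \<le> (4 * \<mu>) ^ 4"
proof -
  let ?t = "\<lambda>p. if integrable M (\<lambda>\<omega>. \<bar>Z \<omega>\<bar> powr p)
        then ennreal (inverse p * (\<integral>\<omega>. \<bar>Z \<omega>\<bar> powr p \<partial>M) powr (1 / p)) else \<infinity>"
  have t: "?t p < ennreal \<mu>" if "1 \<le> p" for p
    using assms that unfolding psi1_norm_def by (intro le_less_trans[OF SUP_upper[of p "{1..}" ?t]]) auto
  have i: "integrable M (\<lambda>\<omega>. \<bar>Z \<omega>\<bar> powr p)" if "1 \<le> p" for p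
    using t[OF that] by (auto split: if_splits)
  show "integrable M (\<lambda>\<omega>. \<bar>Z \<omega>\<bar>)" using i[of 1] by simp
  have i4: "integrable M (\<lambda>\<omega>. \<bar>Z \<omega>\<bar> powr 4)" by (rule i) simp
  then show I: "integrable M (\<lambda>\<omega>. Z \<omega> ^ 4)" by simp
  have nn: "0 \<le> expectation (\<lambda>\<omega>. Z \<omega> ^ 4)" by (rule integral_nonneg_AE) simp
  have "ennreal (inverse 4 * expectation (\<lambda>\<omega>. Z \<omega> ^ 4) powr (1 / 4)) < ennreal \<mu>"
    using t[of 4] i4 by (simp split: if_splits)
  then have "inverse 4 * expectation (\<lambda>\<omega>. Z \<omega> ^ 4) powr (1 / 4) < \<mu>"
    by (subst (asm) ennreal_less_iff) auto
  then have l: "expectation (\<lambda>\<omega>. Z \<omega> ^ 4) powr (1 / 4) \<le> 4 * \<mu>" by simp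
  have "expectation (\<lambda>\<omega>. Z \<omega> ^ 4) = (expectation (\<lambda>\<omega>. Z \<omega> ^ 4) powr (1 / 4)) ^ 4"
    using nn by (simp add: powr_powr flip: powr_numeral)
  also have "\<dots> \<le> (4 * \<mu>) ^ 4" using l by (intro power_mono) auto
  finally show "expectation (\<lambda>\<omega>. Z \<omega> ^ 4) \<le> (4 * \<mu>) ^ 4" .
qed

end

subsection \<open>Projections of the array\<close>

lemma abs_inner_le_infnorm: "\<bar>t \<bullet> x\<bar> \<le> (\<Sum>j\<in>UNIV. \<bar>t $ j\<bar>) * infnorm x" for t x :: "real ^ 'd"
proof -
  have "\<bar>t \<bullet> x\<bar> \<le> (\<Sum>j\<in>UNIV. \<bar>t $ j * x $ j\<bar>)"
    unfolding inner_vec_def by (simp add: sum_abs)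
  also have "\<dots> \<le> (\<Sum>j\<in>UNIV. \<bar>t $ j\<bar> * infnorm x)"
    unfolding abs_mult by (intro sum_mono mult_left_mono component_le_infnorm_cart) simp
  finally show ?thesis by (simp add: sum_distrib_right)
qed

context prob_space
begin

text \<open>The function of the future is divided by its Lipschitz constant \<open>a\<close> to
  become an admissible test function. As \<open>H\<close> belongs to the past, it can be paired with
  the conditional expectation instead, and the covariance is at most \<open>K\<close> times the mean
  distance measured by the coefficient. One factor \<open>card v\<close> undoes the normalisation in
  the coefficient, the other is part of \<open>a\<close>.\<close>

lemma theta_coeff_covariance:
  fixes Y :: "nat \<Rightarrow> 'a \<Rightarrow> real ^ 'd" and \<psi> :: "real \<Rightarrow> real"
  assumes int: "\<And>i. 1 \<le> i \<Longrightarrow> i \<le> n \<Longrightarrow> integrable M (Y i)"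
    and \<theta>: "theta_coeff M Y n r \<le> ennreal c" "0 \<le> c"
    and lr: "1 \<le> l" "v \<noteq> {}" "v \<subseteq> {l + r..n}"
    and H: "H \<in> borel_measurable (gen_sigma M {1..l} Y)" "\<And>\<omega>. \<omega> \<in> space M \<Longrightarrow> \<bar>H \<omega>\<bar> \<le> K"
    and \<psi>: "0 < L" "\<And>x y. \<bar>\<psi> x - \<psi> y\<bar> \<le> L * \<bar>x - y\<bar>"
  shows "\<bar>expectation (\<lambda>\<omega>. H \<omega> * \<psi> (\<Sum>i\<in>v. t \<bullet> (Y i \<omega> - m)))
      - expectation H * expectation (\<lambda>\<omega>. \<psi> (\<Sum>i\<in>v. t \<bullet> (Y i \<omega> - m)))\<bar>
    \<le> ((\<Sum>j\<in>UNIV. \<bar>t $ j\<bar>) + 1) * c * K * L * (real (card v))\<^sup>2"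
proof -
  have fin: "finite v" using lr finite_subset by blast
  have vn: "1 \<le> i \<and> i \<le> n" if "i \<in> v" for i using that lr by auto
  have Ym [measurable]: "Y i \<in> borel_measurable M" if "1 \<le> i" "i \<le> n" for i using int[OF that] by simp
  have ln: "l \<le> n" "l \<in> {1..n - r}" using lr by fastforce+
  define G where "G = gen_sigma M {1..l} Y"
  have sub: "subalgebra M G" unfolding G_def using ln by (intro subalgebra_gen_sigma) auto
  interpret S: finite_measure_subalgebra M G by unfold_locales (rule sub)
  have HG: "H \<in> borel_measurable G" using H(1) by (simp add: G_def)
  have Hm [measurable]: "H \<in> borel_measurable M" using measurable_from_subalg[OF sub HG] .
  \<comment> \<open>The added 1 keeps the divisor \<open>a\<close> positive when
    \<open>t = 0\<close>.\<close>
  define T where "T = (\<Sum>j\<in>UNIV. \<bar>t $ j\<bar>) + 1"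
  have T: "1 \<le> T" by (simp add: T_def sum_nonneg)
  define \<kappa> where "\<kappa> = real (card v)"
  have \<kappa>: "1 \<le> \<kappa>" unfolding \<kappa>_def using fin lr(2) by (simp add: card_gt_0_iff Suc_le_eq One_nat_def)
  define Z where "Z \<omega> = (\<Sum>i\<in>v. t \<bullet> (Y i \<omega> - m))" for \<omega>
  have iZ: "integrable M Z"
    unfolding Z_def[abs_def] using int vn by (intro Bochner_Integration.integrable_sum integrable_inner_right) auto
  have Zm [measurable]: "Z \<in> borel_measurable M" using iZ by simp
  have \<psi>m [measurable]: "\<psi> \<in> borel_measurable borel"
  proof (rule borel_measurable_continuous_onI)
    have "L-lipschitz_on UNIV \<psi>" using \<psi> by (intro lipschitz_onI) (auto simp: dist_real_def)
    then show "continuous_on UNIV \<psi>" by (rule lipschitz_on_continuous_on)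
  qed
  \<comment> \<open>A sup-norm displacement of size \<open>\<delta>\<close> changes each inner
    product by at most \<open>T * \<delta>\<close>, their sum by \<open>\<kappa>\<close> times that,
    and the value of \<open>\<psi>\<close> by a further factor \<open>L\<close>.\<close>
  define a where "a = L * \<kappa> * T"
  have a: "0 < a" using \<psi>(1) \<kappa> T by (simp add: a_def)
  define g where "g x = \<psi> (\<Sum>i\<in>v. t \<bullet> (x i - m)) / a" for x :: "nat \<Rightarrow> real ^ 'd"
  have g: "g \<in> lipschitz1_sup v"
    unfolding lipschitz1_sup_def
  proof (intro CollectI ballI)
    fix x y :: "nat \<Rightarrow> real ^ 'd"
    let ?m = "Max ((\<lambda>j. infnorm (x j - y j)) ` v)"
    have "\<bar>g x - g y\<bar> = \<bar>\<psi> (\<Sum>i\<in>v. t \<bullet> (x i - m)) - \<psi> (\<Sum>i\<in>v. t \<bullet> (y i - m))\<bar> / a"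
      using a by (simp add: g_def diff_divide_distrib[symmetric])
    also have "\<dots> \<le> L * \<bar>(\<Sum>i\<in>v. t \<bullet> (x i - m)) - (\<Sum>i\<in>v. t \<bullet> (y i - m))\<bar> / a"
      using a by (intro divide_right_mono \<psi>(2)) auto
    also have "(\<Sum>i\<in>v. t \<bullet> (x i - m)) - (\<Sum>i\<in>v. t \<bullet> (y i - m)) = (\<Sum>i\<in>v. t \<bullet> (x i - y i))"
      by (simp add: sum_subtractf[symmetric] inner_diff_right)
    also have "\<bar>\<dots>\<bar> \<le> (\<Sum>i\<in>v. T * ?m)"
    proof (intro order_trans[OF sum_abs] sum_mono)
      fix i assume "i \<in> v"
      have "\<bar>t \<bullet> (x i - y i)\<bar> \<le> (T - 1) * infnorm (x i - y i)"
        using abs_inner_le_infnorm[of t "x i - y i"] by (simp add: T_def)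
      also have "\<dots> \<le> T * ?m"
        using \<open>i \<in> v\<close> fin T by (intro mult_mono Max_ge) (auto simp: infnorm_pos_le)
      finally show "\<bar>t \<bullet> (x i - y i)\<bar> \<le> T * ?m" .
    qed
    also have "L * (\<Sum>i\<in>v. T * ?m) / a = ?m"
      using a \<kappa> T \<psi>(1) by (simp add: a_def \<kappa>_def[symmetric])
    finally show "\<bar>g x - g y\<bar> \<le> ?m" using \<psi>(1) a by (simp add: divide_right_mono)
  qed
  have gY: "g (\<lambda>j\<in>v. Y j \<omega>) = \<psi> (Z \<omega>) / a" for \<omega>
    by (simp add: g_def Z_def)
  define h where "h \<omega> = \<psi> (Z \<omega>) / a" for \<omega>
  have hm [measurable]: "h \<in> borel_measurable M" unfolding h_def[abs_def] by measurable
  have ih: "integrable M h"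
  proof -
    have "integrable M (\<lambda>\<omega>. \<psi> (Z \<omega>))"
    proof (rule Bochner_Integration.integrable_bound)
      show "integrable M (\<lambda>\<omega>. \<bar>\<psi> 0\<bar> + L * \<bar>Z \<omega>\<bar>)" using iZ by simp
      have "\<bar>\<psi> x\<bar> \<le> \<bar>\<psi> 0\<bar> + L * \<bar>x\<bar>" for x using \<psi>(2)[of x 0] by simp
      then show "AE \<omega> in M. norm (\<psi> (Z \<omega>)) \<le> norm (\<bar>\<psi> 0\<bar> + L * \<bar>Z \<omega>\<bar>)"
        by (intro AE_I2) (auto intro: order_trans[OF _ abs_ge_self])
    qed measurable
    then show ?thesis unfolding h_def[abs_def] by simp
  qed
  define C where "C = real_cond_exp M G h"
  have Cm [measurable]: "C \<in> borel_measurable M" unfolding C_def by simp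
  have iC: "integrable M C" unfolding C_def by (rule S.real_cond_exp_int(1)[OF ih])
  have iH: "integrable M H" using H(2) by (intro integrable_const_bound[where B = K]) auto
  have mulH: "integrable M (\<lambda>\<omega>. H \<omega> * u \<omega>)" if u: "integrable M u" for u :: "'a \<Rightarrow> real"
  proof (rule Bochner_Integration.integrable_bound[OF integrable_mult_right[OF u, of K]])
    show "AE \<omega> in M. norm (H \<omega> * u \<omega>) \<le> norm (K * u \<omega>)"
    proof (rule AE_I2)
      fix \<omega> assume "\<omega> \<in> space M"
      then have "\<bar>H \<omega>\<bar> \<le> \<bar>K\<bar>" using H(2)[of \<omega>] by linarith
      then show "norm (H \<omega> * u \<omega>) \<le> norm (K * u \<omega>)" by (simp add: abs_mult mult_right_mono)
    qed
  qed (use u in measurable)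
  have L1: "expectation (\<lambda>\<omega>. \<bar>C \<omega> - expectation h\<bar>) \<le> \<kappa> * c"
  proof -
    let ?I = "\<lambda>g. \<integral>\<^sup>+\<omega>. ennreal \<bar>real_cond_exp M (gen_sigma M {1..l} Y) (\<lambda>\<omega>'. g (\<lambda>j\<in>v. Y j \<omega>')) \<omega>
                          - (\<integral>\<omega>'. g (\<lambda>j\<in>v. Y j \<omega>') \<partial>M)\<bar> \<partial>M"
    have "?I g / of_nat (card v) \<le> (SUP g\<in>lipschitz1_sup v. ?I g) / of_nat (card v)"
      by (intro divide_right_mono_ennreal SUP_upper g)
    also have "\<dots> \<le> theta_coeff M Y n r"
      unfolding theta_coeff_def
      by (rule SUP_upper2[OF ln(2)], rule SUP_upper2[of v]) (use lr in auto)
    finally have "?I g / of_nat (card v) \<le> ennreal c" using \<theta>(1) by (rule order_trans)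
    also have "?I g = ennreal (expectation (\<lambda>\<omega>. \<bar>C \<omega> - expectation h\<bar>))"
      unfolding gY h_def[symmetric] G_def[symmetric] C_def[symmetric]
      using iC by (intro nn_integral_eq_integral) auto
    finally have "ennreal (expectation (\<lambda>\<omega>. \<bar>C \<omega> - expectation h\<bar>) / \<kappa>) \<le> ennreal c"
      using \<kappa> unfolding \<kappa>_def by (subst (asm) ennreal_of_nat_eq_real_of_nat) (simp add: divide_ennreal)
    then have "expectation (\<lambda>\<omega>. \<bar>C \<omega> - expectation h\<bar>) / \<kappa> \<le> c" using \<theta>(2) by (simp add: ennreal_le_iff)
    then show ?thesis using \<kappa> by (simp add: field_simps)
  qed
  have "expectation (\<lambda>\<omega>. H \<omega> * h \<omega>) = expectation (\<lambda>\<omega>. H \<omega> * C \<omega>)"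
    unfolding C_def by (rule S.real_cond_exp_intg(2)[symmetric, OF mulH[OF ih] HG hm])
  then have "expectation (\<lambda>\<omega>. H \<omega> * h \<omega>) - expectation H * expectation h
      = expectation (\<lambda>\<omega>. H \<omega> * (C \<omega> - expectation h))"
    using mulH[OF iC] iH by (simp add: right_diff_distrib)
  also have "\<bar>\<dots>\<bar> \<le> expectation (\<lambda>\<omega>. \<bar>H \<omega> * (C \<omega> - expectation h)\<bar>)" by (rule integral_abs_bound)
  also have "\<dots> \<le> expectation (\<lambda>\<omega>. K * \<bar>C \<omega> - expectation h\<bar>)"
  proof (rule integral_mono)
    show "integrable M (\<lambda>\<omega>. \<bar>H \<omega> * (C \<omega> - expectation h)\<bar>)" using iC by (intro integrable_abs mulH) auto
    show "integrable M (\<lambda>\<omega>. K * \<bar>C \<omega> - expectation h\<bar>)" using iC by auto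
  qed (use H(2) in \<open>auto simp: abs_mult intro!: mult_right_mono\<close>)
  also have "\<dots> \<le> K * (\<kappa> * c)"
  proof -
    \<comment> \<open>\<open>K\<close> is nonnegative because it bounds
      \<open>\<bar>H \<omega>\<bar>\<close> at some point; a probability space has one.\<close>
    obtain \<omega> where "\<omega> \<in> space M" using not_empty by blast
    then have "0 \<le> K" using H(2)[of \<omega>] by linarith
    then show ?thesis using L1 by (simp add: mult_left_mono)
  qed
  finally have "a * \<bar>expectation (\<lambda>\<omega>. H \<omega> * h \<omega>) - expectation H * expectation h\<bar> \<le> a * (K * (\<kappa> * c))"
    using a by (intro mult_left_mono) auto
  also have "a * \<bar>expectation (\<lambda>\<omega>. H \<omega> * h \<omega>) - expectation H * expectation h\<bar>
      = \<bar>expectation (\<lambda>\<omega>. H \<omega> * \<psi> (Z \<omega>)) - expectation H * expectation (\<lambda>\<omega>. \<psi> (Z \<omega>))\<bar>"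
    using a by (simp add: h_def[abs_def] diff_divide_distrib[symmetric] abs_divide)
  also have "a * (K * (\<kappa> * c)) = T * c * K * L * \<kappa>\<^sup>2" by (simp add: a_def power2_eq_square)
  finally show ?thesis unfolding Z_def T_def \<kappa>_def .
qed

text \<open>The filtration stops at \<open>n\<close> because nothing is known about \<open>Y i\<close> for \<open>i > n\<close>.\<close>

lemma projection_weakly_dependent:
  fixes Y :: "nat \<Rightarrow> 'a \<Rightarrow> real ^ 'd"
  assumes meas: "\<And>i. 1 \<le> i \<Longrightarrow> i \<le> n \<Longrightarrow> Y i \<in> borel_measurable M"
    and mean: "\<And>i. 1 \<le> i \<Longrightarrow> i \<le> n \<Longrightarrow> expectation (Y i) = m"
    and psi: "\<And>i j. 1 \<le> i \<Longrightarrow> i \<le> n \<Longrightarrow> psi1_norm M (\<lambda>\<omega>. Y i \<omega> $ j - expectation (\<lambda>\<omega>. Y i \<omega> $ j)) < ennreal \<mu>"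
    and theta: "\<And>r. 1 \<le> r \<Longrightarrow> theta_coeff M Y n r \<le> ennreal (C * real r powr - \<theta>)" "4 \<le> \<theta>"
  shows "weakly_dependent M (\<lambda>l. gen_sigma M {1..min l n} Y) (\<lambda>i \<omega>. t \<bullet> (Y i \<omega> - m)) n
      (real CARD('d) ^ 3 * (\<Sum>j\<in>UNIV. (t $ j) ^ 4 * (4 * \<mu>) ^ 4)) (((\<Sum>j\<in>UNIV. \<bar>t $ j\<bar>) + 1) * \<bar>C\<bar>)"
    and "\<And>i. 1 \<le> i \<Longrightarrow> i \<le> n \<Longrightarrow> integrable M (Y i)"
proof -
  have cm: "(\<lambda>\<omega>. Y i \<omega> $ j) \<in> borel_measurable M" if "1 \<le> i" "i \<le> n" for i j
    using borel_measurable_inner[OF meas[OF that] measurable_const, of "axis j 1"] by (simp add: inner_axis)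
  show int: "integrable M (Y i)" if i: "1 \<le> i" "i \<le> n" for i
  proof (rule Bochner_Integration.integrable_bound)
    have "integrable M (\<lambda>\<omega>. Y i \<omega> $ j)" for j
    proof -
      \<comment> \<open>Integrability of the component is not yet known, so the subtracted integral
        could be the default value 0. Adding back whatever constant it is preserves
        integrability.\<close>
      have "integrable M (\<lambda>\<omega>. \<bar>Y i \<omega> $ j - expectation (\<lambda>\<omega>. Y i \<omega> $ j)\<bar>)"
        by (rule psi1_fourth_moment(1)[OF psi[OF i]])
      then have "integrable M (\<lambda>\<omega>. Y i \<omega> $ j - expectation (\<lambda>\<omega>. Y i \<omega> $ j))"
        using cm[OF i] by (subst (asm) integrable_abs_iff) auto
      from Bochner_Integration.integrable_add[OF this integrable_const[of "expectation (\<lambda>\<omega>. Y i \<omega> $ j)"]]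
      show ?thesis by simp
    qed
    then show "integrable M (\<lambda>\<omega>. \<Sum>j\<in>UNIV. \<bar>Y i \<omega> $ j\<bar>)" by simp
    show "AE \<omega> in M. norm (Y i \<omega>) \<le> norm (\<Sum>j\<in>UNIV. \<bar>Y i \<omega> $ j\<bar>)"
      by (intro AE_I2) (simp add: norm_le_l1_cart order_trans[OF norm_le_l1_cart abs_ge_self])
  qed (use meas i in auto)
  have comp: "expectation (\<lambda>\<omega>. Y i \<omega> $ j) = m $ j" if "1 \<le> i" "i \<le> n" for i j
    using integral_inner_left[OF int[OF that], of "axis j 1"] mean[OF that] by (simp add: inner_axis)
  have fourth: "integrable M (\<lambda>\<omega>. (Y i \<omega> $ j - m $ j) ^ 4)" "expectation (\<lambda>\<omega>. (Y i \<omega> $ j - m $ j) ^ 4) \<le> (4 * \<mu>) ^ 4"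
    if "1 \<le> i" "i \<le> n" for i j
    using psi1_fourth_moment(2,3)[OF psi[OF that]] unfolding comp[OF that] by auto
  let ?X = "\<lambda>i \<omega>. t \<bullet> (Y i \<omega> - m)"
  have Xm [measurable]: "?X i \<in> borel_measurable M" if "1 \<le> i" "i \<le> n" for i using meas[OF that] by measurable
  \<comment> \<open>Here \<open>sum_fourth_le\<close> over the coordinates introduces the factor
    \<open>CARD('d) ^ 3\<close>.\<close>
  have bound: "(?X i \<omega>) ^ 4 \<le> real CARD('d) ^ 3 * (\<Sum>j\<in>UNIV. (t $ j) ^ 4 * (Y i \<omega> $ j - m $ j) ^ 4)" for i \<omega>
    unfolding inner_vec_def using sum_fourth_le[of "\<lambda>j. t $ j * (Y i \<omega> $ j - m $ j)" UNIV] by (simp add: power_mult_distrib)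
  have bi: "integrable M (\<lambda>\<omega>. real CARD('d) ^ 3 * (\<Sum>j\<in>UNIV. (t $ j) ^ 4 * (Y i \<omega> $ j - m $ j) ^ 4))" if "1 \<le> i" "i \<le> n" for i
    using fourth(1)[OF that] by (intro integrable_mult_right Bochner_Integration.integrable_sum) auto
  have X4: "integrable M (\<lambda>\<omega>. (?X i \<omega>) ^ 4)" if i: "1 \<le> i" "i \<le> n" for i
    by (rule Bochner_Integration.integrable_bound[OF bi[OF i]])
       (use Xm[OF i] bound in \<open>auto intro!: AE_I2 intro: order_trans[OF _ abs_ge_self]\<close>)
  show "weakly_dependent M (\<lambda>l. gen_sigma M {1..min l n} Y) ?X n
      (real CARD('d) ^ 3 * (\<Sum>j\<in>UNIV. (t $ j) ^ 4 * (4 * \<mu>) ^ 4)) (((\<Sum>j\<in>UNIV. \<bar>t $ j\<bar>) + 1) * \<bar>C\<bar>)"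
  proof
    show "subalgebra M (gen_sigma M {1..min i n} Y)" for i
      using meas by (intro subalgebra_gen_sigma) auto
    show "sets (gen_sigma M {1..min i n} Y) \<subseteq> sets (gen_sigma M {1..min j n} Y)" if "i \<le> j" for i j
      using that by (intro gen_sigma_mono) auto
    show "?X i \<in> borel_measurable (gen_sigma M {1..min i n} Y)" if "i \<in> {1..n}" for i
    proof -
      have "Y i \<in> borel_measurable (gen_sigma M {1..min i n} Y)" using that by (intro gen_sigma_measurable) auto
      then show ?thesis by measurable
    qed
    show "integrable M (\<lambda>\<omega>. (?X i \<omega>) ^ 4)" if "i \<in> {1..n}" for i using that by (intro X4) auto
    show "expectation (\<lambda>\<omega>. (?X i \<omega>) ^ 4) \<le> real CARD('d) ^ 3 * (\<Sum>j\<in>UNIV. (t $ j) ^ 4 * (4 * \<mu>) ^ 4)" if "i \<in> {1..n}" for i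
    proof -
      have i: "1 \<le> i" "i \<le> n" using that by auto
      have "expectation (\<lambda>\<omega>. (?X i \<omega>) ^ 4) \<le> expectation (\<lambda>\<omega>. real CARD('d) ^ 3 * (\<Sum>j\<in>UNIV. (t $ j) ^ 4 * (Y i \<omega> $ j - m $ j) ^ 4))"
        by (intro integral_mono X4 bi bound i)
      also have "\<dots> = real CARD('d) ^ 3 * (\<Sum>j\<in>UNIV. (t $ j) ^ 4 * expectation (\<lambda>\<omega>. (Y i \<omega> $ j - m $ j) ^ 4))"
        using fourth(1)[OF i] by (simp add: Bochner_Integration.integral_sum)
      also have "\<dots> \<le> real CARD('d) ^ 3 * (\<Sum>j\<in>UNIV. (t $ j) ^ 4 * (4 * \<mu>) ^ 4)"
        using fourth(2)[OF i] by (intro mult_left_mono sum_mono) auto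
      finally show ?thesis .
    qed
    show "expectation (?X i) = 0" if "i \<in> {1..n}" for i
    proof -
      have i: "1 \<le> i" "i \<le> n" using that by auto
      have "expectation (?X i) = t \<bullet> expectation (\<lambda>\<omega>. Y i \<omega> - m)"
        using int[OF i] by (intro integral_inner_right) simp
      also have "expectation (\<lambda>\<omega>. Y i \<omega> - m) = 0" using int[OF i] mean[OF i] by (simp add: prob_space)
      finally show ?thesis by simp
    qed
    show "0 \<le> real CARD('d) ^ 3 * (\<Sum>j\<in>UNIV. (t $ j) ^ 4 * (4 * \<mu>) ^ 4)"
      by (intro mult_nonneg_nonneg sum_nonneg) auto
    show "0 \<le> ((\<Sum>j\<in>UNIV. \<bar>t $ j\<bar>) + 1) * \<bar>C\<bar>"
      by (intro mult_nonneg_nonneg add_nonneg_nonneg sum_nonneg) auto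
    fix l r v H \<psi> and K L :: real
    assume h: "1 \<le> l" "1 \<le> r" "v \<noteq> {}" "v \<subseteq> {l + r..n}" "H \<in> borel_measurable (gen_sigma M {1..min l n} Y)"
      "\<And>\<omega>. \<omega> \<in> space M \<Longrightarrow> \<bar>H \<omega>\<bar> \<le> K" "0 < L" "\<And>x y. \<bar>\<psi> x - \<psi> y\<bar> \<le> L * \<bar>x - y\<bar>"
    have "l \<le> n" using h(3,4) by fastforce
    then have HG: "H \<in> borel_measurable (gen_sigma M {1..l} Y)" using h(5) by (simp add: min_def)
    \<comment> \<open>The constant of the assumption may be negative, hence the absolute value; the
      exponent is weakened to 4, which is allowed for \<open>r \<ge> 1\<close>.\<close>
    have "C * real r powr - \<theta> \<le> \<bar>C\<bar> * real r powr - 4"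
      using h(2) theta(2) by (intro mult_mono powr_mono) auto
    also have "\<dots> = \<bar>C\<bar> / real r ^ 4"
      using h(2) by (simp add: powr_minus divide_inverse)
    finally have th: "theta_coeff M Y n r \<le> ennreal (\<bar>C\<bar> / real r ^ 4)"
      using theta(1)[OF h(2)] by (meson ennreal_leI order_trans)
    show "\<bar>expectation (\<lambda>\<omega>. H \<omega> * \<psi> (\<Sum>i\<in>v. ?X i \<omega>)) - expectation H * expectation (\<lambda>\<omega>. \<psi> (\<Sum>i\<in>v. ?X i \<omega>))\<bar>
      \<le> ((\<Sum>j\<in>UNIV. \<bar>t $ j\<bar>) + 1) * \<bar>C\<bar> * K * L * (real (card v))\<^sup>2 / real r ^ 4"
      using theta_coeff_covariance[OF int th _ h(1,3,4) HG h(6,7,8), of t m] by simp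
  qed
qed

end

section \<open>The multiplier sum and the assembled limit theorem\<close>

lemma block_subset: "l \<in> {1..n div b} \<Longrightarrow> block b l \<subseteq> {1..n}"
proof -
  assume l: "l \<in> {1..n div b}"
  then have "l * b \<le> n" by (intro order_trans[OF mult_le_mono1[of l "n div b" b] div_times_less_eq_dividend]) simp
  then show ?thesis by (auto simp: block_def)
qed

text \<open>Allows one and the same sum to be evaluated on different spaces. Values of
  \<open>Y\<close> outside \<open>{1..n}\<close> and the multiplier \<open>e 0\<close> never enter,
  so restricted functions may be substituted.\<close>

lemma multiplier_sum_cong:
  assumes "\<And>i. i \<in> {1..n} \<Longrightarrow> Y i \<omega> = Y' i \<omega>'" "\<And>l. 1 \<le> l \<Longrightarrow> e l \<omega> = e' l \<omega>'"
  shows "multiplier_sum Y e n b \<omega> = multiplier_sum Y' e' n b \<omega>'"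
proof -
  have "sample_mean Y n \<omega> = sample_mean Y' n \<omega>'"
    unfolding sample_mean_def using assms(1) by simp
  then have "block_sum Y n b l \<omega> = block_sum Y' n b l \<omega>'" if "l \<in> {1..n div b}" for l
    unfolding block_sum_def using block_subset[OF that] assms(1) by (intro sum.cong) auto
  then show ?thesis unfolding multiplier_sum_def using assms(2) by (auto intro!: arg_cong2[where f = scaleR] sum.cong)
qed

lemma multiplier_sum_measurable:
  assumes Y: "\<And>i. i \<in> {1..n} \<Longrightarrow> Y i \<in> borel_measurable N" and e: "\<And>l. 1 \<le> l \<Longrightarrow> e l \<in> borel_measurable N"
  shows "multiplier_sum Y e n b \<in> borel_measurable N"
proof -
  have [measurable]: "sample_mean Y n \<in> borel_measurable N"
    unfolding sample_mean_def[abs_def] by (intro borel_measurable_scaleR borel_measurable_const borel_measurable_sum Y)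
  have "block_sum Y n b l \<in> borel_measurable N" if "l \<in> {1..n div b}" for l
    unfolding block_sum_def[abs_def] using block_subset[OF that]
    by (intro borel_measurable_sum borel_measurable_diff Y) auto
  then show ?thesis
    unfolding multiplier_sum_def[abs_def]
    by (intro borel_measurable_scaleR borel_measurable_const borel_measurable_sum e) auto
qed

text \<open>A shift by a common \<open>m\<close> cancels against the sample mean. With
  \<open>m\<close> the constant mean of the row, centring at the sample mean turns into subtracting
  the share \<open>b / n\<close> of the total of the centred projections. \<open>Suc j\<close>
  reconciles blocks counted from 1 with a summation over \<open>j\<close> from 0.\<close>

lemma inner_block_sum:
  assumes n: "1 \<le> n"
  shows "t \<bullet> block_sum Y n b (Suc j) \<omega> = (\<Sum>i=j * b + 1..j * b + b. t \<bullet> (Y i \<omega> - m))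
    - real b / real n * (\<Sum>i=1..n. t \<bullet> (Y i \<omega> - m))"
proof -
  have blk: "block b (Suc j) = {j * b + 1..j * b + b}" by (auto simp: block_def)
  have "t \<bullet> (sample_mean Y n \<omega> - m) = (\<Sum>i=1..n. t \<bullet> (Y i \<omega> - m)) / real n"
    using n by (simp add: sample_mean_def inner_diff_right inner_sum_right sum_subtractf field_simps)
  then have "t \<bullet> (Y i \<omega> - sample_mean Y n \<omega>) = t \<bullet> (Y i \<omega> - m) - (\<Sum>i=1..n. t \<bullet> (Y i \<omega> - m)) / real n" for i
    by (simp add: inner_diff_right)
  then show ?thesis
    unfolding block_sum_def blk inner_sum_right by (simp add: sum_subtractf)
qed

theorem theorem4:
  fixes M :: "'a measure"
    and Y :: "nat \<Rightarrow> nat \<Rightarrow> 'a \<Rightarrow> real ^ 'd"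
    and e :: "nat \<Rightarrow> 'a \<Rightarrow> real"
    and b :: "nat \<Rightarrow> nat"
    and \<mu> \<theta> :: real
    and f :: "real ^ 'd \<Rightarrow> real"
  assumes "prob_space M"
    and "\<And>n i. 1 \<le> i \<Longrightarrow> i \<le> n \<Longrightarrow> Y n i \<in> borel_measurable M"
    and "\<And>n i k. 1 \<le> i \<Longrightarrow> i \<le> n \<Longrightarrow> 1 \<le> k \<Longrightarrow> k \<le> n \<Longrightarrow>
           (\<integral>\<omega>. Y n i \<omega> \<partial>M) = (\<integral>\<omega>. Y n k \<omega> \<partial>M)"
    and "(SUP (n, i)\<in>{(n, i). 1 \<le> i \<and> i \<le> n}. SUP j.
            psi1_norm M (\<lambda>\<omega>. Y n i \<omega> $ j - (\<integral>\<omega>'. Y n i \<omega>' $ j \<partial>M))) < ennreal \<mu>"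
    and "\<theta> > 4"
    and "\<exists>C. \<forall>n\<ge>1. \<forall>r\<ge>1. theta_coeff M (Y n) n r \<le> ennreal (C * real r powr - \<theta>)"
    and "filterlim b at_top sequentially"
    and "(\<lambda>n. real (b n)) \<in> o(\<lambda>n. real n)"
    and "prob_space.indep_vars M (\<lambda>_. borel) e {1..}"
    and "\<And>l. 1 \<le> l \<Longrightarrow> distributed M lborel (e l) std_normal_density"
    and "prob_space.indep_set M
           (sets (gen_sigma M {1..} e))
           (sets (gen_sigma M {(n, i). 1 \<le> i \<and> i \<le> n} (\<lambda>(n, i). Y n i)))"
    and "continuous_on UNIV f"
    and "bounded (range f)"
  shows "converges_in_prob M
           (\<lambda>n \<omega>. real_cond_exp M (gen_sigma M {1..n} (Y n))
                    (\<lambda>\<omega>'. f (multiplier_sum (Y n) e n (b n) \<omega>')) \<omega>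
                - (\<integral>\<omega>'. f (centered_sum M (Y n) n \<omega>') \<partial>M))
           0"
proof -
  interpret prob_space M by fact
  note Ym = assms(2) and mean = assms(3) and b_top = assms(7) and gauss = assms(10) and f_cont = assms(12)
  have ind_e: "indep_vars (\<lambda>_. borel) e {1..}" by fact
  have em [measurable]: "e l \<in> borel_measurable M" if "1 \<le> l" for l
    using distributed_measurable[OF gauss[OF that]] by simp
  have fm [measurable]: "f \<in> borel_measurable borel" using f_cont by (rule borel_measurable_continuous_onI)
  obtain B where B: "\<And>x. \<bar>f x\<bar> \<le> B" using assms(13) unfolding bounded_iff by auto
  obtain C where C: "\<And>n r. 1 \<le> n \<Longrightarrow> 1 \<le> r \<Longrightarrow> theta_coeff M (Y n) n r \<le> ennreal (C * real r powr - \<theta>)"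
    using assms(6) by blast
  define m where "m n = expectation (Y n 1)" for n
  have m: "expectation (Y n i) = m n" if "1 \<le> i" "i \<le> n" for n i
    unfolding m_def using that by (intro mean) auto
  have psi: "psi1_norm M (\<lambda>\<omega>. Y n i \<omega> $ j - expectation (\<lambda>\<omega>. Y n i \<omega> $ j)) < ennreal \<mu>" if "1 \<le> i" "i \<le> n" for n i j
  proof (rule le_less_trans[OF _ assms(4)])
    show "psi1_norm M (\<lambda>\<omega>. Y n i \<omega> $ j - expectation (\<lambda>\<omega>. Y n i \<omega> $ j))
      \<le> (SUP (n, i)\<in>{(n, i). 1 \<le> i \<and> i \<le> n}. SUP j.
            psi1_norm M (\<lambda>\<omega>. Y n i \<omega> $ j - (\<integral>\<omega>'. Y n i \<omega>' $ j \<partial>M)))"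
      by (rule SUP_upper2[of "(n, i)"]) (use that in \<open>auto intro: SUP_upper\<close>)
  qed
  define A :: "real ^ 'd \<Rightarrow> real" where "A t = real CARD('d) ^ 3 * (\<Sum>j\<in>UNIV. (t $ j) ^ 4 * (4 * \<mu>) ^ 4)" for t
  define C' :: "real ^ 'd \<Rightarrow> real" where "C' t = ((\<Sum>j\<in>UNIV. \<bar>t $ j\<bar>) + 1) * \<bar>C\<bar>" for t
  define X where "X t n i \<omega> = t \<bullet> (Y n i \<omega> - m n)" for t n i \<omega>
  have wd: "weakly_dependent M (\<lambda>l. gen_sigma M {1..min l n} (Y n)) (X t n) n (A t) (C' t)" if "1 \<le> n" for t n
    unfolding X_def[abs_def] A_def C'_def
    by (rule projection_weakly_dependent(1)[OF Ym m psi C[OF that]]) (use assms(5) in simp_all)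
  have bn: "(\<lambda>n. real (b n) / real n) \<longlonglongrightarrow> 0" using smalloD_tendsto[OF assms(8)] .

  \<comment> \<open>The multiplier sum on two copies of \<open>M\<close>: the data are read from the
    first coordinate and the multipliers from the second. Its link with the conditional expectation
    is established in \<open>cond\<close>.\<close>
  define W where "W n \<omega> \<omega>' = multiplier_sum (\<lambda>i p. Y n i (fst p)) (\<lambda>l p. e l (snd p)) n (b n) (\<omega>, \<omega>')" for n \<omega> \<omega>'
  define S where "S n = centered_sum M (Y n) n" for n
  define T where "T t n \<omega> = (\<Sum>i=1..n. X t n i \<omega>)" for t n \<omega>
  \<comment> \<open>The variance of \<open>t \<bullet> W n \<omega>\<close> for frozen data, written
    as a sum of squared coefficients of the multipliers.\<close>
  define v where "v t n \<omega> = (\<Sum>l=1..n div b n. (t \<bullet> block_sum (Y n) n (b n) l \<omega> / sqrt (real n))\<^sup>2)" for t n \<omega>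
  have Wm: "case_prod (W n) \<in> borel_measurable (M \<Otimes>\<^sub>M M)" for n
  proof -
    have "multiplier_sum (\<lambda>i p. Y n i (fst p)) (\<lambda>l p. e l (snd p)) n (b n) \<in> borel_measurable (M \<Otimes>\<^sub>M M)"
      by (rule multiplier_sum_measurable) (use Ym in \<open>auto intro!: measurable_compose[OF measurable_fst] measurable_compose[OF measurable_snd] em\<close>)
    then show ?thesis by (simp add: W_def split_beta')
  qed
  have Sm: "S n \<in> borel_measurable M" for n
    unfolding S_def centered_sum_def[abs_def]
    by (intro borel_measurable_scaleR borel_measurable_const borel_measurable_sum borel_measurable_diff Ym) auto
  have tS: "t \<bullet> S n \<omega> = 1 / sqrt (real n) * T t n \<omega>" for t n \<omega>
    by (simp add: S_def centered_sum_def T_def X_def inner_sum_right m)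
  have charW: "(\<integral>\<omega>'. iexp (t \<bullet> W n \<omega> \<omega>') \<partial>M) = complex_of_real (exp (- v t n \<omega> / 2))" for t n \<omega>
  proof -
    have "block_sum (\<lambda>i p. Y n i (fst p)) n (b n) l (\<omega>, \<omega>') = block_sum (Y n) n (b n) l \<omega>" for l and \<omega>' :: 'a
      by (simp add: block_sum_def sample_mean_def)
    then have "t \<bullet> W n \<omega> \<omega>' = (\<Sum>l=1..n div b n. (t \<bullet> block_sum (Y n) n (b n) l \<omega> / sqrt (real n)) * e l \<omega>')" for \<omega>'
      by (simp add: W_def multiplier_sum_def inner_sum_right sum_distrib_left mult_ac)
    then show ?thesis
      unfolding v_def
      by (simp only:) (rule char_gaussian_combination[OF ind_e _ gauss], auto)
  qed
  have v_eq: "v t n \<omega> = (\<Sum>j<n div b n. ((\<Sum>i=j * b n + 1..j * b n + b n. X t n i \<omega>)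
        - real (b n) / real n * (\<Sum>i=1..n. X t n i \<omega>))\<^sup>2) / real n" if "1 \<le> n" for t n \<omega>
  proof -
    have "v t n \<omega> = (\<Sum>j<n div b n. (t \<bullet> block_sum (Y n) n (b n) (Suc j) \<omega> / sqrt (real n))\<^sup>2)"
      unfolding v_def by (simp add: sum.atLeast1_atMost_eq One_nat_def)
    then show ?thesis
      unfolding inner_block_sum[OF that, where m = "m n"] X_def by (simp add: power_divide sum_divide_distrib)
  qed

  have char: "(\<lambda>n. \<integral>\<omega>. cmod ((\<integral>\<omega>'. iexp (t \<bullet> W n \<omega> \<omega>') \<partial>M) - (\<integral>\<omega>. iexp (t \<bullet> S n \<omega>) \<partial>M)) \<partial>M) \<longlonglongrightarrow> 0" (is "?L \<longlonglongrightarrow> 0") for t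
  proof -
    \<comment> \<open>Frequency 1 suffices, since \<open>t\<close> is built into \<open>X t\<close>
      and affects only the constants \<open>A t\<close> and \<open>C' t\<close>.\<close>
    obtain err :: "nat \<Rightarrow> real" where err: "err \<longlonglongrightarrow> 0"
      and clt: "\<And>(M :: 'a measure) F X N. weakly_dependent M F X N (A t) (C' t) \<Longrightarrow> 1 \<le> N \<Longrightarrow>
      cmod ((\<integral>\<omega>. iexp (1 / sqrt (real N) * (\<Sum>i=1..N. X i \<omega>)) \<partial>M)
        - exp (- (1\<^sup>2 * (\<integral>\<omega>. (\<Sum>i=1..N. X i \<omega>)\<^sup>2 \<partial>M) / (2 * real N)))) \<le> err N"
      using weakly_dependent_clt[of 1 "A t" "C' t"] by auto
    define \<sigma> where "\<sigma> n = expectation (\<lambda>\<omega>. (T t n \<omega>)\<^sup>2) / real n" for n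
    have \<sigma>0: "0 \<le> \<sigma> n" for n by (simp add: \<sigma>_def)
    have v0: "0 \<le> v t n \<omega>" for n \<omega> unfolding v_def by (rule sum_nonneg) simp
    have lim: "(\<lambda>n. expectation (\<lambda>\<omega>. \<bar>v t n \<omega> - \<sigma> n\<bar>)) \<longlonglongrightarrow> 0"
    proof (rule Lim_transform_eventually)
      show "(\<lambda>n. \<integral>\<omega>. \<bar>(\<Sum>j<n div b n. ((\<Sum>i=j * b n + 1..j * b n + b n. X t n i \<omega>)
        - real (b n) / real n * (\<Sum>i=1..n. X t n i \<omega>))\<^sup>2) / real n
        - (\<integral>\<omega>. (\<Sum>i=1..n. X t n i \<omega>)\<^sup>2 \<partial>M) / real n\<bar> \<partial>M) \<longlonglongrightarrow> 0"
        by (rule weakly_dependent_block_variance[OF wd b_top bn])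
      show "eventually (\<lambda>n. (\<integral>\<omega>. \<bar>(\<Sum>j<n div b n. ((\<Sum>i=j * b n + 1..j * b n + b n. X t n i \<omega>)
        - real (b n) / real n * (\<Sum>i=1..n. X t n i \<omega>))\<^sup>2) / real n
        - (\<integral>\<omega>. (\<Sum>i=1..n. X t n i \<omega>)\<^sup>2 \<partial>M) / real n\<bar> \<partial>M) = expectation (\<lambda>\<omega>. \<bar>v t n \<omega> - \<sigma> n\<bar>)) sequentially"
        using eventually_ge_at_top[of 1] by eventually_elim (simp add: v_eq \<sigma>_def T_def)
    qed
    \<comment> \<open>Both characteristic functions are compared with
      \<open>exp (- \<sigma> n / 2)\<close>: the conditional one because \<open>exp (- x)\<close> is
      1-Lipschitz for nonnegative \<open>x\<close>, that of \<open>S n\<close> by the central limit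
      theorem.\<close>
    have "?L n \<le> expectation (\<lambda>\<omega>. \<bar>v t n \<omega> - \<sigma> n\<bar>) / 2 + err n" if n: "1 \<le> n" for n
    proof -
      interpret wd: weakly_dependent M "\<lambda>l. gen_sigma M {1..min l n} (Y n)" "X t n" n "A t" "C' t" using n by (rule wd)
      have vi: "integrable M (v t n)"
      proof -
        have e: "v t n \<omega> = (\<Sum>j<n div b n. (wd.S {j * b n + 1..j * b n + b n} \<omega> - real (b n) / real n * wd.S {1..n} \<omega>)\<^sup>2) / real n" for \<omega>
          unfolding v_eq[OF n] wd.S_def ..
        have sub: "{j * b n + 1..j * b n + b n} \<subseteq> {1..n}" if "j < n div b n" for j
          using block_subset[of "Suc j" n "b n"] that by (auto simp: block_def)
        have sq: "(x - c * y)\<^sup>2 = x\<^sup>2 - 2 * c * (x * y) + c\<^sup>2 * y\<^sup>2" for x y c :: real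
          by (simp add: power2_diff power_mult_distrib)
        have "integrable M (\<lambda>\<omega>. (wd.S {j * b n + 1..j * b n + b n} \<omega> - real (b n) / real n * wd.S {1..n} \<omega>)\<^sup>2)" if "j < n div b n" for j
          unfolding sq using sub[OF that]
          by (intro Bochner_Integration.integrable_add Bochner_Integration.integrable_diff integrable_mult_right
              wd.S_square_integrable wd.S_integrable_product) auto
        then show ?thesis unfolding e[abs_def] by (intro integrable_divide Bochner_Integration.integrable_sum) auto
      qed
      have cS: "cmod ((\<integral>\<omega>. iexp (t \<bullet> S n \<omega>) \<partial>M) - complex_of_real (exp (- \<sigma> n / 2))) \<le> err n"
        using clt[OF wd[OF n] n] unfolding tS \<sigma>_def T_def by (simp add: exp_of_real mult.commute)
      have "?L n \<le> expectation (\<lambda>\<omega>. \<bar>v t n \<omega> - \<sigma> n\<bar> / 2 + err n)"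
      proof (rule integral_mono)
        let ?c = "\<integral>\<omega>. iexp (t \<bullet> S n \<omega>) \<partial>M"
        have vm: "v t n \<in> borel_measurable M" using vi by simp
        have le: "cmod ((\<integral>\<omega>'. iexp (t \<bullet> W n \<omega> \<omega>') \<partial>M) - ?c) \<le> \<bar>v t n \<omega> - \<sigma> n\<bar> / 2 + err n" for \<omega>
        proof -
          have "cmod (complex_of_real (exp (- v t n \<omega> / 2)) - complex_of_real (exp (- \<sigma> n / 2))) \<le> \<bar>v t n \<omega> / 2 - \<sigma> n / 2\<bar>"
            unfolding of_real_diff[symmetric] norm_of_real
            using exp_minus_diff_le[of "v t n \<omega> / 2" "\<sigma> n / 2"] v0 \<sigma>0 by simp
          moreover have "\<bar>v t n \<omega> / 2 - \<sigma> n / 2\<bar> = \<bar>v t n \<omega> - \<sigma> n\<bar> / 2"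
            by (simp add: diff_divide_distrib[symmetric])
          ultimately show ?thesis
            unfolding charW using cS norm_triangle_ineq4[of "complex_of_real (exp (- v t n \<omega> / 2)) - complex_of_real (exp (- \<sigma> n / 2))" "?c - complex_of_real (exp (- \<sigma> n / 2))"]
            by simp
        qed
        then show "cmod ((\<integral>\<omega>'. iexp (t \<bullet> W n \<omega> \<omega>') \<partial>M) - ?c) \<le> \<bar>v t n \<omega> - \<sigma> n\<bar> / 2 + err n" for \<omega> .
        show i: "integrable M (\<lambda>\<omega>. \<bar>v t n \<omega> - \<sigma> n\<bar> / 2 + err n)" using vi by simp
        show "integrable M (\<lambda>\<omega>. cmod ((\<integral>\<omega>'. iexp (t \<bullet> W n \<omega> \<omega>') \<partial>M) - ?c))"
        proof (rule Bochner_Integration.integrable_bound[OF i])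
          show "AE \<omega> in M. norm (cmod ((\<integral>\<omega>'. iexp (t \<bullet> W n \<omega> \<omega>') \<partial>M) - ?c)) \<le> norm (\<bar>v t n \<omega> - \<sigma> n\<bar> / 2 + err n)"
            using le by (intro AE_I2) (auto intro: order_trans[OF _ abs_ge_self])
          show "(\<lambda>\<omega>. cmod ((\<integral>\<omega>'. iexp (t \<bullet> W n \<omega> \<omega>') \<partial>M) - ?c)) \<in> borel_measurable M"
            unfolding charW using vm by measurable
        qed
      qed
      also have "\<dots> = expectation (\<lambda>\<omega>. \<bar>v t n \<omega> - \<sigma> n\<bar>) / 2 + err n" using vi by (simp add: prob_space)
      finally show ?thesis .
    qed
    then have ev: "eventually (\<lambda>n. ?L n \<le> expectation (\<lambda>\<omega>. \<bar>v t n \<omega> - \<sigma> n\<bar>) / 2 + err n) sequentially"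
      using eventually_ge_at_top[of "1 :: nat"] by (elim eventually_mono)
    have "(\<lambda>n. expectation (\<lambda>\<omega>. \<bar>v t n \<omega> - \<sigma> n\<bar>) / 2 + err n) \<longlonglongrightarrow> 0 / 2 + 0"
      by (intro tendsto_intros lim err) simp
    then have "(\<lambda>n. expectation (\<lambda>\<omega>. \<bar>v t n \<omega> - \<sigma> n\<bar>) / 2 + err n) \<longlonglongrightarrow> 0" by simp
    then show ?thesis
      by (intro tendsto_sandwich[OF _ ev tendsto_const]) (simp_all add: integral_nonneg_AE)
  qed

  \<comment> \<open>The second moment of \<open>S n\<close> is summed over coordinate directions;
    each contributes the constant of \<open>S_second_moment_le\<close>, which is linear in the
    number of terms and thus bounded after division by \<open>n\<close>.\<close>
  define D :: real where "D = (\<Sum>j\<in>(UNIV :: 'd set). 5 * (1 + 3 * A (axis j 1) + C' (axis j 1)))"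
  have norm_S: "(norm (S n \<omega>))\<^sup>2 = (\<Sum>j\<in>UNIV. (T (axis j 1) n \<omega>)\<^sup>2 / real n)" for n \<omega>
  proof -
    have "S n \<omega> $ j = 1 / sqrt (real n) * T (axis j 1) n \<omega>" for j
      using tS[of "axis j 1" n \<omega>] by (simp add: inner_axis')
    then show ?thesis
      unfolding power2_norm_eq_inner inner_vec_def by (simp add: power2_eq_square)
  qed
  have T_moment: "integrable M (\<lambda>\<omega>. (T (axis j 1) n \<omega>)\<^sup>2 / real n)"
    "expectation (\<lambda>\<omega>. (T (axis j 1) n \<omega>)\<^sup>2 / real n) \<le> 5 * (1 + 3 * A (axis j 1) + C' (axis j 1))" for j n
  proof -
    \<comment> \<open>This instance at row 1 supplies the nonnegativity of the constants in the case
      \<open>n = 0\<close>, where division by 0 makes the normalised square vanish.\<close>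
    interpret w1: weakly_dependent M "\<lambda>l. gen_sigma M {1..min l 1} (Y 1)" "X (axis j 1) 1" 1 "A (axis j 1)" "C' (axis j 1)"
      by (rule wd) simp
    have "integrable M (\<lambda>\<omega>. (T (axis j 1) n \<omega>)\<^sup>2 / real n) \<and>
      expectation (\<lambda>\<omega>. (T (axis j 1) n \<omega>)\<^sup>2 / real n) \<le> 5 * (1 + 3 * A (axis j 1) + C' (axis j 1))"
    proof (cases "1 \<le> n")
      case True
      interpret w: weakly_dependent M "\<lambda>l. gen_sigma M {1..min l n} (Y n)" "X (axis j 1) n" n "A (axis j 1)" "C' (axis j 1)"
        using True by (rule wd)
      show ?thesis
        using w.S_square_integrable[of "{1..n}"] w.S_second_moment_le[of "{1..n}"] True
        by (simp add: T_def w.S_def w.D_def divide_le_eq)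
    next
      case False
      then show ?thesis using w1.nonneg by (simp add: not_le)
    qed
    then show "integrable M (\<lambda>\<omega>. (T (axis j 1) n \<omega>)\<^sup>2 / real n)"
      "expectation (\<lambda>\<omega>. (T (axis j 1) n \<omega>)\<^sup>2 / real n) \<le> 5 * (1 + 3 * A (axis j 1) + C' (axis j 1))" by auto
  qed
  have tight: "integrable M (\<lambda>\<omega>. (norm (S n \<omega>))\<^sup>2)" "(\<integral>\<omega>. (norm (S n \<omega>))\<^sup>2 \<partial>M) \<le> D" for n
  proof -
    show "integrable M (\<lambda>\<omega>. (norm (S n \<omega>))\<^sup>2)"
      unfolding norm_S by (intro Bochner_Integration.integrable_sum T_moment)
    have "(\<integral>\<omega>. (norm (S n \<omega>))\<^sup>2 \<partial>M) = (\<Sum>j\<in>UNIV. expectation (\<lambda>\<omega>. (T (axis j 1) n \<omega>)\<^sup>2 / real n))"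
      unfolding norm_S by (rule Bochner_Integration.integral_sum) (rule T_moment)
    also have "\<dots> \<le> D" unfolding D_def by (intro sum_mono T_moment)
    finally show "(\<integral>\<omega>. (norm (S n \<omega>))\<^sup>2 \<partial>M) \<le> D" .
  qed
  have conv: "(\<lambda>n. \<integral>\<omega>. \<bar>(\<integral>\<omega>'. f (W n \<omega> \<omega>') \<partial>M) - (\<integral>\<omega>. f (S n \<omega>) \<partial>M)\<bar> \<partial>M) \<longlonglongrightarrow> 0"
    by (rule conditional_char_convergence[OF assms(1) assms(1) Wm Sm char tight f_cont B])

  define Z where "Z n \<omega> = real_cond_exp M (gen_sigma M {1..n} (Y n)) (\<lambda>\<omega>'. f (multiplier_sum (Y n) e n (b n) \<omega>')) \<omega>
      - (\<integral>\<omega>'. f (centered_sum M (Y n) n \<omega>') \<partial>M)" for n \<omega>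
  have cond: "AE \<omega> in M. Z n \<omega> = (\<integral>\<omega>'. f (W n \<omega> \<omega>') \<partial>M) - (\<integral>\<omega>. f (S n \<omega>) \<partial>M)" for n
  proof -
    define V where "V \<omega> = (\<lambda>i\<in>{1..n}. Y n i \<omega>)" for \<omega>
    define E where "E \<omega> = (\<lambda>l\<in>{1::nat..}. e l \<omega>)" for \<omega>
    \<comment> \<open>The coordinates of the two sequence spaces serve as data and multipliers, so
      the conditioned variable becomes a function of \<open>(V, E)\<close> as the freezing lemma
      requires.\<close>
    define \<Phi> where "\<Phi> p = f (multiplier_sum (\<lambda>i p. fst p i) (\<lambda>l p. snd p l) n (b n) p)" for p :: "(nat \<Rightarrow> real ^ 'd) \<times> (nat \<Rightarrow> real)"
    let ?MV = "PiM {1..n} (\<lambda>_. borel :: (real ^ 'd) measure)" and ?ME = "PiM {1::nat..} (\<lambda>_. borel :: real measure)"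
    have V: "V \<in> M \<rightarrow>\<^sub>M ?MV" unfolding V_def[abs_def] using Ym by (intro measurable_restrict) auto
    have E: "E \<in> M \<rightarrow>\<^sub>M ?ME" unfolding E_def[abs_def] using em by (intro measurable_restrict) auto
    have ind: "indep_set (sets (vimage_algebra (space M) V ?MV)) (sets (vimage_algebra (space M) E ?ME))"
    proof -
      let ?I = "{(n, i). 1 \<le> i \<and> i \<le> n}"
      have sub: "sets (gen_sigma M {1..n} (Y n)) \<subseteq> sets (gen_sigma M ?I (\<lambda>(n, i). Y n i))"
      proof (rule sets_gen_sigma_subset)
        fix i assume "i \<in> {1..n}"
        then have "(n, i) \<in> ?I" by auto
        from gen_sigma_measurable[OF this, where X = "\<lambda>(n, i). Y n i" and M = M]
        show "Y n i \<in> borel_measurable (gen_sigma M ?I (\<lambda>(n, i). Y n i))" by simp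
      qed simp
      \<comment> \<open>The independence assumption concerns the multipliers and the whole array; it
        is restricted to row \<open>n\<close> and its two sides are exchanged.\<close>
      have "indep_set (sets (gen_sigma M {1..n} (Y n))) (sets (gen_sigma M {1..} e))"
      proof (rule indep_setI)
        show "sets (gen_sigma M {1..n} (Y n)) \<subseteq> events" "sets (gen_sigma M {1..} e) \<subseteq> events"
          by (intro sets_gen_sigma_subset; use Ym em in simp)+
        show "prob (x \<inter> y) = prob x * prob y" if "x \<in> sets (gen_sigma M {1..n} (Y n))" "y \<in> sets (gen_sigma M {1..} e)" for x y
          using indep_setD[OF assms(11) that(2) subsetD[OF sub that(1)]] by (simp only: Int_commute mult.commute)
      qed
      then show ?thesis by (simp add: gen_sigma_def V_def[abs_def] E_def[abs_def])
    qed
    have \<Phi>m: "\<Phi> \<in> borel_measurable (?MV \<Otimes>\<^sub>M ?ME)"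
    proof -
      have "multiplier_sum (\<lambda>i p. fst p i) (\<lambda>l p. snd p l) n (b n) \<in> borel_measurable (?MV \<Otimes>\<^sub>M ?ME)"
      proof (rule multiplier_sum_measurable)
        show "(\<lambda>p. fst p i) \<in> borel_measurable (?MV \<Otimes>\<^sub>M ?ME)" if "i \<in> {1..n}" for i
          using that by (intro measurable_compose[OF measurable_fst measurable_component_singleton]) auto
        show "(\<lambda>p. snd p l) \<in> borel_measurable (?MV \<Otimes>\<^sub>M ?ME)" if "1 \<le> l" for l
          using that by (intro measurable_compose[OF measurable_snd measurable_component_singleton]) auto
      qed
      then show ?thesis unfolding \<Phi>_def[abs_def] by measurable
    qed
    have "\<Phi> (V \<omega>, E \<omega>) = f (multiplier_sum (Y n) e n (b n) \<omega>)" for \<omega>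
      unfolding \<Phi>_def by (intro arg_cong[of _ _ f] multiplier_sum_cong) (simp_all add: V_def E_def)
    moreover have "\<Phi> (V \<omega>, E \<omega>') = f (W n \<omega> \<omega>')" for \<omega> \<omega>'
      unfolding \<Phi>_def W_def by (intro arg_cong[of _ _ f] multiplier_sum_cong) (simp_all add: V_def E_def)
    moreover have "AE \<omega> in M. real_cond_exp M (vimage_algebra (space M) V ?MV) (\<lambda>\<omega>. \<Phi> (V \<omega>, E \<omega>)) \<omega>
        = (\<integral>\<omega>'. \<Phi> (V \<omega>, E \<omega>') \<partial>M)"
      by (rule real_cond_exp_independent[OF V E ind \<Phi>m, of B]) (simp add: \<Phi>_def B)
    moreover have "gen_sigma M {1..n} (Y n) = vimage_algebra (space M) V ?MV"
      by (simp add: gen_sigma_def V_def[abs_def])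
    ultimately show ?thesis by (simp add: Z_def S_def)
  qed
  have Zm: "Z n \<in> borel_measurable M" for n unfolding Z_def[abs_def] by measurable
  have Zi: "integrable M (Z n)" for n
  proof -
    have W': "(\<lambda>\<omega>'. f (W n \<omega> \<omega>')) \<in> borel_measurable M" if "\<omega> \<in> space M" for \<omega>
      using measurable_compose[OF measurable_compose[OF measurable_Pair1'[OF that] Wm] fm] by simp
    have "integrable M (\<lambda>\<omega>. \<integral>\<omega>'. f (W n \<omega> \<omega>') \<partial>M)"
    proof (rule integrable_const_bound[where B = B])
      show "AE \<omega> in M. norm (\<integral>\<omega>'. f (W n \<omega> \<omega>') \<partial>M) \<le> B"
      proof (rule AE_I2)
        fix \<omega> assume "\<omega> \<in> space M"
        then have "integrable M (\<lambda>\<omega>'. f (W n \<omega> \<omega>'))" using B W' by (intro integrable_const_bound[where B = B]) auto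
        then have "(\<integral>\<omega>'. \<bar>f (W n \<omega> \<omega>')\<bar> \<partial>M) \<le> B" using B by (intro integral_le_const AE_I2) auto
        then show "norm (\<integral>\<omega>'. f (W n \<omega> \<omega>') \<partial>M) \<le> B"
          unfolding real_norm_def by (rule order_trans[OF integral_abs_bound])
      qed
      have "case_prod (\<lambda>\<omega> \<omega>'. f (W n \<omega> \<omega>')) \<in> borel_measurable (M \<Otimes>\<^sub>M M)"
        using measurable_compose[OF Wm fm] by (simp add: split_beta')
      then show "(\<lambda>\<omega>. \<integral>\<omega>'. f (W n \<omega> \<omega>') \<partial>M) \<in> borel_measurable M" by (rule borel_measurable_lebesgue_integral)
    qed
    then have "integrable M (\<lambda>\<omega>. (\<integral>\<omega>'. f (W n \<omega> \<omega>') \<partial>M) - (\<integral>\<omega>. f (S n \<omega>) \<partial>M))" by simp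
    \<comment> \<open>The conditional expectation is determined only almost everywhere;
      integrability is inherited from the explicit version.\<close>
    then show ?thesis using cond[of n] Zm by (subst integrable_cong_AE) auto
  qed
  have lim: "(\<lambda>n. expectation (\<lambda>\<omega>. \<bar>Z n \<omega>\<bar>)) \<longlonglongrightarrow> 0"
  proof -
    have "expectation (\<lambda>\<omega>. \<bar>Z n \<omega>\<bar>) = (\<integral>\<omega>. \<bar>(\<integral>\<omega>'. f (W n \<omega> \<omega>') \<partial>M) - (\<integral>\<omega>. f (S n \<omega>) \<partial>M)\<bar> \<partial>M)" for n
    proof (rule integral_cong_AE)
      have "case_prod (\<lambda>\<omega> \<omega>'. f (W n \<omega> \<omega>')) \<in> borel_measurable (M \<Otimes>\<^sub>M M)"
        using measurable_compose[OF Wm fm] by (simp add: split_beta')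
      then have "(\<lambda>\<omega>. \<integral>\<omega>'. f (W n \<omega> \<omega>') \<partial>M) \<in> borel_measurable M" by (rule borel_measurable_lebesgue_integral)
      then show "(\<lambda>\<omega>. \<bar>(\<integral>\<omega>'. f (W n \<omega> \<omega>') \<partial>M) - (\<integral>\<omega>. f (S n \<omega>) \<partial>M)\<bar>) \<in> borel_measurable M" by simp
      show "AE \<omega> in M. \<bar>Z n \<omega>\<bar> = \<bar>(\<integral>\<omega>'. f (W n \<omega> \<omega>') \<partial>M) - (\<integral>\<omega>. f (S n \<omega>) \<partial>M)\<bar>"
        using cond[of n] by eventually_elim simp
    qed (use Zm in simp)
    then show ?thesis using conv by simp
  qed
  have "converges_in_prob M Z 0"
    unfolding converges_in_prob_def
  proof (intro allI impI)
    fix \<epsilon> :: real assume \<epsilon>: "0 < \<epsilon>"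
    \<comment> \<open>Markov's inequality: convergence in mean is passed on to convergence in
      probability.\<close>
    have le: "measure M {\<omega> \<in> space M. \<epsilon> < \<bar>Z n \<omega> - 0\<bar>} \<le> expectation (\<lambda>\<omega>. \<bar>Z n \<omega>\<bar>) / \<epsilon>" for n
    proof -
      have "measure M {\<omega> \<in> space M. \<epsilon> < \<bar>Z n \<omega> - 0\<bar>} \<le> measure M {\<omega> \<in> space M. \<bar>Z n \<omega>\<bar> \<ge> \<epsilon>}"
        using Zm[of n] by (intro finite_measure_mono) auto
      also have "\<dots> \<le> expectation (\<lambda>\<omega>. \<bar>Z n \<omega>\<bar>) / \<epsilon>"
        using integral_Markov_inequality_measure[of M "\<lambda>\<omega>. \<bar>Z n \<omega>\<bar>" "{}" \<epsilon>] Zi \<epsilon> by simp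
      finally show ?thesis .
    qed
    have l: "(\<lambda>n. expectation (\<lambda>\<omega>. \<bar>Z n \<omega>\<bar>) / \<epsilon>) \<longlonglongrightarrow> 0" using tendsto_divide[OF lim tendsto_const[of \<epsilon>]] \<epsilon> by simp
    show "(\<lambda>n. measure M {\<omega> \<in> space M. \<epsilon> < \<bar>Z n \<omega> - 0\<bar>}) \<longlonglongrightarrow> 0"
      by (rule tendsto_sandwich[OF always_eventually always_eventually tendsto_const l])
        (use le in \<open>simp_all only: measure_nonneg simp_thms\<close>)
  qed
  then show ?thesis unfolding Z_def[abs_def] .
qed

end
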